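(* Let $0 < \kappa < 1/2$. Let $\Psi:\mathbb{R}_{\geq 1}\to \mathbb{R}$ be a strictly increasing function with $X\leq \Psi(X)\leq \exp(X^{1/2-\kappa})$ for all sufficiently large $X$. Suppose that for every fixed integer $k\ge0$ and every fixed $\eta>0$, with $H(X)=\Psi^{-1}(X^{\eta})$ one has $$\int_X^{2X} \| \lambda \|_{U^{k+1}([x,x+H(X)])}\, dx = o(X)\quad (X\to\infty).$$ Then $s(k)\geq \Psi(k)$ for all sufficiently large $k$.
   Context: $\lambda$ is the Liouville function, extended by zero to non-positive integers. $s(k)$ is the number of vectors $v\in\{-1,+1\}^k$ with $v=(\lambda(n+1),\ldots,\lambda(n+k))$ for some $n\in\mathbb{N}$. For finitely supported $f:\mathbb{Z}\to\mathbb{C}$, $\| f \|_{U^{k+1}(\mathbb{Z})} \coloneqq \big( \sum_{y,h_1,\dots,h_{k+1} \in \mathbb{Z}} \prod_{\omega \in \{0,1\}^{k+1}} \mathcal{C}^{|\omega|} f(y+\omega_1 h_1+\dots+\omega_{k+1} h_{k+1}) \big)^{1/2^{k+1}}$ ($\mathcal{C}$ complex conjugation, $|\omega|=\sum\omega_i$), and $\| f \|_{U^{k+1}([x,x+H])} \coloneqq \| f 1_{[x,x+H]} \|_{U^{k+1}(\mathbb{Z})} / \| 1_{[x,x+H]} \|_{U^{k+1}(\mathbb{Z})}$. *)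

theory Defs
  imports
    "HOL-Analysis.Analysis"
    "HOL-Computational_Algebra.Primes"
    "HOL-Library.Landau_Symbols"
begin

definition liouville :: "int \<Rightarrow> int" where
  "liouville n = (if n > 0 then (-1) ^ size (prime_factorization n) else 0)"

text \<open>
  Vectors of length \<open>k\<close> are functions on \<open>{1..k}\<close>, extensional outside, so that they are counted
  without repetition. The natural numbers are taken to start at \<open>1\<close>, hence \<open>n \<ge> 1\<close>.
\<close>

definition sign_patterns :: "nat \<Rightarrow> (nat \<Rightarrow> int) set" where
  "sign_patterns k =
    {v \<in> {1..k} \<rightarrow>\<^sub>E {-1, 1}. \<exists>n::nat. n \<ge> 1 \<and> (\<forall>i\<in>{1..k}. v i = liouville (int (n + i)))}"

definition sign_pattern_count :: "nat \<Rightarrow> nat" where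
  "sign_pattern_count k = card (sign_patterns k)"

text \<open>
  \<open>gowers_norm d f\<close> is the norm \<open>U\<^sup>d(\<int>)\<close> for \<open>d \<ge> 1\<close>. For finitely supported \<open>f\<close> only finitely many
  \<open>(y, h)\<close> contribute (the product contains \<open>f y\<close> and each \<open>f (y + h i)\<close>, up to conjugation), so the
  infinite sum is a finite one; its value is a nonnegative real, so taking \<open>Re\<close> loses nothing.
\<close>

definition gowers_sum :: "nat \<Rightarrow> (int \<Rightarrow> complex) \<Rightarrow> complex" where
  "gowers_sum d f =
    (\<Sum>\<^sub>\<infinity>(y, h) \<in> (UNIV :: int set) \<times> ({1..d} \<rightarrow>\<^sub>E (UNIV :: int set)).
       \<Prod>\<omega> \<in> {1..d} \<rightarrow>\<^sub>E {0, 1::nat}.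
         (cnj ^^ (\<Sum>i=1..d. \<omega> i)) (f (y + (\<Sum>i=1..d. int (\<omega> i) * h i))))"

definition gowers_norm :: "nat \<Rightarrow> (int \<Rightarrow> complex) \<Rightarrow> real" where
  "gowers_norm d f = Re (gowers_sum d f) powr (1 / 2 ^ d)"

definition interval_indicator :: "real \<Rightarrow> real \<Rightarrow> int \<Rightarrow> complex" where
  "interval_indicator a b n = indicator {a..b} (real_of_int n)"

definition local_gowers_norm :: "nat \<Rightarrow> real \<Rightarrow> real \<Rightarrow> (int \<Rightarrow> complex) \<Rightarrow> real" where
  "local_gowers_norm d a b f =
    gowers_norm d (\<lambda>n. f n * interval_indicator a b n) / gowers_norm d (interval_indicator a b)"

text \<open>
  A strictly increasing function on \<open>[1, \<infinity>)\<close> need not be continuous, so its range may have gaps. The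
  inverse below agrees with the ordinary inverse on the range and is its unique monotone extension to
  the gaps. Values below \<open>\<Psi> 1\<close> are irrelevant (the set is then empty).
\<close>

definition increasing_inverse :: "(real \<Rightarrow> real) \<Rightarrow> real \<Rightarrow> real" where
  "increasing_inverse \<Psi> y = Sup {x. 1 \<le> x \<and> \<Psi> x \<le> y}"

lemma increasing_inverse_eq:
  assumes "strict_mono_on {1..} \<Psi>" and "1 \<le> x"
  shows "increasing_inverse \<Psi> (\<Psi> x) = x"
  unfolding increasing_inverse_def
proof (rule cSup_eq_maximum)
  show "x \<in> {z. 1 \<le> z \<and> \<Psi> z \<le> \<Psi> x}" using assms by simp
next
  fix z assume "z \<in> {z. 1 \<le> z \<and> \<Psi> z \<le> \<Psi> x}"
  then have z: "1 \<le> z" "\<Psi> z \<le> \<Psi> x" by auto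
  show "z \<le> x"
  proof (rule ccontr)
    assume "\<not> z \<le> x"
    then have "\<Psi> x < \<Psi> z"
      using strict_mono_onD[OF assms(1), of x z] assms(2) z(1) by simp
    with z(2) show False by simp
  qed
qed

end

theory Submission
  imports Defs "HOL-Real_Asymp.Real_Asymp"
begin

text \<open>
  Suppose that \<open>s(k) < \<Psi>(k)\<close> for arbitrarily large \<open>k\<close>, and put \<open>X = \<Psi>(k)^(1/\<eta>)\<close> with \<open>\<eta> = \<kappa>/20\<close>, so that
  \<open>H(X) = k\<close>. For primes \<open>p\<close> up to a constant times \<open>k\<close>, multiplicativity turns a correlation of
  \<open>\<lambda>(n + h)\<close>, \<open>h \<in> B\<close>, with \<open>n \<sim> X/p\<close> into one of \<open>\<lambda>(n + p h)\<close> over the multiples \<open>n \<sim> X\<close> of \<open>p\<close>. As there are at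
  most \<open>X^\<eta>\<close> patterns, a high moment of \<open>p 1[p dvd n + j] - 1\<close> and a union bound over the patterns
  show that the restriction to multiples can be dropped on average over \<open>p\<close>. The remaining averages
  of \<open>\<lambda>(n + j + p h)\<close> over \<open>j\<close> and \<open>p\<close> are controlled by local Gowers norms: the primes are majorised by a
  Brun--Hooley sieve weight whose cube correlations are close to 1. Hence all correlations of fixed
  tuples are small on a common set of scales, every pattern of every fixed length \<open>M\<close> occurs, and
  \<open>s(M) = 2^M\<close> for all \<open>M\<close>. This contradicts \<open>s(k) < \<Psi>(k) \<le> exp (k^(1/2 - \<kappa>))\<close>.
\<close>

section \<open>Primes\<close>

text \<open>Two obstacles shape the argument. First, the deviation of
  \<open>p 1[p dvd n + j]\<close> from 1 must be small against the pattern that occurs near n, and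
  this pattern depends on n; hence the union bound over all patterns. The 2r-th moment over about k
  / ln k primes saves (r^2 ln k / k)^r up to constants, and this has to beat the number exp y of
  patterns, where \<Psi>(k) = exp y. It does once r is a suitable multiple of y / ln k, provided
  that r^2 is smaller than k by a power of k: this is the origin of the exponent 1/2 - \<kappa>. The
  moduli in this moment reach k^(2r), so X must be a large power of \<Psi>(k), which fixes \<eta>.
  Second, the primes have density 1 / ln k, and a bound for averages over all integers d would lose
  this factor. Transfer through a sieve weight loses only a constant depending on the lower cutoff b
  of the sieve, provided that the cube correlations are closer to 1 than this constant requires. So
  b is chosen from the desired accuracy alone and the Gowers norm threshold \<delta> after it; a
  bound o(X) without any rate is then enough.\<close>

definition dexp :: "nat \<Rightarrow> nat" where "dexp i = 2 ^ 2 ^ i"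

definition primes_between :: "nat \<Rightarrow> nat \<Rightarrow> nat set" where
  "primes_between a b = {p. prime p \<and> a < p \<and> p \<le> b}"

lemma finite_primes_between [simp, intro]: "finite (primes_between a b)"
  by (rule finite_subset[of _ "{..b}"]) (auto simp: primes_between_def)

lemma primes_between_Un:
  assumes "a \<le> b" "b \<le> c"
  shows "primes_between a c = primes_between a b \<union> primes_between b c"
  using assms by (auto simp: primes_between_def)

lemma primes_between_same [simp]: "primes_between a a = {}"
  by (auto simp: primes_between_def)

lemma primes_between_disjoint: "primes_between a b \<inter> primes_between b c = {}"
  by (auto simp: primes_between_def)

section \<open>Chebyshev and Mertens bounds along the scale \<open>dexp\<close>\<close>

lemma primes_dvd_central_binomial:
  assumes "prime p" "n < p" "p \<le> 2 * n"
  shows "p dvd (2 * n) choose n"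
proof -
  have "fact n * fact n * ((2 * n) choose n) = (fact (2 * n) :: nat)"
    using binomial_fact_lemma[of n "2 * n"] by simp
  moreover have "p dvd (fact (2 * n) :: nat)"
    using assms by (simp add: prime_dvd_fact_iff)
  moreover have "\<not> p dvd (fact n :: nat)"
    using assms by (simp add: prime_dvd_fact_iff)
  ultimately show ?thesis
    using assms(1) by (metis prime_dvd_mult_iff)
qed

lemma prod_primes_dvd:
  fixes n :: nat
  assumes "finite A" "\<And>p. p \<in> A \<Longrightarrow> prime p" "\<And>p. p \<in> A \<Longrightarrow> p dvd n"
  shows "\<Prod>A dvd n"
  using assms
proof (induction A rule: finite_induct)
  case (insert p A)
  have "coprime p (\<Prod>A)"
    using insert.hyps insert.prems(1)
    by (intro prod_coprime_right) (metis insertI1 insertI2 primes_coprime)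
  with insert show ?case by (simp add: divides_mult)
qed simp

text \<open>The primes of a dyadic block all divide the central binomial coefficient of 2^(l+1) over
  2^l, which is at most 2^(2^(l+1)), while each of them exceeds 2^l.\<close>

lemma card_primes_dyadic_le: "l * card (primes_between (2 ^ l) (2 ^ Suc l)) \<le> 2 * 2 ^ l"
proof -
  define A where "A = primes_between (2 ^ l) (2 ^ Suc l)"
  have fin: "finite A" by (simp add: A_def)
  have dvd: "\<Prod>A dvd (2 * 2 ^ l) choose (2 ^ l)"
    using fin by (intro prod_primes_dvd primes_dvd_central_binomial) (auto simp: A_def primes_between_def)
  have "(2 ^ l) ^ card A = (\<Prod>p\<in>A. 2 ^ l :: nat)" by simp
  also have "\<dots> \<le> \<Prod>A" by (intro prod_mono) (auto simp: A_def primes_between_def)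
  also have "\<dots> \<le> (2 * 2 ^ l) choose (2 ^ l)" using dvd by (intro dvd_imp_le) auto
  also have "\<dots> \<le> 2 ^ (2 * 2 ^ l)" by (rule binomial_le_pow2)
  finally have "(2::nat) ^ (l * card A) \<le> 2 ^ (2 * 2 ^ l)" by (simp add: power_mult)
  then show ?thesis unfolding A_def by (subst (asm) power_increasing_iff) auto
qed

lemma sum_inverse_primes_dyadic_le:
  assumes "l \<ge> 1"
  shows "(\<Sum>p\<in>primes_between (2 ^ l) (2 ^ Suc l). 1 / real p) \<le> 2 / real l"
proof -
  let ?A = "primes_between (2 ^ l) (2 ^ Suc l)"
  have "(\<Sum>p\<in>?A. 1 / real p) \<le> (\<Sum>p\<in>?A. 1 / 2 ^ l)"
  proof (intro sum_mono divide_left_mono)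
    fix p assume "p \<in> ?A"
    then have "2 ^ l \<le> p" "p > 0" by (auto simp: primes_between_def)
    then show "(2::real) ^ l \<le> real p" by (simp add: numeral_power_le_of_nat_cancel_iff)
    from \<open>p > 0\<close> show "0 < real p * 2 ^ l" by simp
  qed auto
  also have "\<dots> = real (card ?A) / 2 ^ l" by simp
  also have "\<dots> \<le> 2 / real l"
  proof -
    have "real (l * card ?A) \<le> real (2 * 2 ^ l)" using card_primes_dyadic_le by (rule of_nat_mono)
    then show ?thesis using assms by (simp add: field_simps)
  qed
  finally show ?thesis .
qed

text \<open>Reason for the doubly exponential scale: between consecutive values of
  \<open>dexp\<close> there are 2^i dyadic blocks of weight at most 2 / 2^i each, so every range
  carries a bounded part of the sum of 1/p.\<close>

lemma sum_inverse_primes_dexp_le: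
  "(\<Sum>p\<in>primes_between (dexp i) (dexp (Suc i)). 1 / real p) \<le> 2"
proof -
  have *: "(\<Sum>p\<in>primes_between (2 ^ a) (2 ^ (a + j)). 1 / real p) \<le> (\<Sum>l\<in>{a..<a+j}. 2 / real l)"
    if "a \<ge> 1" for a j :: nat
  proof (induction j)
    case 0
    then show ?case by simp
  next
    case (Suc j)
    have "primes_between (2 ^ a) (2 ^ (a + Suc j))
        = primes_between (2 ^ a) (2 ^ (a + j)) \<union> primes_between (2 ^ (a + j)) (2 ^ Suc (a + j))"
      using primes_between_Un[of "2 ^ a" "2 ^ (a+j)" "2 ^ Suc (a + j)"] by simp
    then show ?case
      using Suc sum_inverse_primes_dyadic_le[of "a + j"] that
      by (simp add: sum.union_disjoint primes_between_disjoint del: power_Suc)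
  qed
  have "(\<Sum>p\<in>primes_between (dexp i) (dexp (Suc i)). 1 / real p) \<le> (\<Sum>l\<in>{2^i..<2^i+2^i}. 2 / real l)"
    using *[of "2 ^ i" "2 ^ i"] by (simp add: dexp_def mult_2)
  also have "\<dots> \<le> (\<Sum>l\<in>{2^i..<2^i+2^i::nat}. 2 / 2 ^ i)"
    by (intro sum_mono divide_left_mono) (auto simp: numeral_power_le_of_nat_cancel_iff intro!: mult_pos_pos)
  also have "\<dots> = 2" by simp
  finally show ?thesis .
qed

lemma dexp_mono: "i \<le> j \<Longrightarrow> dexp i \<le> dexp j"
  by (simp add: dexp_def)

lemma sum_inverse_primes_between_le:
  assumes "b \<le> L"
  shows "(\<Sum>p\<in>primes_between (dexp b) (dexp L). 1 / real p) \<le> 2 * real (L - b)"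
  using assms
proof (induction L rule: dec_induct)
  case base
  then show ?case by simp
next
  case (step L)
  have "primes_between (dexp b) (dexp (Suc L))
      = primes_between (dexp b) (dexp L) \<union> primes_between (dexp L) (dexp (Suc L))"
    using step by (intro primes_between_Un dexp_mono) auto
  then show ?case
    using step sum_inverse_primes_dexp_le[of L]
    by (simp add: sum.union_disjoint primes_between_disjoint Suc_diff_le)
qed

lemma one_minus_ge_exp:
  assumes "0 \<le> x" "x \<le> (1/2::real)"
  shows "exp (- 2 * x) \<le> 1 - x"
proof -
  have "- 2 * x \<le> - x - 2 * x\<^sup>2"
    using assms mult_left_mono[of x "1/2" x] by (simp add: power2_eq_square)
  also have "\<dots> \<le> ln (1 - x)" using assms by (intro ln_one_minus_pos_lower_bound)
  finally show ?thesis using assms by (subst (asm) ln_ge_iff) auto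
qed

lemma prod_one_minus_ge_exp:
  assumes "finite A" "\<And>a. a \<in> A \<Longrightarrow> 0 \<le> f a \<and> f a \<le> (1/2::real)"
  shows "exp (- 2 * sum f A) \<le> (\<Prod>a\<in>A. 1 - f a)"
proof -
  have "exp (- 2 * sum f A) = (\<Prod>a\<in>A. exp (- 2 * f a))"
    using assms(1) by (simp add: exp_sum[symmetric] sum_distrib_left sum_negf)
  also have "\<dots> \<le> (\<Prod>a\<in>A. 1 - f a)"
    using assms one_minus_ge_exp by (intro prod_mono) auto
  finally show ?thesis .
qed

text \<open>Euler's argument: multiplied out, the product of the truncated geometric series contains
  1/n for every n \<le> z, so it is at least the harmonic number and hence at least ln z.\<close>

lemma ln_le_prod_primes:
  "ln (real z) * (\<Prod>p\<in>primes_between 0 z. 1 - 1 / real p) \<le> 1"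
proof (cases "z = 0")
  case False
  define P where "P = primes_between 0 z"
  have finP: "finite P" by (simp add: P_def)
  have primeP: "prime p" if "p \<in> P" for p using that by (simp add: P_def primes_between_def)
  define F where "F n = restrict (\<lambda>p. multiplicity p n) P" for n :: nat
  define g where "g f = (\<Prod>p\<in>P. (1 / real p) ^ f p)" for f :: "nat \<Rightarrow> nat"
  have gF: "g (F n) = 1 / real n" if n: "n \<in> {1..z}" for n
  proof -
    have "n = (\<Prod>p\<in>prime_factors n. p ^ multiplicity p n)"
      using n by (subst prod_prime_factors) auto
    also have "\<dots> = (\<Prod>p\<in>P. p ^ multiplicity p n)"
    proof (rule prod.mono_neutral_left)
      show "prime_factors n \<subseteq> P"
      proof
        fix p assume "p \<in> prime_factors n"
        then have "prime p" "p dvd n" by (auto simp: in_prime_factors_iff)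
        moreover from this n have "p \<le> n" by (intro dvd_imp_le) auto
        ultimately show "p \<in> P" using n by (simp add: P_def primes_between_def prime_gt_0_nat)
      qed
      show "\<forall>p\<in>P - prime_factors n. p ^ multiplicity p n = 1"
        using n primeP by (auto simp: in_prime_factors_iff not_dvd_imp_multiplicity_0)
    qed (rule finP)
    finally have "real n = (\<Prod>p\<in>P. real p ^ multiplicity p n)" by (metis (no_types, lifting) of_nat_power of_nat_prod prod.cong)
    then show ?thesis
      by (simp add: g_def F_def power_one_over prod_dividef)
  qed
  \<comment> \<open>Different n have different exponent vectors because the vector determines the
    term 1/n.\<close>
  have inj: "inj_on F {1..z}"
  proof (rule inj_onI)
    fix m n assume "m \<in> {1..z}" "n \<in> {1..z}" "F m = F n"
    then have "1 / real m = 1 / real n" using gF by metis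
    with \<open>m \<in> {1..z}\<close> show "m = n" by auto
  qed
  \<comment> \<open>Truncating every series at the exponent z loses nothing: 2^e \<le> p^e \<le> n
    \<le> z forces e < z.\<close>
  have mult: "multiplicity p n \<le> z" if "n \<in> {1..z}" "p \<in> P" for n p
  proof -
    have "p ^ multiplicity p n \<le> n" using that by (intro dvd_imp_le multiplicity_dvd) auto
    moreover have "multiplicity p n < 2 ^ multiplicity p n" by (rule less_exp)
    moreover have "2 ^ multiplicity p n \<le> p ^ multiplicity p n"
      using primeP[OF that(2)] prime_ge_2_nat by (intro power_mono) auto
    moreover have "n \<le> z" using that by simp
    ultimately show ?thesis by linarith
  qed
  have "ln (real z) \<le> harm z"
    using ln_le_harm[of z] False by (smt (verit) ln_le_cancel_iff of_nat_0_less_iff bot_nat_0.not_eq_extremum)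
  also have "harm z = (\<Sum>n\<in>{1..z}. g (F n))"
    unfolding harm_def by (intro sum.cong) (auto simp: gF inverse_eq_divide)
  also have "\<dots> = sum g (F ` {1..z})" using inj by (simp add: sum.reindex)
  also have "\<dots> \<le> sum g (PiE P (\<lambda>_. {..z}))"
  proof (rule sum_mono2)
    show "finite (PiE P (\<lambda>_. {..z}))" using finP by (intro finite_PiE) auto
    show "F ` {1..z} \<subseteq> PiE P (\<lambda>_. {..z})" using mult by (auto simp: F_def)
  qed (auto simp: g_def intro!: prod_nonneg)
  also have "\<dots> = (\<Prod>p\<in>P. \<Sum>a\<le>z. (1 / real p) ^ a)"
    unfolding g_def using finP by (subst prod_sum_PiE) auto
  finally have 1: "ln (real z) \<le> (\<Prod>p\<in>P. \<Sum>a\<le>z. (1 / real p) ^ a)" .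
  have pos: "0 \<le> 1 - 1 / real p" if "p \<in> P" for p
    using primeP[OF that] prime_ge_1_nat[of p] by simp
  have "ln (real z) * (\<Prod>p\<in>P. 1 - 1 / real p)
      \<le> (\<Prod>p\<in>P. \<Sum>a\<le>z. (1 / real p) ^ a) * (\<Prod>p\<in>P. 1 - 1 / real p)"
    using 1 pos by (intro mult_right_mono prod_nonneg) auto
  also have "\<dots> = (\<Prod>p\<in>P. (1 - 1 / real p) * (\<Sum>a\<le>z. (1 / real p) ^ a))"
    by (simp add: prod.distrib mult.commute)
  also have "\<dots> \<le> 1"
  proof (rule prod_le_1)
    fix p assume p: "p \<in> P"
    have "(1 - 1 / real p) * (\<Sum>a\<le>z. (1 / real p) ^ a) = 1 - (1 / real p) ^ Suc z"
      by (simp only: one_diff_power_eq lessThan_Suc_atMost)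
    then show "0 \<le> (1 - 1 / real p) * (\<Sum>a\<le>z. (1 / real p) ^ a) \<and> (1 - 1 / real p) * (\<Sum>a\<le>z. (1 / real p) ^ a) \<le> 1"
      unfolding \<open>_ = 1 - (1 / real p) ^ Suc z\<close>
      using pos[OF p] power_le_one[of "1 / real p" "Suc z"] by (simp del: power_Suc)
  qed
  finally show ?thesis unfolding P_def .
qed simp

lemma prime_ge_2_real: "prime (p::nat) \<Longrightarrow> 1 / real p \<le> 1 / 2"
  using prime_ge_2_nat[of p] by (auto simp: field_simps)

lemma primes_between_inverse:
  "p \<in> primes_between a b \<Longrightarrow> 0 \<le> 1 / real p \<and> 1 / real p \<le> 1 / 2"
  using prime_ge_2_real[of p] by (simp add: primes_between_def)

text \<open>Far below the true order 2^(b - L), but enough to make the density positive and its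
  inverse at most a fixed power of \<open>dexp L\<close>.\<close>

lemma sieve_product_lower:
  assumes "b \<le> L"
  shows "exp (- 4 * real L) \<le> (\<Prod>p\<in>primes_between (dexp b) (dexp L). 1 - 1 / real p)"
proof -
  have "exp (- 4 * real L) \<le> exp (- 2 * (\<Sum>p\<in>primes_between (dexp b) (dexp L). 1 / real p))"
    using sum_inverse_primes_between_le[OF assms] assms by (simp add: of_nat_diff)
  also have "\<dots> \<le> (\<Prod>p\<in>primes_between (dexp b) (dexp L). 1 - 1 / real p)"
    by (intro prod_one_minus_ge_exp) (use primes_between_inverse in auto)
  finally show ?thesis .
qed

text \<open>Mertens' bound for all primes up to \<open>dexp L\<close>, divided by the contribution
  of the primes up to \<open>dexp b\<close>, which is at least exp (-(4b + 1)). The factor 2^(-L) is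
  the logarithm that matches the density of the primes.\<close>

lemma sieve_product_upper:
  assumes "b \<le> L"
  shows "(\<Prod>p\<in>primes_between (dexp b) (dexp L). 1 - 1 / real p) \<le> 2 * exp (4 * real b + 1) / 2 ^ L"
proof -
  define V where "V = (\<Prod>p\<in>primes_between (dexp b) (dexp L). 1 - 1 / real p)"
  define U where "U = (\<Prod>p\<in>primes_between 0 (dexp b). 1 - 1 / real p)"
  have V0: "V \<ge> 0" unfolding V_def
  proof (rule prod_nonneg)
    fix p assume "p \<in> primes_between (dexp b) (dexp L)"
    from primes_between_inverse[OF this] show "0 \<le> 1 - 1 / real p" by linarith
  qed
  \<comment> \<open>The ranges start above \<open>dexp 0 = 2\<close>, so the prime 2 has to be added
    by hand; it accounts for the 1 in the exponent 4b + 1.\<close>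
  have "primes_between 0 (dexp b) = insert 2 (primes_between (dexp 0) (dexp b))"
  proof -
    have "primes_between 0 2 = {2}"
    proof (rule set_eqI)
      fix p :: nat
      show "p \<in> primes_between 0 2 \<longleftrightarrow> p \<in> {2}"
      proof (cases "prime p")
        case True
        then show ?thesis using prime_ge_2_nat[of p] by (auto simp: primes_between_def)
      qed (auto simp: primes_between_def)
    qed
    moreover have "(2::nat) \<le> dexp b" using dexp_mono[of 0 b] by (simp add: dexp_def)
    ultimately show ?thesis
      using primes_between_Un[of 0 2 "dexp b"] by (simp add: dexp_def)
  qed
  moreover have "2 \<notin> primes_between (dexp 0) (dexp b)" by (simp add: primes_between_def dexp_def)
  ultimately have "(\<Sum>p\<in>primes_between 0 (dexp b). 1 / real p) \<le> 1 / 2 + 2 * real b"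
    using sum_inverse_primes_between_le[of 0 b] by simp
  then have "exp (- (4 * real b + 1)) \<le> exp (- 2 * (\<Sum>p\<in>primes_between 0 (dexp b). 1 / real p))"
    by simp
  also have "\<dots> \<le> U" unfolding U_def
    by (intro prod_one_minus_ge_exp) (use primes_between_inverse in auto)
  finally have U: "exp (- (4 * real b + 1)) \<le> U" .
  have "U * V = (\<Prod>p\<in>primes_between 0 (dexp L). 1 - 1 / real p)"
    unfolding U_def V_def using assms
    by (subst primes_between_Un[of 0 "dexp b" "dexp L"])
       (auto simp: prod.union_disjoint primes_between_disjoint dexp_mono)
  then have "ln (real (dexp L)) * (U * V) \<le> 1" using ln_le_prod_primes[of "dexp L"] by simp
  moreover have "ln (real (dexp L)) = 2 ^ L * ln 2" by (simp add: dexp_def ln_realpow)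
  moreover have "ln 2 \<ge> (1 / 2 :: real)"
    using ln_one_minus_pos_upper_bound[of "1/2"] by (simp add: ln_div)
  ultimately have *: "2 ^ L * (1 / 2) * (U * V) \<le> 1"
  proof -
    have "U * V \<ge> 0" using V0 U exp_ge_zero order_trans by (intro mult_nonneg_nonneg) blast+
    then have "2 ^ L * (1 / 2) * (U * V) \<le> 2 ^ L * ln 2 * (U * V)"
      using \<open>ln 2 \<ge> 1 / 2\<close> by (intro mult_right_mono mult_left_mono) auto
    also have "\<dots> \<le> 1"
      using \<open>ln (real (dexp L)) * (U * V) \<le> 1\<close> unfolding \<open>ln (real (dexp L)) = 2 ^ L * ln 2\<close> .
    finally show ?thesis .
  qed
  have "exp (- (4 * real b + 1)) * V \<le> U * V" using U V0 by (intro mult_right_mono)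
  also have "\<dots> \<le> 2 / 2 ^ L" using * by (simp add: field_simps)
  finally have "exp (4 * real b + 1) * (exp (- (4 * real b + 1)) * V) \<le> exp (4 * real b + 1) * (2 / 2 ^ L)"
    by (intro mult_left_mono) auto
  moreover have "exp (4 * real b + 1) * (exp (- (4 * real b + 1)) * V) = V"
    by (simp only: mult.assoc[symmetric] exp_add[symmetric]) simp
  ultimately show ?thesis unfolding V_def[symmetric] by (simp only: times_divide_eq_right mult.commute[of 2])
qed

text \<open>
  The entries \<open>1 / (k (n choose k))\<close> of the Leibniz triangle are integer combinations of
  \<open>1/1, \<dots>, 1/n\<close>. This makes every common multiple of \<open>1, \<dots>, 2m\<close> at least \<open>m (2m choose m)\<close>,
  whence the Chebyshev lower bound.
\<close>

lemma leibniz_triangle_integral: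
  fixes Q N :: nat
  assumes Q: "\<And>n. 1 \<le> n \<Longrightarrow> n \<le> N \<Longrightarrow> n dvd Q"
  shows "1 \<le> k \<Longrightarrow> k \<le> n \<Longrightarrow> n \<le> N \<Longrightarrow> \<exists>z::int. real Q / (real k * real (n choose k)) = of_int z"
proof (induction k arbitrary: n rule: nat_induct_at_least)
  case base
  then have "n dvd Q" using Q by simp
  then obtain c where "Q = n * c" by (rule dvdE)
  then show ?case using base by (intro exI[of _ "int c"]) simp
next
  case (Suc k n)
  obtain a where a: "real Q / (real k * real ((n - 1) choose k)) = of_int a"
  proof -
    have "k \<le> n - 1" "n - 1 \<le> N" using Suc.prems by linarith+
    then show ?thesis using Suc.IH[of "n - 1"] that by blast
  qed
  obtain c where c: "real Q / (real k * real (n choose k)) = of_int c"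
    using Suc.IH[of n] Suc.prems by auto
  have pos: "real (n choose k) > 0" using Suc.prems by simp
  have nk: "real n > real k" "real k > 0" using Suc by auto
  have 1: "real (Suc k) * real (n choose Suc k) = (real n - real k) * real (n choose k)"
  proof -
    have "Suc k * (n choose Suc k) = (n - k) * (n choose k)"
      using binomial_absorption[of k "n"] binomial_absorb_comp[of n k] by (metis Suc_times_binomial)
    then show ?thesis using Suc.prems by (metis Suc_leD of_nat_diff of_nat_mult)
  qed
  have 2: "real n * real ((n - 1) choose k) = (real n - real k) * real (n choose k)"
  proof -
    have "(n - k) * (n choose k) = n * ((n - 1) choose k)" by (rule binomial_absorb_comp)
    then show ?thesis using Suc.prems by (metis Suc_leD of_nat_diff of_nat_mult)
  qed
  have 3: "real ((n - 1) choose k) = (real n - real k) * real (n choose k) / real n"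
    using 2 nk by (simp add: field_simps)
  \<comment> \<open>The recursion of the triangle: an entry is the difference of two entries of the
    previous column, in rows n - 1 and n.\<close>
  have "real Q / (real (Suc k) * real (n choose Suc k))
      = real Q / (real k * real ((n - 1) choose k)) - real Q / (real k * real (n choose k))"
    unfolding 1 3 using pos nk by (simp add: divide_simps) (simp add: algebra_simps)
  then have "real Q / (real (Suc k) * real (n choose Suc k)) = of_int (a - c)"
    unfolding a c by simp
  then show ?case by blast
qed

lemma card_primes_lower:
  assumes "n \<ge> 2"
  shows "real n / (6 * ln (real n)) \<le> real (card (primes_between 0 n))"
proof -
  define P where "P = primes_between 0 n"
  define m where "m = n div 2"
  have m: "m \<ge> 1" "2 * m \<le> n" "3 * m \<ge> n" using assms by (auto simp: m_def)
  have "\<exists>e. p ^ e \<le> n \<and> n < p ^ (e + 1)" if "p \<in> P" for p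
    using that assms prime_ge_2_nat[of p] by (intro ex_power_ivl1) (auto simp: P_def primes_between_def)
  then obtain e where e: "\<And>p. p \<in> P \<Longrightarrow> p ^ e p \<le> n \<and> n < p ^ (e p + 1)" by metis
  \<comment> \<open>The least common multiple of 1, \<dots>, n. Each prime enters with its largest
    power not exceeding n, so \<open>Q\<close> is at most n to the number of primes.\<close>
  define Q where "Q = (\<Prod>p\<in>P. p ^ e p)"
  have Q0: "Q > 0" unfolding Q_def by (intro prod_pos) (auto simp: P_def primes_between_def)
  have dvd: "i dvd Q" if "1 \<le> i" "i \<le> n" for i
  proof (rule multiplicity_le_imp_dvd)
    show "i \<noteq> 0" using that by simp
    fix p :: nat assume p: "prime p"
    show "multiplicity p i \<le> multiplicity p Q"
    proof (cases "p dvd i")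
      case True
      then have "p \<le> i" using that by (intro dvd_imp_le) auto
      then have pP: "p \<in> P" using p that by (auto simp: P_def primes_between_def prime_gt_0_nat)
      have "multiplicity p Q = e p"
        unfolding Q_def using pP p by (subst multiplicity_prod_prime_powers) (auto simp: P_def primes_between_def)
      moreover have "p ^ multiplicity p i \<le> i" using that by (intro dvd_imp_le multiplicity_dvd) auto
      ultimately have "p ^ multiplicity p i < p ^ (e p + 1)" using e[OF pP] that by linarith
      then have "multiplicity p i < e p + 1"
        using prime_gt_1_nat[OF p] by (rule power_less_imp_less_exp[rotated])
      with \<open>multiplicity p Q = e p\<close> show ?thesis by simp
    qed (simp add: not_dvd_imp_multiplicity_0)
  qed
  obtain z :: int where z: "real Q / (real m * real ((2*m) choose m)) = of_int z"
    using leibniz_triangle_integral[of n Q m "2 * m"] dvd m by auto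
  have pos: "real m * real ((2*m) choose m) > 0" using m by simp
  have "of_int z > (0::real)" using z pos Q0 by (metis divide_pos_pos of_nat_0_less_iff)
  then have "1 \<le> real Q / (real m * real ((2*m) choose m))" using z by simp
  then have "real m * real ((2*m) choose m) \<le> real Q" using pos by (simp add: field_simps)
  moreover have "4 ^ m / (2 * real m) \<le> real ((2*m) choose m)"
    using central_binomial_lower_bound[of m] m by simp
  ultimately have "4 ^ m / 2 \<le> real Q"
    using m by (simp add: field_simps)
  moreover have "(2::real) ^ m \<le> 4 ^ m / 2"
  proof -
    have "(2::real) ^ 1 \<le> 2 ^ m" using m by (intro power_increasing) auto
    then have "2 * 2 ^ m \<le> (2::real) ^ m * 2 ^ m" by simp
    also have "\<dots> = 4 ^ m" by (simp flip: power_mult_distrib)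
    finally show ?thesis by simp
  qed
  moreover have "real Q \<le> real n ^ card P"
  proof -
    have "Q \<le> (\<Prod>p\<in>P. n)" unfolding Q_def using e by (intro prod_mono) auto
    then show ?thesis by (metis of_nat_mono of_nat_power prod_constant)
  qed
  ultimately have "(2::real) ^ m \<le> real n ^ card P" by linarith
  then have "ln ((2::real) ^ m) \<le> ln (real n ^ card P)" using assms by (subst ln_le_cancel_iff) auto
  then have 1: "real m * ln 2 \<le> real (card P) * ln (real n)" using assms by (simp add: ln_realpow)
  have "ln 2 \<ge> (1 / 2 :: real)"
    using ln_one_minus_pos_upper_bound[of "1/2"] by (simp add: ln_div)
  then have "real m * (1 / 2) \<le> real m * ln 2" by (intro mult_left_mono) auto
  with 1 m have "real n / 6 \<le> real (card P) * ln (real n)" by linarith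
  moreover have "ln (real n) > 0" using assms by simp
  ultimately show ?thesis unfolding P_def by (simp add: field_simps)
qed

section \<open>The Brun--Hooley sieve\<close>

definition esym :: "'a set \<Rightarrow> ('a \<Rightarrow> real) \<Rightarrow> nat \<Rightarrow> real" where
  "esym R \<beta> j = (\<Sum>e | e \<subseteq> R \<and> card e = j. prod \<beta> e)"

lemma esym_0: "finite R \<Longrightarrow> esym R \<beta> 0 = 1"
proof -
  assume "finite R"
  then have "{e. e \<subseteq> R \<and> card e = 0} = {{}}" by (auto dest: finite_subset)
  then show ?thesis by (simp add: esym_def)
qed

lemma esym_empty_Suc: "esym {} \<beta> (Suc j) = 0"
proof -
  have "{e. e \<subseteq> {} \<and> card e = Suc j} = ({} :: 'a set set)" by auto
  then show ?thesis unfolding esym_def by (metis sum.empty)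
qed

lemma esym_insert:
  assumes "finite R" "r \<notin> R"
  shows "esym (insert r R) \<beta> (Suc j) = esym R \<beta> (Suc j) + \<beta> r * esym R \<beta> j"
proof -
  have fin: "finite {e. e \<subseteq> R \<and> P e}" for P using assms(1) by auto
  have eq: "{e. e \<subseteq> insert r R \<and> card e = Suc j}
      = {e. e \<subseteq> R \<and> card e = Suc j} \<union> insert r ` {e. e \<subseteq> R \<and> card e = j}" (is "?L = ?A \<union> ?B")
  proof (intro equalityI subsetI)
    fix e assume e: "e \<in> ?L"
    show "e \<in> ?A \<union> ?B"
    proof (cases "r \<in> e")
      case True
      have "e - {r} \<subseteq> R" "card (e - {r}) = j" "e = insert r (e - {r})"
        using e True by (auto simp: card_Diff_singleton)
      then show ?thesis by blast
    qed (use e in auto)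
  next
    fix e assume "e \<in> ?A \<union> ?B"
    then show "e \<in> ?L"
    proof
      assume "e \<in> ?B"
      then obtain e' where e': "e = insert r e'" "e' \<subseteq> R" "card e' = j" by auto
      then have "finite e'" "r \<notin> e'" using assms finite_subset by auto
      with e' show "e \<in> ?L" by auto
    qed auto
  qed
  have inj: "inj_on (insert r) {e. e \<subseteq> R \<and> card e = j}"
  proof (rule inj_onI)
    fix x y assume "x \<in> {e. e \<subseteq> R \<and> card e = j}" "y \<in> {e. e \<subseteq> R \<and> card e = j}"
      and eq: "insert r x = insert r y"
    then have "r \<notin> x" "r \<notin> y" using assms(2) by auto
    with eq show "x = y" by (metis insert_ident)
  qed
  have "?A \<inter> ?B = {}" using assms(2) by auto
  then have "esym (insert r R) \<beta> (Suc j) = sum (prod \<beta>) ?A + sum (prod \<beta>) ?B"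
    unfolding esym_def eq using fin by (intro sum.union_disjoint) auto
  also have "sum (prod \<beta>) ?B = (\<Sum>e | e \<subseteq> R \<and> card e = j. \<beta> r * prod \<beta> e)"
    using inj assms by (subst sum.reindex) (auto intro!: sum.cong prod.insert dest: finite_subset)
  finally show ?thesis by (simp add: esym_def sum_distrib_left)
qed

text \<open>In the j-th power of the sum, every product over a j-element set occurs j! times. The
  induction over the set keeps only the first two terms of the power of s + \<beta> r.\<close>

lemma esym_le:
  assumes "finite R" "\<And>r. r \<in> R \<Longrightarrow> 0 \<le> \<beta> r"
  shows "esym R \<beta> j \<le> (sum \<beta> R) ^ j / fact j"
  using assms
proof (induction R arbitrary: j rule: finite_induct)
  case empty
  then show ?case by (cases j) (auto simp: esym_0 esym_empty_Suc)
next
  case (insert r R)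
  show ?case
  proof (cases j)
    case 0
    then show ?thesis using insert by (simp add: esym_0)
  next
    case (Suc i)
    define s where "s = sum \<beta> R"
    have s: "s \<ge> 0" "\<beta> r \<ge> 0" unfolding s_def using insert by (auto intro: sum_nonneg)
    have "s ^ Suc i + real (Suc i) * (\<beta> r * s ^ i) \<le> (s + \<beta> r) ^ Suc i"
    proof (induction i)
      case (Suc i)
      have "s ^ Suc (Suc i) + real (Suc (Suc i)) * (\<beta> r * s ^ Suc i)
         \<le> (s ^ Suc i + real (Suc i) * (\<beta> r * s ^ i)) * (s + \<beta> r)"
        using s by (simp add: algebra_simps)
      also have "\<dots> \<le> (s + \<beta> r) ^ Suc i * (s + \<beta> r)" using s by (intro mult_right_mono Suc) auto
      finally show ?case by (simp add: mult.commute)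
    qed simp
    then have "(s ^ Suc i + real (Suc i) * (\<beta> r * s ^ i)) / fact (Suc i) \<le> (s + \<beta> r) ^ Suc i / fact (Suc i)"
      by (intro divide_right_mono) auto
    moreover have "(s ^ Suc i + real (Suc i) * (\<beta> r * s ^ i)) / fact (Suc i)
        = s ^ Suc i / fact (Suc i) + \<beta> r * (s ^ i / fact i)"
      unfolding add_divide_distrib by (simp del: power_Suc)
    ultimately have "s ^ Suc i / fact (Suc i) + \<beta> r * (s ^ i / fact i) \<le> (s + \<beta> r) ^ Suc i / fact (Suc i)"
      by (simp only:)
    moreover have 1: "esym R \<beta> (Suc i) \<le> s ^ Suc i / fact (Suc i)" and 2: "esym R \<beta> i \<le> s ^ i / fact i"
      using insert by (auto simp: s_def simp del: fact_Suc power_Suc)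
    moreover have "\<beta> r * esym R \<beta> i \<le> \<beta> r * (s ^ i / fact i)"
      using 2 s by (intro mult_left_mono) auto
    ultimately have "esym R \<beta> (Suc i) + \<beta> r * esym R \<beta> i \<le> (s + \<beta> r) ^ Suc i / fact (Suc i)"
      by linarith
    moreover have "sum \<beta> (insert r R) = s + \<beta> r" using insert by (simp add: s_def)
    ultimately show ?thesis
      unfolding Suc by (simp only: esym_insert[OF insert.hyps(1,2)])
  qed
qed

definition bonferroni :: "'a set \<Rightarrow> ('a \<Rightarrow> real) \<Rightarrow> nat \<Rightarrow> real" where
  "bonferroni R \<beta> a = (\<Sum>j\<le>a. (-1) ^ j * esym R \<beta> j)"

lemma bonferroni_insert:
  assumes "finite R" "r \<notin> R"
  shows "bonferroni (insert r R) \<beta> (Suc a) = bonferroni R \<beta> (Suc a) - \<beta> r * bonferroni R \<beta> a"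
  using assms unfolding bonferroni_def
  by (simp add: sum.atMost_Suc_shift esym_0 esym_insert sum.distrib sum_distrib_left algebra_simps sum_negf sum_subtractf del: sum.atMost_Suc)

text \<open>Bonferroni's inequalities for weights in [0, 1], so that densities are covered as well
  as indicators. The signed errors obey a recursion without cancellation: adding r gives the error
  of order a plus \<beta> r times the error of order a - 1. Both bounds therefore propagate
  together.\<close>

lemma bonferroni_bounds:
  assumes "finite R" "\<And>r. r \<in> R \<Longrightarrow> 0 \<le> \<beta> r \<and> \<beta> r \<le> 1"
  shows "0 \<le> (-1) ^ a * (bonferroni R \<beta> a - (\<Prod>r\<in>R. 1 - \<beta> r)) \<and>
         (-1) ^ a * (bonferroni R \<beta> a - (\<Prod>r\<in>R. 1 - \<beta> r)) \<le> esym R \<beta> (Suc a)"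
  using assms
proof (induction R arbitrary: a rule: finite_induct)
  case empty
  have "bonferroni {} \<beta> a = 1"
    by (induction a) (auto simp: bonferroni_def esym_0 esym_empty_Suc)
  then show ?case by (simp add: esym_empty_Suc)
next
  case (insert r R)
  define V where "V = (\<Prod>r\<in>R. 1 - \<beta> r)"
  have b: "0 \<le> \<beta> r" "\<beta> r \<le> 1" using insert by auto
  have V: "0 \<le> V" "V \<le> 1" unfolding V_def using insert by (auto intro!: prod_nonneg prod_le_1)
  have IH: "0 \<le> (-1) ^ a * (bonferroni R \<beta> a - V) \<and> (-1) ^ a * (bonferroni R \<beta> a - V) \<le> esym R \<beta> (Suc a)" for a
    using insert unfolding V_def by auto
  have prod: "(\<Prod>r\<in>insert r R. 1 - \<beta> r) = V - \<beta> r * V"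
    using insert by (simp add: V_def algebra_simps)
  show ?case
  proof (cases a)
    case 0
    have "\<beta> r * V \<le> \<beta> r" using b V by (simp add: mult_left_le)
    moreover have "0 \<le> \<beta> r * V" using b V by simp
    ultimately show ?thesis using IH[of 0] insert unfolding 0 prod
      by (simp add: bonferroni_def esym_insert esym_0)
  next
    case (Suc i)
    have "(-1) ^ a * (bonferroni (insert r R) \<beta> a - (V - \<beta> r * V))
        = (-1) ^ Suc i * (bonferroni R \<beta> (Suc i) - V) + \<beta> r * ((-1) ^ i * (bonferroni R \<beta> i - V))"
      using insert unfolding Suc by (simp add: bonferroni_insert algebra_simps)
    moreover have "0 \<le> \<beta> r * ((-1) ^ i * (bonferroni R \<beta> i - V))"
      by (rule mult_nonneg_nonneg[OF b(1) conjunct1[OF IH]])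
    moreover have "\<beta> r * ((-1) ^ i * (bonferroni R \<beta> i - V)) \<le> \<beta> r * esym R \<beta> (Suc i)"
      by (rule mult_left_mono[OF conjunct2[OF IH] b(1)])
    ultimately show ?thesis
      using IH[of "Suc i"] insert unfolding prod by (simp add: esym_insert Suc)
  qed
qed

lemma bonferroni_sets:
  assumes "finite R"
  shows "bonferroni R \<beta> a = (\<Sum>e | e \<subseteq> R \<and> card e \<le> a. (-1) ^ card e * prod \<beta> e)"
proof -
  have "(\<Sum>e | e \<subseteq> R \<and> card e \<le> a. (-1) ^ card e * prod \<beta> e)
      = (\<Sum>j\<le>a. \<Sum>e | e \<in> {e. e \<subseteq> R \<and> card e \<le> a} \<and> card e = j. (-1) ^ card e * prod \<beta> e)"
    using assms by (intro sum.group[symmetric]) auto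
  also have "\<dots> = bonferroni R \<beta> a"
    unfolding bonferroni_def esym_def sum_distrib_left
    by (intro sum.cong) auto
  finally show ?thesis ..
qed

text \<open>
  The primes are split into ranges, with a Bonferroni truncation \<open>y i\<close> of the indicator \<open>x i\<close> in
  each range; the inequality applies both to the indicators of sieve events and to their densities.
\<close>

lemma brun_hooley_ineq:
  fixes x y w :: "'i \<Rightarrow> real"
  assumes "finite I" "\<And>i. i \<in> I \<Longrightarrow> 0 \<le> x i \<and> x i \<le> y i \<and> y i \<le> x i + w i"
  shows "prod x I \<le> prod y I \<and> prod y I \<le> prod x I + (\<Sum>l\<in>I. w l * prod y (I - {l}))"
proof -
  have "prod x I \<le> prod y I" using assms by (intro prod_mono) auto
  moreover have "prod y I \<le> prod x I + (\<Sum>l\<in>I. w l * prod y (I - {l}))"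
    using assms
  proof (induction I rule: finite_induct)
    case (insert i I)
    have y0: "0 \<le> y j" if "j \<in> insert i I" for j using insert.prems[OF that] by linarith
    have "prod y (insert i I) = y i * prod y I" using insert by simp
    also have "\<dots> \<le> x i * prod y I + w i * prod y I"
      using insert.prems[of i] y0
      by (subst distrib_right[symmetric]) (intro mult_right_mono prod_nonneg, auto)
    finally have 1: "prod y (insert i I) \<le> x i * prod y I + w i * prod y I" .
    have 2: "x i * prod y I \<le> x i * (prod x I + (\<Sum>l\<in>I. w l * prod y (I - {l})))"
      using insert by (intro mult_left_mono) auto
    have w0: "0 \<le> w j" if "j \<in> insert i I" for j using insert.prems[OF that] by linarith
    have "x i * (\<Sum>l\<in>I. w l * prod y (I - {l})) \<le> y i * (\<Sum>l\<in>I. w l * prod y (I - {l}))"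
      using insert.prems[of i] y0 w0 by (intro mult_right_mono sum_nonneg mult_nonneg_nonneg prod_nonneg) auto
    also have "\<dots> = (\<Sum>l\<in>I. w l * prod y (insert i I - {l}))"
      unfolding sum_distrib_left
    proof (intro sum.cong refl)
      fix l assume "l \<in> I"
      then have "insert i I - {l} = insert i (I - {l})" "i \<notin> I - {l}" using insert by auto
      then show "y i * (w l * prod y (I - {l})) = w l * prod y (insert i I - {l})"
        using insert by simp
    qed
    finally have 3: "x i * (\<Sum>l\<in>I. w l * prod y (I - {l})) \<le> (\<Sum>l\<in>I. w l * prod y (insert i I - {l}))" .
    have "(\<Sum>l\<in>insert i I. w l * prod y (insert i I - {l}))
        = w i * prod y I + (\<Sum>l\<in>I. w l * prod y (insert i I - {l}))"
      using insert.hyps by simp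
    with 1 2 3 show ?case using insert.hyps by (simp add: algebra_simps)
  qed simp
  ultimately show ?thesis by simp
qed

text \<open>Points of the n-th power of S are lists, so that averaging out one coordinate is the
  defining equation and induction on n is available.\<close>

primrec avg :: "nat \<Rightarrow> int set \<Rightarrow> (int list \<Rightarrow> real) \<Rightarrow> real" where
  "avg 0 S f = f []"
| "avg (Suc n) S f = (\<Sum>x\<in>S. avg n S (\<lambda>xs. f (x # xs))) / real (card S)"

lemma avg_mono: "(\<And>xs. length xs = n \<Longrightarrow> f xs \<le> g xs) \<Longrightarrow> avg n S f \<le> avg n S g"
proof (induction n arbitrary: f g)
  case (Suc n)
  have "avg n S (\<lambda>xs. f (x # xs)) \<le> avg n S (\<lambda>xs. g (x # xs))" for x
    by (rule Suc.IH) (simp add: Suc.prems)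
  then show ?case by (auto intro!: divide_right_mono sum_mono)
qed simp

lemma avg_add: "avg n S (\<lambda>xs. f xs + g xs) = avg n S f + avg n S g"
  by (induction n arbitrary: f g) (simp_all add: sum.distrib add_divide_distrib)

lemma avg_cmult: "avg n S (\<lambda>xs. c * f xs) = c * avg n S f"
  by (induction n arbitrary: f) (simp_all flip: sum_distrib_left)

lemma avg_zero: "avg n S (\<lambda>xs. 0) = 0"
  by (induction n) simp_all

lemma avg_sum: "avg n S (\<lambda>xs. \<Sum>a\<in>A. f a xs) = (\<Sum>a\<in>A. avg n S (f a))"
  by (induction A rule: infinite_finite_induct) (simp_all add: avg_zero avg_add)

lemma avg_const:
  assumes "finite S" "S \<noteq> {}"
  shows "avg n S (\<lambda>xs. c) = c"
  using assms by (induction n) simp_all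

lemma avg_nonneg: "(\<And>xs. length xs = n \<Longrightarrow> 0 \<le> f xs) \<Longrightarrow> 0 \<le> avg n S f"
  using avg_mono[of n "\<lambda>_. 0" f S] by (simp add: avg_zero)

text \<open>Multiplying out the sums gives one monomial for each choice f of a set in every range.
  As the ranges are disjoint, the monomial is indexed by the union of the chosen sets, and \<delta>
  is paid once per choice.\<close>

lemma avg_product_sums:
  fixes R :: "'i \<Rightarrow> nat set" and B :: "nat \<Rightarrow> int list \<Rightarrow> bool"
  assumes "finite I" "disjoint_family_on R I" "\<And>i. i \<in> I \<Longrightarrow> finite (R i)"
    and ES: "\<And>i. i \<in> I \<Longrightarrow> ES i \<subseteq> Pow (R i)"
    and c: "\<And>i e. i \<in> I \<Longrightarrow> e \<in> ES i \<Longrightarrow> \<bar>c i e\<bar> \<le> 1"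
    and approx: "\<And>f. f \<in> PiE I ES \<Longrightarrow>
        \<bar>avg n S (\<lambda>xs. \<Prod>r\<in>(\<Union>i\<in>I. f i). of_bool (B r xs)) - (\<Prod>r\<in>(\<Union>i\<in>I. f i). \<beta> r)\<bar> \<le> \<delta>"
  shows "\<bar>avg n S (\<lambda>xs. \<Prod>i\<in>I. \<Sum>e\<in>ES i. c i e * (\<Prod>r\<in>e. of_bool (B r xs)))
           - (\<Prod>i\<in>I. \<Sum>e\<in>ES i. c i e * (\<Prod>r\<in>e. \<beta> r))\<bar> \<le> (\<Prod>i\<in>I. real (card (ES i))) * \<delta>"
proof -
  have finES: "finite (ES i)" if "i \<in> I" for i
    using assms(3)[OF that] ES[OF that] finite_subset by blast
  have expand: "(\<Prod>i\<in>I. \<Sum>e\<in>ES i. c i e * (\<Prod>r\<in>e. g r))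
      = (\<Sum>f\<in>PiE I ES. (\<Prod>i\<in>I. c i (f i)) * (\<Prod>r\<in>(\<Union>i\<in>I. f i). g r))" for g :: "nat \<Rightarrow> real"
  proof -
    have "(\<Prod>i\<in>I. \<Sum>e\<in>ES i. c i e * (\<Prod>r\<in>e. g r))
        = (\<Sum>f\<in>PiE I ES. \<Prod>i\<in>I. c i (f i) * (\<Prod>r\<in>f i. g r))"
      using assms(1) finES by (intro prod_sum_PiE) auto
    also have "\<dots> = (\<Sum>f\<in>PiE I ES. (\<Prod>i\<in>I. c i (f i)) * (\<Prod>r\<in>(\<Union>i\<in>I. f i). g r))"
    proof (intro sum.cong refl)
      fix f assume f: "f \<in> PiE I ES"
      have sub: "f i \<subseteq> R i" if "i \<in> I" for i using f ES that by (auto simp: PiE_iff)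
      have "(\<Prod>r\<in>(\<Union>i\<in>I. f i). g r) = (\<Prod>i\<in>I. \<Prod>r\<in>f i. g r)"
      proof (rule prod.UNION_disjoint)
        show "\<forall>i\<in>I. finite (f i)" using sub assms(3) finite_subset by blast
        show "\<forall>i\<in>I. \<forall>j\<in>I. i \<noteq> j \<longrightarrow> f i \<inter> f j = {}"
          using sub assms(2) unfolding disjoint_family_on_def by blast
      qed (rule assms(1))
      then show "(\<Prod>i\<in>I. c i (f i) * (\<Prod>r\<in>f i. g r)) = (\<Prod>i\<in>I. c i (f i)) * (\<Prod>r\<in>(\<Union>i\<in>I. f i). g r)"
        by (simp add: prod.distrib)
    qed
    finally show ?thesis .
  qed
  let ?D = "\<lambda>f. avg n S (\<lambda>xs. \<Prod>r\<in>(\<Union>i\<in>I. f i). of_bool (B r xs)) - (\<Prod>r\<in>(\<Union>i\<in>I. f i). \<beta> r)"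
  have "\<bar>avg n S (\<lambda>xs. \<Prod>i\<in>I. \<Sum>e\<in>ES i. c i e * (\<Prod>r\<in>e. of_bool (B r xs)))
           - (\<Prod>i\<in>I. \<Sum>e\<in>ES i. c i e * (\<Prod>r\<in>e. \<beta> r))\<bar> = \<bar>\<Sum>f\<in>PiE I ES. (\<Prod>i\<in>I. c i (f i)) * ?D f\<bar>"
    unfolding expand by (simp add: avg_sum avg_cmult sum_subtractf right_diff_distrib)
  also have "\<dots> \<le> (\<Sum>f\<in>PiE I ES. \<bar>(\<Prod>i\<in>I. c i (f i)) * ?D f\<bar>)" by (rule sum_abs)
  also have "\<dots> \<le> (\<Sum>f\<in>PiE I ES. \<delta>)"
  proof (intro sum_mono)
    fix f assume f: "f \<in> PiE I ES"
    have "\<bar>\<Prod>i\<in>I. c i (f i)\<bar> \<le> 1"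
      unfolding abs_prod using f c by (intro prod_le_1) (auto simp: PiE_iff)
    moreover have "\<bar>?D f\<bar> \<le> \<delta>" using approx[OF f] .
    ultimately show "\<bar>(\<Prod>i\<in>I. c i (f i)) * ?D f\<bar> \<le> \<delta>"
      unfolding abs_mult using mult_mono[of "\<bar>\<Prod>i\<in>I. c i (f i)\<bar>" 1 "\<bar>?D f\<bar>" \<delta>] by simp
  qed
  also have "\<dots> = (\<Prod>i\<in>I. real (card (ES i))) * \<delta>"
    using assms(1) finES by (simp add: card_PiE)
  finally show ?thesis .
qed

text \<open>The error allowed in range i is relative to the sifted density of that range. The
  relative errors therefore add up to \<open>sum \<epsilon> I\<close>, and the truncation depth may
  vary from range to range. The absolute error \<delta> is paid for every monomial, in card I + 1
  expansions: one for the product of the \<open>y\<close> and one for each error term.\<close>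

lemma brun_hooley_sieve:
  fixes R :: "'i \<Rightarrow> nat set" and B :: "nat \<Rightarrow> int list \<Rightarrow> bool" and \<beta> :: "nat \<Rightarrow> real" and b :: "'i \<Rightarrow> nat"
  assumes S: "finite S" "S \<noteq> {}"
    and I: "finite I" "disjoint_family_on R I" "\<And>i. i \<in> I \<Longrightarrow> finite (R i)"
    and \<beta>: "\<And>r. 0 \<le> \<beta> r \<and> \<beta> r \<le> 1"
    and approx: "\<And>E. E \<subseteq> (\<Union>i\<in>I. R i) \<Longrightarrow> (\<And>i. i \<in> I \<Longrightarrow> card (E \<inter> R i) \<le> 2 * b i + 1) \<Longrightarrow>
        \<bar>avg n S (\<lambda>xs. \<Prod>r\<in>E. of_bool (B r xs)) - (\<Prod>r\<in>E. \<beta> r)\<bar> \<le> \<delta>"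
    and K: "(\<Prod>i\<in>I. real (card {e. e \<subseteq> R i \<and> card e \<le> 2 * b i + 1})) \<le> K"
    and e: "\<And>i. i \<in> I \<Longrightarrow> 0 \<le> \<epsilon> i \<and> esym (R i) \<beta> (2 * b i + 1) \<le> \<epsilon> i * (\<Prod>r\<in>R i. 1 - \<beta> r)"
  shows "\<bar>avg n S (\<lambda>xs. \<Prod>i\<in>I. \<Prod>r\<in>R i. 1 - of_bool (B r xs)) - (\<Prod>i\<in>I. \<Prod>r\<in>R i. 1 - \<beta> r)\<bar>
     \<le> (\<Prod>i\<in>I. \<Prod>r\<in>R i. 1 - \<beta> r) * (sum \<epsilon> I * exp (sum \<epsilon> I)) + (real (card I) + 1) * (K * \<delta>)"
proof -
  define D where "D i = {e. e \<subseteq> R i \<and> card e \<le> 2 * b i}" for i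
  define D1 where "D1 i = {e. e \<subseteq> R i \<and> card e = 2 * b i + 1}" for i
  \<comment> \<open>Truncation at the even order 2 b i gives the upper bound \<open>y\<close>; the
    first omitted term \<open>w\<close> has order 2 b i + 1. \<open>D2\<close> contains the sets of
    both, so one approximation hypothesis serves for all expansions.\<close>
  define D2 where "D2 i = {e. e \<subseteq> R i \<and> card e \<le> 2 * b i + 1}" for i
  define x where "x \<gamma> i = (\<Prod>r\<in>R i. 1 - \<gamma> r)" for i and \<gamma> :: "nat \<Rightarrow> real"
  define y where "y \<gamma> i = (\<Sum>e\<in>D i. (-1) ^ card e * prod \<gamma> e)" for i and \<gamma> :: "nat \<Rightarrow> real"
  define w where "w \<gamma> i = (\<Sum>e\<in>D1 i. 1 * prod \<gamma> e)" for i and \<gamma> :: "nat \<Rightarrow> real"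
  define B' where "B' xs r = (of_bool (B r xs) :: real)" for r xs
  have y_alt: "y \<gamma> i = bonferroni (R i) \<gamma> (2 * b i)" if "i \<in> I" for \<gamma> i
    unfolding y_def D_def using I(3)[OF that] by (rule bonferroni_sets[symmetric])
  have w_alt: "w \<gamma> i = esym (R i) \<gamma> (2 * b i + 1)" for \<gamma> i
    by (simp add: w_def D1_def esym_def)
  have \<delta>: "0 \<le> \<delta>" using approx[of "{}"] by (simp add: avg_const[OF S])
  have bnd: "0 \<le> x \<gamma> i \<and> x \<gamma> i \<le> y \<gamma> i \<and> y \<gamma> i \<le> x \<gamma> i + w \<gamma> i"
    if "i \<in> I" "\<And>r. 0 \<le> \<gamma> r \<and> \<gamma> r \<le> 1" for i \<gamma>
  proof -
    have "0 \<le> x \<gamma> i" unfolding x_def using that by (intro prod_nonneg) auto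
    then show ?thesis using bonferroni_bounds[of "R i" \<gamma> "2 * b i"] I(3)[of i] that
      by (simp add: x_def y_alt w_alt)
  qed
  have bnd\<beta>: "0 \<le> x \<beta> i \<and> x \<beta> i \<le> y \<beta> i \<and> y \<beta> i \<le> x \<beta> i + w \<beta> i" if "i \<in> I" for i
    using that \<beta> by (rule bnd)
  have bndB: "0 \<le> x (B' xs) i \<and> x (B' xs) i \<le> y (B' xs) i \<and> y (B' xs) i \<le> x (B' xs) i + w (B' xs) i"
    if "i \<in> I" for i xs
    using that by (rule bnd) (auto simp: B'_def)
  have finD: "finite (D2 i)" "D i \<subseteq> D2 i" "D1 i \<subseteq> D2 i" if "i \<in> I" for i
    using I(3)[OF that] by (auto simp: D2_def D_def D1_def)
  have apx: "\<bar>avg n S (\<lambda>xs. \<Prod>i\<in>I. \<Sum>e\<in>ES i. c i e * (\<Prod>r\<in>e. of_bool (B r xs)))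
           - (\<Prod>i\<in>I. \<Sum>e\<in>ES i. c i e * (\<Prod>r\<in>e. \<beta> r))\<bar> \<le> K * \<delta>"
    if ES: "\<And>i. i \<in> I \<Longrightarrow> ES i \<subseteq> D2 i" and c: "\<And>i e. \<bar>c i e\<bar> \<le> 1" for ES c
  proof -
    have "\<bar>avg n S (\<lambda>xs. \<Prod>i\<in>I. \<Sum>e\<in>ES i. c i e * (\<Prod>r\<in>e. of_bool (B r xs)))
           - (\<Prod>i\<in>I. \<Sum>e\<in>ES i. c i e * (\<Prod>r\<in>e. \<beta> r))\<bar> \<le> (\<Prod>i\<in>I. real (card (ES i))) * \<delta>"
    proof (rule avg_product_sums[OF I])
      show "ES i \<subseteq> Pow (R i)" if "i \<in> I" for i using ES[OF that] by (auto simp: D2_def)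
      fix f assume f: "f \<in> PiE I ES"
      have "f i \<in> D2 i" if "i \<in> I" for i
        using PiE_mem[OF f that] ES[OF that] by blast
      then have fi: "f i \<subseteq> R i" "card (f i) \<le> 2 * b i + 1" if "i \<in> I" for i
        using that by (auto simp: D2_def)
      have int: "(\<Union>i\<in>I. f i) \<inter> R i = f i" if i: "i \<in> I" for i
      proof
        show "(\<Union>i\<in>I. f i) \<inter> R i \<subseteq> f i"
        proof
          fix r assume "r \<in> (\<Union>i\<in>I. f i) \<inter> R i"
          then obtain j where "j \<in> I" "r \<in> f j" "r \<in> R i" by blast
          moreover from this have "r \<in> R j" using fi(1) by blast
          ultimately have "j = i" using I(2) i unfolding disjoint_family_on_def by blast
          with \<open>r \<in> f j\<close> show "r \<in> f i" by simp
        qed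
      qed (use fi(1) i in blast)
      have "(\<Union>i\<in>I. f i) \<subseteq> (\<Union>i\<in>I. R i)" using fi(1) by blast
      then show "\<bar>avg n S (\<lambda>xs. \<Prod>r\<in>(\<Union>i\<in>I. f i). of_bool (B r xs)) - (\<Prod>r\<in>(\<Union>i\<in>I. f i). \<beta> r)\<bar> \<le> \<delta>"
        by (rule approx) (simp only: int fi(2))
    qed (use c in auto)
    also have "\<dots> \<le> (\<Prod>i\<in>I. real (card (D2 i))) * \<delta>"
      using ES finD \<delta> by (intro mult_right_mono prod_mono) (auto intro!: card_mono)
    also have "\<dots> \<le> K * \<delta>" using K \<delta> by (intro mult_right_mono) (auto simp: D2_def)
    finally show ?thesis .
  qed
  have apy: "\<bar>avg n S (\<lambda>xs. \<Prod>i\<in>I. y (B' xs) i) - (\<Prod>i\<in>I. y \<beta> i)\<bar> \<le> K * \<delta>"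
    unfolding y_def B'_def by (rule apx) (use finD in auto)
  have apw: "\<bar>avg n S (\<lambda>xs. w (B' xs) l * (\<Prod>i\<in>I - {l}. y (B' xs) i)) - w \<beta> l * (\<Prod>i\<in>I - {l}. y \<beta> i)\<bar> \<le> K * \<delta>"
    if l: "l \<in> I" for l
  proof -
    define ES where "ES i = (if i = l then D1 i else D i)" for i
    define c where "c i e = (if i = l then 1 else (-1) ^ card e :: real)" for i and e :: "nat set"
    have eq: "w \<gamma> l * (\<Prod>i\<in>I - {l}. y \<gamma> i) = (\<Prod>i\<in>I. \<Sum>e\<in>ES i. c i e * prod \<gamma> e)" for \<gamma>
      using l I(1) by (subst prod.remove[of I l]) (auto simp: w_def y_def ES_def c_def)
    show ?thesis unfolding eq unfolding B'_def
    proof (rule apx)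
      show "ES i \<subseteq> D2 i" if "i \<in> I" for i using finD[OF that] by (cases "i = l") (simp_all add: ES_def)
    qed (simp add: c_def)
  qed
  define V where "V = (\<Prod>i\<in>I. x \<beta> i)"
  define Q where "Q = (\<Sum>l\<in>I. w \<beta> l * (\<Prod>i\<in>I - {l}. y \<beta> i))"
  define P where "P = avg n S (\<lambda>xs. \<Prod>i\<in>I. x (B' xs) i)"
  define Y where "Y = (\<Prod>i\<in>I. y \<beta> i)"
  have VY: "V \<le> Y" "Y \<le> V + Q"
    using brun_hooley_ineq[OF I(1) bnd\<beta>] by (auto simp: V_def Q_def Y_def)
  have bhB: "prod (x (B' xs)) I \<le> prod (y (B' xs)) I \<and>
      prod (y (B' xs)) I \<le> prod (x (B' xs)) I + (\<Sum>l\<in>I. w (B' xs) l * prod (y (B' xs)) (I - {l}))" for xs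
    using I(1) bndB by (rule brun_hooley_ineq)
  have "P \<le> avg n S (\<lambda>xs. \<Prod>i\<in>I. y (B' xs) i)"
    unfolding P_def by (intro avg_mono) (use bhB in auto)
  then have 1: "P \<le> Y + K * \<delta>" using apy by (simp add: Y_def)
  have "avg n S (\<lambda>xs. \<Prod>i\<in>I. y (B' xs) i)
      \<le> avg n S (\<lambda>xs. (\<Prod>i\<in>I. x (B' xs) i) + (\<Sum>l\<in>I. w (B' xs) l * (\<Prod>i\<in>I - {l}. y (B' xs) i)))"
    by (intro avg_mono) (use bhB in auto)
  also have "\<dots> = P + (\<Sum>l\<in>I. avg n S (\<lambda>xs. w (B' xs) l * (\<Prod>i\<in>I - {l}. y (B' xs) i)))"
    by (simp add: avg_add avg_sum P_def)
  also have "(\<Sum>l\<in>I. avg n S (\<lambda>xs. w (B' xs) l * (\<Prod>i\<in>I - {l}. y (B' xs) i)))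
      \<le> (\<Sum>l\<in>I. w \<beta> l * (\<Prod>i\<in>I - {l}. y \<beta> i) + K * \<delta>)"
  proof (rule sum_mono)
    fix l assume "l \<in> I"
    from apw[OF this] show "avg n S (\<lambda>xs. w (B' xs) l * (\<Prod>i\<in>I - {l}. y (B' xs) i))
      \<le> w \<beta> l * (\<Prod>i\<in>I - {l}. y \<beta> i) + K * \<delta>" by linarith
  qed
  also have "\<dots> = Q + real (card I) * (K * \<delta>)" by (simp add: Q_def sum.distrib)
  finally have 2: "Y \<le> P + Q + real (card I) * (K * \<delta>) + K * \<delta>" using apy by (simp add: Y_def)
  have K0: "0 \<le> K * \<delta>" using apy by linarith
  have "0 \<le> real (card I) * (K * \<delta>)" using K0 by simp
  have main: "\<bar>P - V\<bar> \<le> Q + (real (card I) + 1) * (K * \<delta>)"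
    using 1 2 VY K0 \<open>0 \<le> real (card I) * (K * \<delta>)\<close> by (simp add: algebra_simps abs_le_iff)
  have Q: "Q \<le> V * (sum \<epsilon> I * exp (sum \<epsilon> I))"
  proof -
    have y: "0 \<le> y \<beta> i" "y \<beta> i \<le> exp (\<epsilon> i) * x \<beta> i" if "i \<in> I" for i
    proof -
      show "0 \<le> y \<beta> i" using bnd\<beta>[OF that] by linarith
      have "w \<beta> i \<le> \<epsilon> i * x \<beta> i" using e[OF that] by (simp add: w_alt x_def)
      then have "y \<beta> i \<le> (1 + \<epsilon> i) * x \<beta> i" using bnd\<beta>[OF that] by (simp add: algebra_simps)
      also have "\<dots> \<le> exp (\<epsilon> i) * x \<beta> i" using bnd\<beta>[OF that] by (intro mult_right_mono) auto
      finally show "y \<beta> i \<le> exp (\<epsilon> i) * x \<beta> i" .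
    qed
    \<comment> \<open>Each truncated factor is at most exp (\<epsilon> i) times the exact one, so
      replacing all of them costs at most the exponential of the sum.\<close>
    have "Q \<le> (\<Sum>l\<in>I. \<epsilon> l * (exp (sum \<epsilon> I) * V))"
      unfolding Q_def
    proof (rule sum_mono)
      fix l assume l: "l \<in> I"
      have "(\<Prod>i\<in>I - {l}. y \<beta> i) \<le> (\<Prod>i\<in>I - {l}. exp (\<epsilon> i) * x \<beta> i)"
        using y by (intro prod_mono) auto
      also have "\<dots> = exp (sum \<epsilon> (I - {l})) * (\<Prod>i\<in>I - {l}. x \<beta> i)"
        using I(1) by (simp add: prod.distrib exp_sum)
      also have "\<dots> \<le> exp (sum \<epsilon> I) * (\<Prod>i\<in>I - {l}. x \<beta> i)"
        using I(1) e bnd\<beta> by (intro mult_right_mono prod_nonneg) (auto intro!: sum_mono2)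
      finally have A: "(\<Prod>i\<in>I - {l}. y \<beta> i) \<le> exp (sum \<epsilon> I) * (\<Prod>i\<in>I - {l}. x \<beta> i)" .
      have "w \<beta> l * (\<Prod>i\<in>I - {l}. y \<beta> i) \<le> (\<epsilon> l * x \<beta> l) * (exp (sum \<epsilon> I) * (\<Prod>i\<in>I - {l}. x \<beta> i))"
        using A e[OF l] bnd\<beta>[OF l] y
        by (intro mult_mono prod_nonneg) (auto simp: w_alt x_def)
      also have "\<dots> = \<epsilon> l * (exp (sum \<epsilon> I) * V)"
        unfolding V_def using I(1) l by (subst prod.remove[of I l]) (auto simp: algebra_simps)
      finally show "w \<beta> l * (\<Prod>i\<in>I - {l}. y \<beta> i) \<le> \<epsilon> l * (exp (sum \<epsilon> I) * V)" .
    qed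
    also have "\<dots> = V * (sum \<epsilon> I * exp (sum \<epsilon> I))"
      unfolding sum_distrib_right[symmetric] by simp
    finally show ?thesis .
  qed
  show ?thesis using main Q unfolding P_def V_def x_def B'_def by linarith
qed

section \<open>Local densities of cube forms\<close>

definition mod_invariant :: "int \<Rightarrow> (int list \<Rightarrow> 'a) \<Rightarrow> bool" where
  "mod_invariant e F \<longleftrightarrow> (\<forall>xs. F (map (\<lambda>x. x mod e) xs) = F xs)"

lemma bij_betw_mod:
  assumes "(e::int) > 0"
  shows "bij_betw (\<lambda>x. x mod e) {c..<c + e} {0..<e}"
proof -
  have inj: "inj_on (\<lambda>x. x mod e) {c..<c + e}"
  proof (rule inj_onI)
    fix x y assume xy: "x \<in> {c..<c + e}" "y \<in> {c..<c + e}" "x mod e = y mod e"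
    then have "e dvd x - y" by (simp add: mod_eq_dvd_iff)
    moreover have "\<bar>x - y\<bar> < e" using xy by auto
    ultimately show "x = y" using dvd_imp_le_int[of "x - y" e] assms by auto
  qed
  moreover have "(\<lambda>x. x mod e) ` {c..<c + e} = {0..<e}"
  proof (rule card_subset_eq)
    show "(\<lambda>x. x mod e) ` {c..<c + e} \<subseteq> {0..<e}" using assms by auto
    show "card ((\<lambda>x. x mod e) ` {c..<c + e}) = card {0..<e}"
      using inj by (simp add: card_image)
  qed simp
  ultimately show ?thesis by (simp add: bij_betw_def)
qed

lemma sum_period_window:
  fixes a :: "int \<Rightarrow> real"
  assumes "e > 0" "\<And>x. a (x mod e) = a x"
  shows "(\<Sum>x\<in>{c..<c + e}. a x) = (\<Sum>x\<in>{0..<e}. a x)"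
proof -
  have "(\<Sum>x\<in>{0..<e}. a x) = (\<Sum>x\<in>{c..<c + e}. a (x mod e))"
    using bij_betw_mod[OF assms(1)] by (rule sum.reindex_bij_betw[symmetric])
  then show ?thesis using assms(2) by simp
qed

lemma sum_period_blocks:
  fixes a :: "int \<Rightarrow> real"
  assumes "e > 0" "\<And>x. a (x mod e) = a x"
  shows "(\<Sum>x\<in>{c..<c + int g * e}. a x) = real g * (\<Sum>x\<in>{0..<e}. a x)"
proof (induction g)
  case (Suc g)
  define m where "m = int g * e"
  have "0 \<le> m" "int (Suc g) * e = m + e" using assms(1) by (auto simp: m_def algebra_simps)
  then have "{c..<c + int (Suc g) * e} = {c..<c + int g * e} \<union> {c + int g * e..<c + int g * e + e}"
    unfolding m_def[symmetric] using assms(1) by auto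
  then have "(\<Sum>x\<in>{c..<c + int (Suc g) * e}. a x)
      = (\<Sum>x\<in>{c..<c + int g * e}. a x) + (\<Sum>x\<in>{c + int g * e..<c + int g * e + e}. a x)"
    by (simp add: sum.union_disjoint)
  then show ?case using Suc sum_period_window[of e a "c + int g * e"] assms by (simp add: algebra_simps)
qed simp

lemma average_residues:
  fixes a :: "int \<Rightarrow> real"
  assumes e: "e > 0" and a: "\<And>x. a (x mod e) = a x" "\<And>x. 0 \<le> a x \<and> a x \<le> 1" and T: "T > 0"
  shows "\<bar>(\<Sum>x\<in>{1..int T}. a x) / real T - (\<Sum>x\<in>{0..<e}. a x) / of_int e\<bar> \<le> of_int e / real T"
proof -
  define g where "g = T div nat e"
  define h where "h = T mod nat e"
  define A where "A = (\<Sum>x\<in>{0..<e}. a x)"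
  have T': "int T = int g * e + int h"
    unfolding g_def h_def using e by (metis div_mult_mod_eq int_nat_eq of_nat_add of_nat_mult order_less_imp_le)
  have h: "int h < e" unfolding h_def using e by (metis nat_0_less_mult_iff pos_mod_bound zless_nat_eq_int_zless of_nat_0_le_iff mod_less_divisor zero_less_nat_eq)
  have A: "0 \<le> A" "A \<le> of_int e"
    unfolding A_def using a(2) sum_bounded_above[of "{0..<e}" a 1] e by (auto intro!: sum_nonneg)
  define B where "B = (\<Sum>x\<in>{1 + int g * e..<1 + int T}. a x)"
  have B: "0 \<le> B" "B \<le> real h"
    unfolding B_def using a(2) sum_bounded_above[of "{1 + int g * e..<1 + int T}" a 1] T'
    by (auto intro!: sum_nonneg)
  have "0 \<le> int g * e" using e by simp
  then have "{1..int T} = {1..<1 + int g * e} \<union> {1 + int g * e..<1 + int T}"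
    using T' by auto
  then have "(\<Sum>x\<in>{1..int T}. a x) = (\<Sum>x\<in>{1..<1 + int g * e}. a x) + B"
    unfolding B_def by (simp add: sum.union_disjoint)
  then have S: "(\<Sum>x\<in>{1..int T}. a x) = real g * A + B"
    using sum_period_blocks[of e a 1 g] e a(1) by (simp add: A_def)
  have TR: "real T = real g * of_int e + real h" using T' by (metis of_int_add of_int_mult of_int_of_nat_eq)
  have "(\<Sum>x\<in>{1..int T}. a x) / real T - A / of_int e = (B - real h * (A / of_int e)) / real T"
    using e T unfolding S by (simp add: field_simps) (simp add: TR algebra_simps)
  moreover have "\<bar>B - real h * (A / of_int e)\<bar> \<le> of_int e"
  proof -
    have "0 \<le> A / of_int e" "A / of_int e \<le> 1" using A e by (auto simp: field_simps)
    then have "0 \<le> real h * (A / of_int e)" "real h * (A / of_int e) \<le> real h"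
      by (intro mult_nonneg_nonneg mult_left_le; simp)+
    moreover have "real h \<le> of_int e" using h by linarith
    ultimately show ?thesis using B by linarith
  qed
  ultimately show ?thesis unfolding A_def by (simp add: abs_divide divide_right_mono)
qed

lemma avg_le_1:
  assumes "finite S" "S \<noteq> {}" "\<And>xs. f xs \<le> 1"
  shows "avg n S f \<le> 1"
  using avg_mono[of n f "\<lambda>_. 1" S] assms by (simp add: avg_const)

text \<open>Coordinates are replaced one at a time; cutting {1..T} into complete periods costs e / T
  for each of them.\<close>

lemma avg_residues:
  fixes F :: "int list \<Rightarrow> real"
  assumes e: "e > 0" and T: "T > 0"
  shows "mod_invariant e F \<Longrightarrow> (\<And>xs. 0 \<le> F xs \<and> F xs \<le> 1) \<Longrightarrow>
    \<bar>avg n {1..int T} F - avg n {0..<e} F\<bar> \<le> real n * (of_int e / real T)"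
proof (induction n arbitrary: F)
  case (Suc n)
  define G where "G x = avg n {0..<e} (\<lambda>xs. F (x # xs))" for x
  define H where "H x = avg n {1..int T} (\<lambda>xs. F (x # xs))" for x
  have inv: "F (map (\<lambda>x. x mod e) xs) = F xs" for xs using Suc.prems(1) by (simp add: mod_invariant_def)
  have head: "F ((x mod e) # xs) = F (x # xs)" for x xs
    using inv[of "x mod e # xs"] inv[of "x # xs"] by simp
  have tail: "mod_invariant e (\<lambda>xs. F (x # xs))" for x
    unfolding mod_invariant_def using inv[of "x # _"] head by simp
  have 1: "\<bar>H x - G x\<bar> \<le> real n * (of_int e / real T)" for x
    unfolding G_def H_def using tail Suc.prems(2) by (intro Suc.IH)
  have 2: "\<bar>(\<Sum>x\<in>{1..int T}. G x) / real T - (\<Sum>x\<in>{0..<e}. G x) / of_int e\<bar> \<le> of_int e / real T"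
  proof (rule average_residues[OF e _ _ T])
    fix x show "G (x mod e) = G x" by (simp add: G_def head)
    show "0 \<le> G x \<and> G x \<le> 1"
      unfolding G_def using Suc.prems(2) e by (auto intro!: avg_nonneg avg_le_1)
  qed
  have "\<bar>(\<Sum>x\<in>{1..int T}. H x) / real T - (\<Sum>x\<in>{1..int T}. G x) / real T\<bar>
      = \<bar>\<Sum>x\<in>{1..int T}. H x - G x\<bar> / real T"
    by (simp add: sum_subtractf diff_divide_distrib[symmetric])
  also have "\<dots> \<le> (\<Sum>x\<in>{1..int T}. \<bar>H x - G x\<bar>) / real T"
    by (intro divide_right_mono sum_abs) auto
  also have "\<dots> \<le> (\<Sum>x\<in>{1..int T}. real n * (of_int e / real T)) / real T"
    using 1 by (intro divide_right_mono sum_mono) auto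
  also have "\<dots> = real n * (of_int e / real T)" using T by simp
  finally have 3: "\<bar>(\<Sum>x\<in>{1..int T}. H x) / real T - (\<Sum>x\<in>{1..int T}. G x) / real T\<bar> \<le> real n * (of_int e / real T)" .
  have "avg (Suc n) {1..int T} F = (\<Sum>x\<in>{1..int T}. H x) / real T"
    "avg (Suc n) {0..<e} F = (\<Sum>x\<in>{0..<e}. G x) / of_int e"
    using e by (simp_all add: H_def G_def)
  moreover have "real (Suc n) * (of_int e / real T) = real n * (of_int e / real T) + of_int e / real T"
    by (simp add: algebra_simps add_divide_distrib)
  ultimately show ?case using 2 3 by linarith
qed simp

lemma sum_crt:
  fixes a b :: "int \<Rightarrow> real"
  assumes "e > 0" "r > 0" "coprime e r"
  shows "(\<Sum>x\<in>{0..<e * r}. a (x mod e) * b (x mod r)) = (\<Sum>x\<in>{0..<e}. a x) * (\<Sum>x\<in>{0..<r}. b x)"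
proof -
  let ?f = "\<lambda>x. (x mod e, x mod r)"
  have inj: "inj_on ?f {0..<e * r}"
  proof (rule inj_onI)
    fix x y assume xy: "x \<in> {0..<e * r}" "y \<in> {0..<e * r}" "?f x = ?f y"
    then have "e dvd x - y" "r dvd x - y" by (auto simp: mod_eq_dvd_iff)
    then have "e * r dvd x - y" using assms(3) by (simp add: divides_mult)
    moreover have "\<bar>x - y\<bar> < e * r" using xy by auto
    ultimately show "x = y" using dvd_imp_le_int[of "x - y" "e * r"] assms by (auto simp: abs_mult)
  qed
  have "?f ` {0..<e * r} = {0..<e} \<times> {0..<r}"
  proof (rule card_subset_eq)
    show "?f ` {0..<e * r} \<subseteq> {0..<e} \<times> {0..<r}" using assms by auto
    show "card (?f ` {0..<e * r}) = card ({0..<e} \<times> {0..<r})"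
      using inj assms by (simp add: card_image card_cartesian_product nat_mult_distrib)
  qed simp
  with inj have bij: "bij_betw ?f {0..<e * r} ({0..<e} \<times> {0..<r})" by (simp add: bij_betw_def)
  have "(\<Sum>x\<in>{0..<e}. a x) * (\<Sum>x\<in>{0..<r}. b x) = (\<Sum>p\<in>{0..<e} \<times> {0..<r}. a (fst p) * b (snd p))"
    by (simp add: sum_product sum.cartesian_product case_prod_beta)
  also have "\<dots> = (\<Sum>x\<in>{0..<e * r}. a (fst (?f x)) * b (snd (?f x)))"
    using bij by (rule sum.reindex_bij_betw[symmetric])
  finally show ?thesis by simp
qed

lemma avg_crt:
  assumes "e > 0" "r > 0" "coprime e r"
  shows "avg n {0..<e * r} (\<lambda>xs. f (map (\<lambda>x. x mod e) xs) * g (map (\<lambda>x. x mod r) xs))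
       = avg n {0..<e} f * avg n {0..<r} g"
proof (induction n arbitrary: f g)
  case (Suc n)
  have "avg (Suc n) {0..<e * r} (\<lambda>xs. f (map (\<lambda>x. x mod e) xs) * g (map (\<lambda>x. x mod r) xs))
      = (\<Sum>x\<in>{0..<e * r}. avg n {0..<e} (\<lambda>xs. f (x mod e # xs)) * avg n {0..<r} (\<lambda>xs. g (x mod r # xs))) / of_int (e * r)"
    using assms Suc[of "\<lambda>xs. f (_ mod e # xs)" "\<lambda>xs. g (_ mod r # xs)"] by simp
  also have "\<dots> = (\<Sum>x\<in>{0..<e}. avg n {0..<e} (\<lambda>xs. f (x # xs))) * (\<Sum>x\<in>{0..<r}. avg n {0..<r} (\<lambda>xs. g (x # xs))) / of_int (e * r)"
    by (subst sum_crt[OF assms]) simp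
  finally show ?case using assms by simp
qed simp

text \<open>Independence of distinct primes: the residues of a uniform point modulo p and modulo the
  product of the other primes are independent.\<close>

lemma avg_prod_primes:
  fixes F :: "nat \<Rightarrow> int list \<Rightarrow> real"
  assumes "finite E" "\<And>r. r \<in> E \<Longrightarrow> prime r" "\<And>r. r \<in> E \<Longrightarrow> mod_invariant (int r) (F r)"
  shows "avg n {0..<int (\<Prod>E)} (\<lambda>xs. \<Prod>r\<in>E. F r xs) = (\<Prod>r\<in>E. avg n {0..<int r} (F r)) \<and>
    mod_invariant (int (\<Prod>E)) (\<lambda>xs. \<Prod>r\<in>E. F r xs)"
  using assms
proof (induction E rule: finite_induct)
  case empty
  have "avg n {0..<1} (\<lambda>xs. 1) = 1" by (rule avg_const) auto
  then show ?case by (simp add: mod_invariant_def)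
next
  case (insert p E)
  define e where "e = \<Prod>E"
  have IH: "avg n {0..<int e} (\<lambda>xs. \<Prod>r\<in>E. F r xs) = (\<Prod>r\<in>E. avg n {0..<int r} (F r))"
    "mod_invariant (int e) (\<lambda>xs. \<Prod>r\<in>E. F r xs)"
    unfolding e_def using insert by blast+
  have invp: "mod_invariant (int p) (F p)" using insert by auto
  have "coprime p e" unfolding e_def
    using insert.hyps insert.prems(1) by (intro prod_coprime_right) (metis insertI1 insertI2 primes_coprime)
  then have cop: "coprime (int p) (int e)" by simp
  have pos: "int p > 0" "int e > 0"
    unfolding e_def using insert.prems(1) insert.hyps by (auto simp: prime_gt_0_nat intro!: prod_pos)
  have prod: "int (\<Prod>(insert p E)) = int p * int e" using insert.hyps by (simp add: e_def)
  have F: "(\<Prod>r\<in>insert p E. F r xs) = F p (map (\<lambda>x. x mod int p) xs) * (\<Prod>r\<in>E. F r (map (\<lambda>x. x mod int e) xs))" for xs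
    using insert.hyps IH(2) invp by (simp add: mod_invariant_def)
  have "avg n {0..<int (\<Prod>(insert p E))} (\<lambda>xs. \<Prod>r\<in>insert p E. F r xs)
      = avg n {0..<int p * int e} (\<lambda>xs. F p (map (\<lambda>x. x mod int p) xs) * (\<Prod>r\<in>E. F r (map (\<lambda>x. x mod int e) xs)))"
    unfolding F prod ..
  also have "\<dots> = avg n {0..<int p} (F p) * avg n {0..<int e} (\<lambda>xs. \<Prod>r\<in>E. F r xs)"
    by (rule avg_crt[OF pos cop])
  finally have 1: "avg n {0..<int (\<Prod>(insert p E))} (\<lambda>xs. \<Prod>r\<in>insert p E. F r xs) = (\<Prod>r\<in>insert p E. avg n {0..<int r} (F r))"
    using IH insert.hyps by simp
  have "map (\<lambda>x. x mod (int p * int e) mod int p) xs = map (\<lambda>x. x mod int p) xs"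
    "map (\<lambda>x. x mod (int p * int e) mod int e) xs = map (\<lambda>x. x mod int e) xs" for xs
    by (simp_all add: mod_mod_cancel)
  then have "mod_invariant (int (\<Prod>(insert p E))) (\<lambda>xs. \<Prod>r\<in>insert p E. F r xs)"
    unfolding mod_invariant_def F prod map_map o_def by (simp only: simp_thms)
  with 1 show ?case ..
qed

text \<open>The linear form at a vertex of the box norm. Each of the q directions has two
  independent variables t and t', adjacent in the list, and the vertex picks one of them: 2q
  variables for 2^q forms.\<close>

fun cube_form :: "bool list \<Rightarrow> int list \<Rightarrow> int" where
  "cube_form (e # \<omega>) (t # t' # xs) = (if e then t' else t) + cube_form \<omega> xs"
| "cube_form _ _ = 0"

lemma cube_form_mod: "cube_form \<omega> (map (\<lambda>x. x mod e) xs) mod e = cube_form \<omega> xs mod e"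
proof (induction \<omega> xs rule: cube_form.induct)
  case (1 \<epsilon> \<omega> t t' xs)
  have "((if \<epsilon> then t' else t) mod e + cube_form \<omega> (map (\<lambda>x. x mod e) xs)) mod e
      = ((if \<epsilon> then t' else t) + cube_form \<omega> xs) mod e"
    using 1 by (metis mod_add_cong mod_mod_trivial)
  then show ?case by (cases \<epsilon>) simp_all
qed auto

section \<open>Divisibility of cube forms by a prime\<close>

lemma sum_dvd_residues:
  assumes "(r::int) > 0"
  shows "(\<Sum>t\<in>{0..<r}. of_bool (r dvd c + t) :: real) = 1"
proof -
  have "(\<Sum>t\<in>{0..<r}. of_bool (r dvd c + t) :: real) = (\<Sum>t\<in>{c..<c + r}. of_bool (r dvd t))"
    by (rule sum.reindex_bij_witness[of _ "\<lambda>t. t - c" "\<lambda>t. c + t"]) auto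
  also have "\<dots> = (\<Sum>t\<in>{0..<r}. of_bool (r dvd t))"
    using assms by (intro sum_period_window) (auto simp: dvd_mod_iff)
  also have "\<dots> = (\<Sum>t\<in>{0}. of_bool (r dvd t))"
    using assms by (intro sum.mono_neutral_right) (auto dest: zdvd_imp_le)
  finally show ?thesis by simp
qed

lemma avg_add_two:
  "avg (Suc (Suc n)) S F = avg n S (\<lambda>xs. \<Sum>t\<in>S. \<Sum>t'\<in>S. F (t # t' # xs)) / real (card S) ^ 2"
  by (simp add: avg_sum power2_eq_square sum_divide_distrib[symmetric])

lemma cube_form_single:
  assumes r: "(r::int) > 0" and "\<omega> \<noteq> []"
  shows "avg (2 * length \<omega>) {0..<r} (\<lambda>xs. of_bool (r dvd c + cube_form \<omega> xs)) = 1 / of_int r"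
proof -
  obtain \<epsilon> \<omega>' where \<omega>: "\<omega> = \<epsilon> # \<omega>'" using assms(2) by (cases \<omega>) auto
  have "(\<Sum>t\<in>{0..<r}. \<Sum>t'\<in>{0..<r}. of_bool (r dvd c + cube_form \<omega> (t # t' # xs))) = (of_int r :: real)" for xs
  proof (cases \<epsilon>)
    case True
    have "(\<Sum>t'\<in>{0..<r}. of_bool (r dvd c + cube_form \<omega> (t # t' # xs))) = (1 :: real)" for t
      using sum_dvd_residues[OF r, of "c + cube_form \<omega>' xs"] by (simp add: \<omega> True algebra_simps)
    then show ?thesis using r by simp
  next
    case False
    have "(\<Sum>t\<in>{0..<r}. of_bool (r dvd c + cube_form \<omega> (t # t' # xs))) = (1 :: real)" for t'
      using sum_dvd_residues[OF r, of "c + cube_form \<omega>' xs"] by (simp add: \<omega> False algebra_simps)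
    then show ?thesis using r by (subst sum.swap) simp
  qed
  moreover have "2 * length \<omega> = Suc (Suc (2 * length \<omega>'))" by (simp add: \<omega>)
  ultimately show ?thesis using r by (simp only: avg_add_two) (simp add: avg_const power2_eq_square)
qed

text \<open>In the first coordinate where the vertices differ, one form contains t and the other t',
  both with coefficient 1. So the two divisibility conditions are independent, whatever the
  remaining variables are.\<close>

lemma cube_form_pair:
  assumes r: "(r::int) > 0"
  shows "length \<omega> = length \<omega>' \<Longrightarrow> \<omega> \<noteq> \<omega>' \<Longrightarrow>
    avg (2 * length \<omega>) {0..<r} (\<lambda>xs. of_bool (r dvd c + cube_form \<omega> xs) * of_bool (r dvd c' + cube_form \<omega>' xs))
      = 1 / of_int r ^ 2"
proof (induction \<omega> \<omega>' arbitrary: c c' rule: list_induct2)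
  case (Cons e \<omega> e' \<omega>')
  let ?F = "\<lambda>xs. of_bool (r dvd c + cube_form (e # \<omega>) xs) * of_bool (r dvd c' + cube_form (e' # \<omega>') xs) :: real"
  have len: "2 * length (e # \<omega>) = Suc (Suc (2 * length \<omega>))" by simp
  have card: "real (card {0..<r}) = of_int r" using r by simp
  show ?case
  proof (cases "e = e'")
    case True
    then have "\<omega> \<noteq> \<omega>'" using Cons by auto
    then have "avg (2 * length \<omega>) {0..<r} (\<lambda>xs. ?F (t # t' # xs)) = 1 / of_int r ^ 2" for t t'
      using Cons.IH[of "c + (if e then t' else t)" "c' + (if e then t' else t)"] True
      by (simp add: add.assoc)
    then show ?thesis using r unfolding len avg_add_two card avg_sum by (simp add: power2_eq_square)
  next
    case False
    have "(\<Sum>t\<in>{0..<r}. \<Sum>t'\<in>{0..<r}. ?F (t # t' # xs)) = 1" for xs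
    proof (cases e)
      case True
      have "(\<Sum>t\<in>{0..<r}. \<Sum>t'\<in>{0..<r}. ?F (t # t' # xs))
          = (\<Sum>t\<in>{0..<r}. of_bool (r dvd (c' + cube_form \<omega>' xs) + t)) * (\<Sum>t'\<in>{0..<r}. of_bool (r dvd (c + cube_form \<omega> xs) + t'))"
        unfolding sum_product using True False by (intro sum.cong refl) (simp add: algebra_simps)
      then show ?thesis by (simp only: sum_dvd_residues[OF r])
    next
      case e: False
      have "(\<Sum>t\<in>{0..<r}. \<Sum>t'\<in>{0..<r}. ?F (t # t' # xs))
          = (\<Sum>t\<in>{0..<r}. of_bool (r dvd (c + cube_form \<omega> xs) + t)) * (\<Sum>t'\<in>{0..<r}. of_bool (r dvd (c' + cube_form \<omega>' xs) + t'))"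
        unfolding sum_product using e False by (intro sum.cong refl) (simp add: algebra_simps)
      then show ?thesis by (simp only: sum_dvd_residues[OF r])
    qed
    then show ?thesis using r unfolding len avg_add_two card by (simp add: avg_const)
  qed
qed simp

definition hit_density :: "nat \<Rightarrow> bool list set \<Rightarrow> int \<Rightarrow> nat \<Rightarrow> real" where
  "hit_density q A c r = avg (2 * q) {0..<int r} (\<lambda>xs. of_bool (\<exists>\<omega>\<in>A. int r dvd c + cube_form \<omega> xs))"

text \<open>With s the number of forms divisible by r, the indicator of s > 0 lies between 2s - s^2
  and s. The means of s and s^2 follow from the counts for one and for two forms.\<close>

lemma hit_density_bounds:
  assumes r: "r > 0" and q: "q > 0" and A: "finite A" "\<And>\<omega>. \<omega> \<in> A \<Longrightarrow> length \<omega> = q"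
  shows "0 \<le> hit_density q A c r" "hit_density q A c r \<le> 1"
    "hit_density q A c r \<le> real (card A) / real r"
    "real (card A) / real r - (real (card A) / real r)\<^sup>2 \<le> hit_density q A c r"
proof -
  define X where "X \<omega> xs = (of_bool (int r dvd c + cube_form \<omega> xs) :: real)" for \<omega> xs
  define s where "s xs = (\<Sum>\<omega>\<in>A. X \<omega> xs)" for xs
  define Y where "Y xs = (of_bool (\<exists>\<omega>\<in>A. int r dvd c + cube_form \<omega> xs) :: real)" for xs
  have S: "finite {0..<int r}" "{0..<int r} \<noteq> {}" using r by auto
  have hd: "hit_density q A c r = avg (2 * q) {0..<int r} Y"
    by (simp add: hit_density_def Y_def[abs_def])
  show "0 \<le> hit_density q A c r" unfolding hd by (intro avg_nonneg) (simp add: Y_def)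
  show "hit_density q A c r \<le> 1" unfolding hd by (intro avg_le_1 S) (simp add: Y_def)
  have single: "avg (2 * q) {0..<int r} (X \<omega>) = 1 / real r" if "\<omega> \<in> A" for \<omega>
    using cube_form_single[of "int r" \<omega> c] A(2)[OF that] q r by (auto simp: X_def[abs_def])
  have Es: "avg (2 * q) {0..<int r} s = real (card A) / real r"
    unfolding s_def avg_sum using single by simp
  have pt: "Y xs \<le> s xs \<and> 2 * s xs - (s xs)\<^sup>2 \<le> Y xs" for xs
  proof (cases "\<exists>\<omega>\<in>A. int r dvd c + cube_form \<omega> xs")
    case True
    then obtain \<omega> where \<omega>: "\<omega> \<in> A" "int r dvd c + cube_form \<omega> xs" by blast
    have "X \<omega> xs \<le> s xs" unfolding s_def using \<omega> A(1) by (intro member_le_sum) (auto simp: X_def)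
    moreover have "0 \<le> (s xs - 1)\<^sup>2" by simp
    ultimately show ?thesis using True \<omega> by (auto simp: Y_def X_def power2_eq_square algebra_simps)
  next
    case False
    then show ?thesis by (simp add: Y_def s_def X_def)
  qed
  show "hit_density q A c r \<le> real (card A) / real r"
    unfolding hd Es[symmetric] using pt by (intro avg_mono) auto
  have pair: "avg (2 * q) {0..<int r} (\<lambda>xs. X \<omega> xs * X \<omega>' xs)
      \<le> 1 / real r ^ 2 + (if \<omega> = \<omega>' then 1 / real r else 0)" if "\<omega> \<in> A" "\<omega>' \<in> A" for \<omega> \<omega>'
  proof (cases "\<omega> = \<omega>'")
    case True
    have "(\<lambda>xs. X \<omega> xs * X \<omega> xs) = X \<omega>" by (rule ext) (simp add: X_def)
    then show ?thesis using True single[OF that(1)] by simp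
  next
    case False
    then show ?thesis
      using cube_form_pair[of "int r" \<omega> \<omega>' c c] A(2)[OF that(1)] A(2)[OF that(2)] r by (simp add: X_def)
  qed
  have "avg (2 * q) {0..<int r} (\<lambda>xs. (s xs)\<^sup>2)
      = (\<Sum>\<omega>\<in>A. \<Sum>\<omega>'\<in>A. avg (2 * q) {0..<int r} (\<lambda>xs. X \<omega> xs * X \<omega>' xs))"
    unfolding s_def power2_eq_square sum_product avg_sum ..
  also have "\<dots> \<le> (\<Sum>\<omega>\<in>A. \<Sum>\<omega>'\<in>A. 1 / real r ^ 2 + (if \<omega> = \<omega>' then 1 / real r else 0))"
    using pair by (intro sum_mono) auto
  also have "\<dots> = (real (card A) / real r)\<^sup>2 + real (card A) / real r"
    using A(1) by (simp add: sum.distrib power2_eq_square distrib_left)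
  finally have "avg (2 * q) {0..<int r} (\<lambda>xs. (s xs)\<^sup>2) \<le> (real (card A) / real r)\<^sup>2 + real (card A) / real r" .
  moreover have "avg (2 * q) {0..<int r} (\<lambda>xs. 2 * s xs + (- 1) * (s xs)\<^sup>2) \<le> avg (2 * q) {0..<int r} Y"
    using pt by (intro avg_mono) (auto simp: algebra_simps)
  ultimately show "real (card A) / real r - (real (card A) / real r)\<^sup>2 \<le> hit_density q A c r"
    unfolding hd avg_add avg_cmult Es by linarith
qed

text \<open>
  The primes up to \<open>dexp b\<close> are left out of the sieve. This costs only a factor exponential in \<open>b\<close>,
  whereas the error terms decay superexponentially in \<open>b\<close>, so that no \<open>W\<close>-trick is needed.
\<close>

definition sieve_density :: "nat \<Rightarrow> nat \<Rightarrow> real" where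
  "sieve_density b L = (\<Prod>r\<in>primes_between (dexp b) (dexp L). 1 - 1 / real r)"

definition sieve_weight :: "nat \<Rightarrow> nat \<Rightarrow> int \<Rightarrow> real" where
  "sieve_weight b L d = of_bool (\<forall>r\<in>primes_between (dexp b) (dexp L). \<not> int r dvd d) / sieve_density b L"

definition exp_tail :: "real \<Rightarrow> nat \<Rightarrow> real" where
  "exp_tail x b = (\<Sum>j. x ^ (j + b) / fact (j + b))"

text \<open>Here \<epsilon> bounds the relative truncation error of the Brun--Hooley sieve and
  \<gamma> the deviation of the joint local densities from a product of densities of single forms.
  The middle term is the remainder from incomplete residue systems.\<close>

definition sieve_error :: "nat \<Rightarrow> nat \<Rightarrow> real" where
  "sieve_error q b = (let \<epsilon> = exp (4 * 2 ^ q) * exp_tail (2 * 2 ^ q) b; \<gamma> = exp (2 * (2 ^ q)\<^sup>2 / real (dexp b)) - 1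
     in (1 + \<gamma>) * (\<epsilon> * exp \<epsilon>) + 2 * real q / real (dexp b) + \<gamma>)"

section \<open>Level and error terms of the sieve\<close>

lemma prod_of_bool: "finite A \<Longrightarrow> (\<Prod>a\<in>A. of_bool (P a) :: real) = of_bool (\<forall>a\<in>A. P a)"
  by (induction A rule: finite_induct) auto

lemma summable_exp_tail: "summable (\<lambda>j. (x :: real) ^ (j + b) / fact (j + b))"
  using summable_exp[of x] by (subst summable_iff_shift) (simp add: divide_inverse mult.commute)

lemma sum_le_exp_tail:
  assumes "x \<ge> 0" "finite J" "\<And>j. j \<in> J \<Longrightarrow> b \<le> j"
  shows "(\<Sum>j\<in>J. x ^ j / fact j) \<le> exp_tail x b"
proof -
  have "(\<Sum>j\<in>J. x ^ j / fact j) = (\<Sum>j\<in>(\<lambda>j. j - b) ` J. x ^ (j + b) / fact (j + b))"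
    using assms(3) by (intro sum.reindex_bij_witness[of _ "\<lambda>j. j + b" "\<lambda>j. j - b"]) auto
  also have "\<dots> \<le> exp_tail x b"
    unfolding exp_tail_def using assms by (intro sum_le_suminf summable_exp_tail) auto
  finally show ?thesis .
qed

lemma card_small_subsets_le:
  assumes "finite R"
  shows "card {e. e \<subseteq> R \<and> card e \<le> a} \<le> (card R + 1) ^ a"
proof -
  have "card {e. e \<subseteq> R \<and> card e \<le> a} = card (\<Union>j\<in>{..a}. {e. e \<subseteq> R \<and> card e = j})"
    by (intro arg_cong[of _ _ card]) auto
  also have "\<dots> \<le> (\<Sum>j\<in>{..a}. card {e. e \<subseteq> R \<and> card e = j})" by (rule card_UN_le) simp
  also have "\<dots> = (\<Sum>j\<le>a. card R choose j)" using assms by (simp add: n_subsets)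
  also have "\<dots> \<le> (\<Sum>j\<le>a. (a choose j) * card R ^ j)"
  proof (rule sum_mono)
    fix j assume j: "j \<in> {..a}"
    have "card R choose j \<le> card R ^ j"
      using binomial_le_pow[of j "card R"] by (cases "j \<le> card R") (auto simp: binomial_eq_0)
    also have "\<dots> \<le> (a choose j) * card R ^ j"
      using j zero_less_binomial[of j a] by (cases "a choose j") auto
    finally show "card R choose j \<le> (a choose j) * card R ^ j" .
  qed
  also have "\<dots> = (card R + 1) ^ a" using binomial[of "card R" 1 a] by simp
  finally show ?thesis .
qed

text \<open>Exponent of 2 in the level when range i is truncated at depth b + (L - 1 - i). The depth
  grows only linearly towards the small primes, whereas their logarithms shrink geometrically, so
  the sum is at most (4b + 6) 2^L and the level at most a fixed power of
  \<open>dexp L\<close>.\<close>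

lemma sieve_level_sum:
  "(\<Sum>i<L. 2 ^ Suc i * (2 * (b + (L - 1 - i)) + 1)) + (4 * b + 4 * L + 6) = 2 ^ L * (4 * b + 6 :: nat)"
proof (induction L)
  case (Suc L)
  have "(\<Sum>i<Suc L. 2 ^ Suc i * (2 * (b + (Suc L - 1 - i)) + 1))
      = 2 * (2 * (b + L) + 1) + 2 * (\<Sum>i<L. 2 ^ Suc i * (2 * (b + (L - 1 - i)) + 1))"
    by (subst sum.lessThan_Suc_shift) (simp add: sum_distrib_left mult.assoc)
  with Suc show ?case by simp
qed simp

lemma primes_between_dexp_UN:
  assumes "b \<le> L"
  shows "primes_between (dexp b) (dexp L) = (\<Union>i\<in>{b..<L}. primes_between (dexp i) (dexp (Suc i)))"
  using assms
proof (induction L rule: dec_induct)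
  case (step L)
  have "primes_between (dexp b) (dexp (Suc L))
      = primes_between (dexp b) (dexp L) \<union> primes_between (dexp L) (dexp (Suc L))"
    using step by (intro primes_between_Un dexp_mono) auto
  moreover have "{b..<Suc L} = insert L {b..<L}" using step by auto
  ultimately show ?case using step by auto
qed simp

lemma disjoint_primes_between_dexp:
  "disjoint_family_on (\<lambda>i. primes_between (dexp i) (dexp (Suc i))) I"
proof (unfold disjoint_family_on_def, intro ballI impI)
  fix i j :: nat assume "i \<noteq> j"
  then have "Suc i \<le> j \<or> Suc j \<le> i" by linarith
  then have "dexp (Suc i) \<le> dexp j \<or> dexp (Suc j) \<le> dexp i" using dexp_mono by blast
  then show "primes_between (dexp i) (dexp (Suc i)) \<inter> primes_between (dexp j) (dexp (Suc j)) = {}"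
    by (auto simp: primes_between_def)
qed

lemma sum_inverse_squares_le:
  assumes "w > 0" "w \<le> z"
  shows "(\<Sum>n\<in>{w<..z}. 1 / (real n)\<^sup>2) \<le> 1 / real w - 1 / real z"
  using assms(2)
proof (induction z rule: dec_induct)
  case (step z)
  have z: "real z > 0" using step assms by simp
  have "{w<..Suc z} = insert (Suc z) {w<..z}" using step by auto
  moreover have "1 / (real (Suc z))\<^sup>2 \<le> 1 / (real z * real (Suc z))"
    unfolding power2_eq_square using z by (intro divide_left_mono mult_right_mono) auto
  moreover have "1 / (real z * real (Suc z)) = 1 / real z - 1 / real (Suc z)"
    using z by (simp add: field_simps)
  ultimately show ?case using step by simp
qed simp

lemma prod_minus_1_le:
  fixes u :: "nat \<Rightarrow> real"
  assumes "finite A"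
  shows "\<bar>prod u A - 1\<bar> \<le> exp (\<Sum>a\<in>A. \<bar>u a - 1\<bar>) - 1"
proof -
  have "\<bar>prod u A - 1\<bar> \<le> (\<Prod>a\<in>A. 1 + \<bar>u a - 1\<bar>) - 1"
    using norm_prod_minus1_le_prod_minus1[of "\<lambda>a. u a - 1" A] by simp
  also have "\<dots> \<le> (\<Prod>a\<in>A. exp \<bar>u a - 1\<bar>) - 1"
    by (intro diff_right_mono prod_mono) auto
  finally show ?thesis using assms by (simp add: exp_sum)
qed

lemma power_one_minus_bounds:
  assumes "0 \<le> x" "x \<le> (1::real)"
  shows "1 - real a * x \<le> (1 - x) ^ a" "(1 - x) ^ a \<le> 1 - real a * x + (real a * x)\<^sup>2"
proof -
  show "1 - real a * x \<le> (1 - x) ^ a"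
    using Bernoulli_inequality[of "- x" a] assms by simp
  show "(1 - x) ^ a \<le> 1 - real a * x + (real a * x)\<^sup>2"
  proof (induction a)
    case (Suc a)
    have "(1 - x) ^ Suc a \<le> (1 - real a * x + (real a * x)\<^sup>2) * (1 - x)"
      using Suc assms by (simp add: mult.commute mult_left_mono)
    also have "\<dots> = 1 - real (Suc a) * x + (real a * x)\<^sup>2 + real a * x\<^sup>2 - (real a * x)\<^sup>2 * x"
      by (simp add: algebra_simps power2_eq_square)
    also have "\<dots> \<le> 1 - real (Suc a) * x + (real a * x)\<^sup>2 + 2 * real a * x\<^sup>2 + x\<^sup>2"
    proof -
      have "0 \<le> (real a * x)\<^sup>2 * x" "0 \<le> real a * x\<^sup>2" "0 \<le> x\<^sup>2" using assms by auto
      then show ?thesis by linarith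
    qed
    also have "\<dots> = 1 - real (Suc a) * x + (real (Suc a) * x)\<^sup>2"
      by (simp add: algebra_simps power2_eq_square)
    finally show ?case .
  qed simp
qed

lemma dexp_pos [simp]: "dexp i > 0" by (simp add: dexp_def)

text \<open>The terms a/r of first order cancel between 1 - \<beta> r and (1 - 1/r)^a, so each
  factor of the quotient is 1 + O(\<kappa>^2 / r^2). Over r > \<open>dexp b\<close> these deviations
  have a small sum.\<close>

lemma sieve_density_compare:
  fixes \<beta> :: "nat \<Rightarrow> real"
  assumes bL: "b \<le> L" and \<kappa>: "2 * \<kappa> \<le> real (dexp b)" and a: "real a \<le> \<kappa>"
    and \<beta>: "\<And>r. r > 0 \<Longrightarrow> \<beta> r \<le> real a / real r \<and> real a / real r - (real a / real r)\<^sup>2 \<le> \<beta> r"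
  shows "\<bar>(\<Prod>r\<in>primes_between (dexp b) (dexp L). 1 - \<beta> r) / sieve_density b L ^ a - 1\<bar>
      \<le> exp (2 * \<kappa>\<^sup>2 / real (dexp b)) - 1"
proof -
  define P where "P = primes_between (dexp b) (dexp L)"
  define u where "u r = (1 - \<beta> r) / (1 - 1 / real r) ^ a" for r
  have \<kappa>0: "0 \<le> \<kappa>" using a by linarith
  have u: "\<bar>u r - 1\<bar> \<le> 2 * \<kappa>\<^sup>2 * (1 / (real r)\<^sup>2)" if "r \<in> P" for r
  proof -
    have r: "real r > real (dexp b)" "r \<ge> 2" using that prime_ge_2_nat by (auto simp: P_def primes_between_def)
    then have r0: "real r > 0" by linarith
    define x where "x = real a / real r"
    have x: "0 \<le> x" "x \<le> 1 / 2"
      unfolding x_def using r r0 a \<kappa> by (auto simp: field_simps)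
    define y where "y = (1 - 1 / real r) ^ a"
    have y: "1 - x \<le> y" "y \<le> 1 - x + x\<^sup>2"
      unfolding x_def y_def using power_one_minus_bounds[of "1 / real r" a] r by simp_all
    have b: "1 - x \<le> 1 - \<beta> r" "1 - \<beta> r \<le> 1 - x + x\<^sup>2"
      using \<beta>[of r] r0 unfolding x_def by auto
    have "\<bar>1 - \<beta> r - y\<bar> \<le> x\<^sup>2" using y b by linarith
    moreover have "y \<ge> 1 / 2" using x y by linarith
    ultimately have "\<bar>1 - \<beta> r - y\<bar> / y \<le> x\<^sup>2 / (1 / 2)" by (intro frac_le) auto
    moreover have "u r - 1 = (1 - \<beta> r - y) / y" unfolding u_def y_def[symmetric] using \<open>y \<ge> 1 / 2\<close> by (simp add: field_simps)
    moreover have "x\<^sup>2 \<le> \<kappa>\<^sup>2 * (1 / (real r)\<^sup>2)"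
      unfolding x_def power_divide using a by (simp add: divide_right_mono power_mono)
    ultimately show ?thesis using \<open>y \<ge> 1 / 2\<close> by (simp add: abs_divide)
  qed
  have "(\<Prod>r\<in>P. 1 - \<beta> r) / sieve_density b L ^ a = prod u P"
    by (simp add: sieve_density_def u_def P_def prod_dividef prod_power_distrib)
  then have "\<bar>(\<Prod>r\<in>P. 1 - \<beta> r) / sieve_density b L ^ a - 1\<bar> \<le> exp (\<Sum>r\<in>P. \<bar>u r - 1\<bar>) - 1"
    using prod_minus_1_le[of P u] by (simp add: P_def)
  also have "(\<Sum>r\<in>P. \<bar>u r - 1\<bar>) \<le> (\<Sum>r\<in>P. 2 * \<kappa>\<^sup>2 * (1 / (real r)\<^sup>2))"
    using u by (rule sum_mono)
  also have "\<dots> = 2 * \<kappa>\<^sup>2 * (\<Sum>r\<in>P. 1 / (real r)\<^sup>2)" by (simp only: sum_distrib_left)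
  also have "\<dots> \<le> 2 * \<kappa>\<^sup>2 * (\<Sum>r\<in>{dexp b<..dexp L}. 1 / (real r)\<^sup>2)"
    by (intro mult_left_mono sum_mono2) (auto simp: P_def primes_between_def)
  also have "\<dots> \<le> 2 * \<kappa>\<^sup>2 * (1 / real (dexp b))"
    using sum_inverse_squares_le[of "dexp b" "dexp L"] dexp_mono[OF bL]
    by (intro mult_left_mono) (auto simp: order_trans)
  finally show ?thesis by (simp add: P_def)
qed

lemma prod_subset_dexp_le:
  assumes I: "I \<subseteq> {b..<L}" and E: "E \<subseteq> (\<Union>i\<in>I. primes_between (dexp i) (dexp (Suc i)))"
    and card: "\<And>i. i \<in> I \<Longrightarrow> card (E \<inter> primes_between (dexp i) (dexp (Suc i))) \<le> c i"
  shows "\<Prod>E \<le> (\<Prod>i\<in>I. dexp (Suc i) ^ c i)"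
proof -
  let ?R = "\<lambda>i. primes_between (dexp i) (dexp (Suc i))"
  have finI: "finite I" using I finite_subset by blast
  have "E = (\<Union>i\<in>I. E \<inter> ?R i)" using E by blast
  then have "\<Prod>E = \<Prod>(\<Union>i\<in>I. E \<inter> ?R i)" by simp
  also have "\<dots> = (\<Prod>i\<in>I. \<Prod>(E \<inter> ?R i))"
    using finI disjoint_primes_between_dexp[of I]
    by (intro prod.UNION_disjoint) (auto simp: disjoint_family_on_def)
  also have "\<dots> \<le> (\<Prod>i\<in>I. dexp (Suc i) ^ c i)"
  proof (intro prod_mono conjI)
    fix i assume i: "i \<in> I"
    have "\<Prod>(E \<inter> ?R i) \<le> (\<Prod>r\<in>E \<inter> ?R i. dexp (Suc i))"
      by (intro prod_mono) (auto simp: primes_between_def)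
    also have "\<dots> \<le> dexp (Suc i) ^ c i"
      using card[OF i] dexp_pos[of "Suc i"] by (auto intro!: power_increasing simp: Suc_leI)
    finally show "\<Prod>(E \<inter> ?R i) \<le> dexp (Suc i) ^ c i" .
  qed simp
  finally show ?thesis .
qed

lemma prod_level_le:
  "(\<Prod>i\<in>{b..<L}. dexp (Suc i) ^ (2 * (b + (L - 1 - i)) + 1)) \<le> dexp L ^ (4 * b + 6)"
proof -
  have "(\<Prod>i\<in>{b..<L}. dexp (Suc i) ^ (2 * (b + (L - 1 - i)) + 1))
      = 2 ^ (\<Sum>i\<in>{b..<L}. 2 ^ Suc i * (2 * (b + (L - 1 - i)) + 1))"
    unfolding dexp_def power_mult[symmetric] by (rule power_sum[symmetric])
  also have "\<dots> \<le> 2 ^ (\<Sum>i<L. 2 ^ Suc i * (2 * (b + (L - 1 - i)) + 1))"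
    by (intro power_increasing sum_mono2) auto
  also have "\<dots> \<le> 2 ^ (2 ^ L * (4 * b + 6))"
    using sieve_level_sum[of b L] by (intro power_increasing) linarith+
  also have "\<dots> = dexp L ^ (4 * b + 6)" by (simp add: dexp_def power_mult)
  finally show ?thesis .
qed

lemma card_primes_between_dexp: "card (primes_between (dexp i) (dexp (Suc i))) + 1 \<le> dexp (Suc i)"
proof -
  have "card (primes_between (dexp i) (dexp (Suc i))) \<le> card {dexp i<..dexp (Suc i)}"
    by (intro card_mono) (auto simp: primes_between_def)
  also have "\<dots> = dexp (Suc i) - dexp i" by simp
  finally show ?thesis using dexp_pos[of i] dexp_mono[of i "Suc i"] by linarith
qed

text \<open>Bookkeeping for the remainder: twice 4b + 6 for the number of monomials and the largest
  modulus, 8 * 2^q for the inverse densities, 1 for the number of ranges, and 1 to gain a factor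
  \<open>dexp L\<close>.\<close>

definition sieve_exponent :: "nat \<Rightarrow> nat \<Rightarrow> nat" where
  "sieve_exponent q b = 8 * b + 14 + 8 * 2 ^ q"

lemma sieve_remainder_le:
  assumes bL: "b \<le> L" and a: "a \<le> 2 ^ q" and T: "dexp L ^ sieve_exponent q b \<le> T"
  shows "(real (card {b..<L}) + 1) * (real (dexp L ^ (4 * b + 6)) *
      (real (2 * q) * (real (dexp L ^ (4 * b + 6)) / real T))) / sieve_density b L ^ a \<le> 2 * real q / real (dexp b)"
proof -
  define z where "z = real (dexp L)"
  have z1: "z \<ge> 1" unfolding z_def using dexp_pos[of L] by linarith
  have zw: "real (dexp b) \<le> z" unfolding z_def using dexp_mono[OF bL] by simp
  have L: "real (card {b..<L}) + 1 \<le> z"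
  proof -
    have "L < 2 ^ L" "2 ^ L < (2::nat) ^ 2 ^ L" by (rule less_exp)+
    then have "card {b..<L} + 1 \<le> 2 ^ 2 ^ L" unfolding card_atLeastLessThan by linarith
    from of_nat_mono[OF this, where 'a = real] show ?thesis unfolding z_def dexp_def by simp
  qed
  have V: "1 / sieve_density b L ^ a \<le> z ^ (8 * 2 ^ q)"
  proof -
    have "exp (- 4 * real L) \<le> sieve_density b L"
      unfolding sieve_density_def using bL by (rule sieve_product_lower)
    then have "exp (- 4 * real L) ^ a \<le> sieve_density b L ^ a" by (intro power_mono) auto
    then have "1 / sieve_density b L ^ a \<le> 1 / exp (- 4 * real L) ^ a"
      by (intro divide_left_mono mult_pos_pos) (auto intro: less_le_trans[of _ "exp (- 4 * real L) ^ a"])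
    also have "\<dots> = exp (real (4 * L * a))"
      by (simp add: exp_minus field_simps flip: exp_of_nat_mult)
    also have "\<dots> = exp 1 ^ (4 * L * a)" by (simp flip: exp_of_nat_mult)
    also have "\<dots> \<le> 4 ^ (4 * L * a)" using exp_le by (intro power_mono) auto
    also have "\<dots> = 2 ^ (8 * L * a)" using power_mult[of "2::real" 2 "4 * L * a"] by (simp add: mult_ac)
    also have "\<dots> \<le> 2 ^ (2 ^ L * (8 * 2 ^ q))"
    proof (rule power_increasing)
      have "L * a \<le> 2 ^ L * 2 ^ q" using a less_exp[of L] by (intro mult_mono) auto
      then show "8 * L * a \<le> 2 ^ L * (8 * 2 ^ q)" by simp
    qed simp
    also have "\<dots> = z ^ (8 * 2 ^ q)" by (simp add: z_def dexp_def power_mult)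
    finally show ?thesis .
  qed
  have Tz: "z ^ sieve_exponent q b \<le> real T" unfolding z_def using T by (metis of_nat_le_iff of_nat_power)
  have T0: "real T > 0" using Tz z1 by (meson less_le_trans zero_less_power zero_less_one less_le_trans)
  have "0 < sieve_density b L"
    unfolding sieve_density_def using sieve_product_lower[OF bL] exp_gt_zero less_le_trans by blast
  then have V0: "0 \<le> 1 / sieve_density b L ^ a" by simp
  have "(real (card {b..<L}) + 1) * (z ^ (4 * b + 6) * (real (2 * q) * (z ^ (4 * b + 6) / real T))) / sieve_density b L ^ a
     = ((real (card {b..<L}) + 1) * (1 / sieve_density b L ^ a)) * ((2 * real q) * (z ^ (8 * b + 12) / real T))"
    by (simp add: power_add[symmetric] mult_ac)
  also have "\<dots> \<le> (z * z ^ (8 * 2 ^ q)) * ((2 * real q) * (z ^ (8 * b + 12) / real T))"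
    using L V V0 z1 T0 by (intro mult_right_mono mult_mono) auto
  also have "\<dots> = 2 * real q * (z ^ (8 * b + 13 + 8 * 2 ^ q) / real T)"
    by (simp add: power_add[symmetric] mult_ac add_ac) (simp add: power_add algebra_simps numeral_eq_Suc)
  also have "\<dots> \<le> 2 * real q * (1 / z)"
  proof (rule mult_left_mono)
    have "z ^ (8 * b + 13 + 8 * 2 ^ q) * z = z ^ sieve_exponent q b"
    proof -
      have "sieve_exponent q b = Suc (8 * b + 13 + 8 * 2 ^ q)" by (simp add: sieve_exponent_def)
      then show ?thesis by (simp only: power_Suc2)
    qed
    then have "z ^ (8 * b + 13 + 8 * 2 ^ q) * z \<le> real T" using Tz by simp
    then show "z ^ (8 * b + 13 + 8 * 2 ^ q) / real T \<le> 1 / z" using z1 T0 by (simp add: field_simps)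
  qed simp
  also have "\<dots> \<le> 2 * real q * (1 / real (dexp b))"
    using zw z1 by (intro mult_left_mono divide_left_mono mult_pos_pos) auto
  finally show ?thesis by (simp add: z_def)
qed

text \<open>The product of the weights over A is a constant times the indicator that no prime r of
  the sieve divides any of the forms. This is a sieve of dimension card A whose event at r is that r
  divides at least one form.\<close>

theorem sieve_cube_average:
  assumes q: "q > 0" and A: "finite A" "\<And>\<omega>. \<omega> \<in> A \<Longrightarrow> length \<omega> = q" "card A \<le> 2 ^ q"
    and b: "2 * 2 ^ q \<le> dexp b" and bL: "b \<le> L" and T: "dexp L ^ sieve_exponent q b \<le> T"
  shows "\<bar>avg (2 * q) {1..int T} (\<lambda>xs. \<Prod>\<omega>\<in>A. sieve_weight b L (c + cube_form \<omega> xs)) - 1\<bar> \<le> sieve_error q b"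
proof -
  define \<kappa> where "\<kappa> = (2 :: real) ^ q"
  define R where "R i = primes_between (dexp i) (dexp (Suc i))" for i
  define P where "P = primes_between (dexp b) (dexp L)"
  define I where "I = {b..<L}"
  \<comment> \<open>The depth is smallest in the range of the largest primes, where each additional
    factor is most expensive.\<close>
  define bb where "bb i = b + (L - 1 - i)" for i
  define B where "B r xs \<longleftrightarrow> (\<exists>\<omega>\<in>A. int r dvd c + cube_form \<omega> xs)" for r xs
  define \<beta> where "\<beta> r = (if r > 0 then hit_density q A c r else 0)" for r
  \<comment> \<open>The densities in one range have sum at most 2 \<kappa>, so
    \<open>esym_le\<close> gives the fraction; the sifted density of the range is at least exp (- 4
    \<kappa>).\<close>
  define \<epsilon> where "\<epsilon> i = exp (4 * \<kappa>) * ((2 * \<kappa>) ^ (2 * bb i + 1) / fact (2 * bb i + 1))" for i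
  define N where "N = dexp L ^ (4 * b + 6)"
  define \<delta> where "\<delta> = real (2 * q) * (real N / real T)"
  define a where "a = card A"
  have T0: "T > 0" using T dexp_pos[of L] by (metis gr0I le_zero_eq power_eq_0_iff less_numeral_extra(3))
  have S: "finite {1..int T}" "{1..int T} \<noteq> {}" using T0 by auto
  have I: "finite I" "disjoint_family_on R I" "\<And>i. i \<in> I \<Longrightarrow> finite (R i)"
    unfolding I_def R_def using disjoint_primes_between_dexp by auto
  have P: "P = (\<Union>i\<in>I. R i)" unfolding P_def I_def R_def using bL by (rule primes_between_dexp_UN)
  have \<beta>: "0 \<le> \<beta> r \<and> \<beta> r \<le> 1" for r
    unfolding \<beta>_def using hit_density_bounds[of r q A c] q A by auto
  have \<beta>2: "\<beta> r \<le> real a / real r \<and> real a / real r - (real a / real r)\<^sup>2 \<le> \<beta> r" if "r > 0" for r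
    unfolding \<beta>_def a_def using hit_density_bounds[of r q A c] q A that by auto
  have a: "real a \<le> \<kappa>" unfolding a_def \<kappa>_def using A(3) by (metis of_nat_le_iff of_nat_numeral of_nat_power)
  have \<kappa>w: "2 * \<kappa> \<le> real (dexp b)" unfolding \<kappa>_def using b by (metis of_nat_le_iff of_nat_mult of_nat_numeral of_nat_power)
  have level: "\<Prod>E \<le> N" if E: "E \<subseteq> (\<Union>i\<in>I. R i)" "\<And>i. i \<in> I \<Longrightarrow> card (E \<inter> R i) \<le> 2 * bb i + 1" for E
  proof -
    have "\<Prod>E \<le> (\<Prod>i\<in>I. dexp (Suc i) ^ (2 * bb i + 1))"
      using E unfolding R_def I_def by (intro prod_subset_dexp_le) auto
    also have "\<dots> \<le> N" unfolding N_def I_def bb_def by (rule prod_level_le)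
    finally show ?thesis .
  qed
  have approx: "\<bar>avg (2 * q) {1..int T} (\<lambda>xs. \<Prod>r\<in>E. of_bool (B r xs)) - (\<Prod>r\<in>E. \<beta> r)\<bar> \<le> \<delta>"
    if E: "E \<subseteq> (\<Union>i\<in>I. R i)" "\<And>i. i \<in> I \<Longrightarrow> card (E \<inter> R i) \<le> 2 * bb i + 1" for E
  proof -
    have EP: "E \<subseteq> P" using E(1) P by simp
    have finE: "finite E" using EP by (rule finite_subset) (simp add: P_def)
    have prime: "prime r" if "r \<in> E" for r using EP that by (auto simp: P_def primes_between_def)
    have inv: "mod_invariant (int r) (\<lambda>xs. of_bool (B r xs) :: real)" for r
    proof -
      have "(int r dvd c + cube_form \<omega> (map (\<lambda>x. x mod int r) xs)) = (int r dvd c + cube_form \<omega> xs)" for \<omega> xs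
        using cube_form_mod[of \<omega> "int r" xs] by (metis dvd_eq_mod_eq_0 mod_add_right_eq)
      then show ?thesis by (simp add: mod_invariant_def B_def)
    qed
    have crt: "avg (2 * q) {0..<int (\<Prod>E)} (\<lambda>xs. \<Prod>r\<in>E. of_bool (B r xs)) =
          (\<Prod>r\<in>E. avg (2 * q) {0..<int r} (\<lambda>xs. of_bool (B r xs))) \<and>
        mod_invariant (int (\<Prod>E)) (\<lambda>xs. \<Prod>r\<in>E. of_bool (B r xs) :: real)"
      using finE prime inv by (rule avg_prod_primes)
    have Epos: "int (\<Prod>E) > 0" using prime by (auto intro!: prod_pos simp: prime_gt_0_nat simp del: of_nat_prod)
    have "avg (2 * q) {0..<int (\<Prod>E)} (\<lambda>xs. \<Prod>r\<in>E. of_bool (B r xs)) = (\<Prod>r\<in>E. \<beta> r)"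
    proof -
      have "avg (2 * q) {0..<int (\<Prod>E)} (\<lambda>xs. \<Prod>r\<in>E. of_bool (B r xs))
          = (\<Prod>r\<in>E. avg (2 * q) {0..<int r} (\<lambda>xs. of_bool (B r xs)))"
        using crt by (rule conjunct1)
      also have "\<dots> = (\<Prod>r\<in>E. \<beta> r)"
        using prime by (intro prod.cong) (auto simp: \<beta>_def hit_density_def B_def prime_gt_0_nat)
      finally show ?thesis .
    qed
    moreover have "\<bar>avg (2 * q) {1..int T} (\<lambda>xs. \<Prod>r\<in>E. of_bool (B r xs)) - avg (2 * q) {0..<int (\<Prod>E)} (\<lambda>xs. \<Prod>r\<in>E. of_bool (B r xs))\<bar>
        \<le> real (2 * q) * (of_int (int (\<Prod>E)) / real T)"
      by (rule avg_residues[OF Epos T0 conjunct2[OF crt]]) (simp add: prod_of_bool finE)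
    moreover have "real (2 * q) * (of_int (int (\<Prod>E)) / real T) \<le> \<delta>"
      unfolding \<delta>_def using level[OF E]
      by (intro mult_left_mono divide_right_mono) (auto simp del: of_nat_prod)
    ultimately show ?thesis by linarith
  qed
  have K: "(\<Prod>i\<in>I. real (card {e. e \<subseteq> R i \<and> card e \<le> 2 * bb i + 1})) \<le> real N"
  proof -
    have "(\<Prod>i\<in>I. card {e. e \<subseteq> R i \<and> card e \<le> 2 * bb i + 1}) \<le> (\<Prod>i\<in>I. dexp (Suc i) ^ (2 * bb i + 1))"
    proof (intro prod_mono conjI)
      fix i assume i: "i \<in> I"
      have "card {e. e \<subseteq> R i \<and> card e \<le> 2 * bb i + 1} \<le> (card (R i) + 1) ^ (2 * bb i + 1)"
        using I(3)[OF i] by (rule card_small_subsets_le)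
      also have "\<dots> \<le> dexp (Suc i) ^ (2 * bb i + 1)"
        unfolding R_def by (rule power_mono[OF card_primes_between_dexp]) simp
      finally show "card {e. e \<subseteq> R i \<and> card e \<le> 2 * bb i + 1} \<le> dexp (Suc i) ^ (2 * bb i + 1)" .
    qed simp
    also have "\<dots> \<le> N" unfolding N_def I_def bb_def by (rule prod_level_le)
    finally show ?thesis unfolding of_nat_prod[symmetric] of_nat_le_iff .
  qed
  have e: "0 \<le> \<epsilon> i \<and> esym (R i) \<beta> (2 * bb i + 1) \<le> \<epsilon> i * (\<Prod>r\<in>R i. 1 - \<beta> r)" if i: "i \<in> I" for i
  proof
    show "0 \<le> \<epsilon> i" by (simp add: \<epsilon>_def \<kappa>_def)
    have Rr: "real r > 2 * \<kappa>" "r > 0" if "r \<in> R i" for r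
    proof -
      have "dexp b \<le> dexp i" using i by (intro dexp_mono) (simp add: I_def)
      then have "real (dexp b) < real r" using that by (simp add: R_def primes_between_def)
      then show "real r > 2 * \<kappa>" "r > 0" using \<kappa>w by (auto intro: gr0I)
    qed
    have \<beta>le: "\<beta> r \<le> \<kappa> * (1 / real r)" if "r \<in> R i" for r
      using \<beta>2[OF Rr(2)[OF that]] a divide_right_mono[OF a, of "real r"] by simp
    have "sum \<beta> (R i) \<le> (\<Sum>r\<in>R i. \<kappa> * (1 / real r))" using \<beta>le by (rule sum_mono)
    also have "\<dots> \<le> \<kappa> * 2"
      unfolding sum_distrib_left[symmetric] R_def
      using sum_inverse_primes_dexp_le by (intro mult_left_mono) (auto simp: \<kappa>_def)
    finally have s: "sum \<beta> (R i) \<le> 2 * \<kappa>" by simp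
    have s0: "0 \<le> sum \<beta> (R i)" using \<beta> by (intro sum_nonneg) auto
    have "exp (- (4 * \<kappa>)) \<le> exp (- 2 * sum \<beta> (R i))" using s by simp
    also have "\<dots> \<le> (\<Prod>r\<in>R i. 1 - \<beta> r)"
    proof (rule prod_one_minus_ge_exp[OF I(3)[OF i]])
      fix r assume r: "r \<in> R i"
      have "\<kappa> * (1 / real r) \<le> 1 / 2" using Rr[OF r] by (simp add: field_simps)
      then show "0 \<le> \<beta> r \<and> \<beta> r \<le> 1 / 2" using \<beta>[of r] \<beta>le[OF r] by linarith
    qed
    finally have V: "exp (- (4 * \<kappa>)) \<le> (\<Prod>r\<in>R i. 1 - \<beta> r)" .
    have "esym (R i) \<beta> (2 * bb i + 1) \<le> sum \<beta> (R i) ^ (2 * bb i + 1) / fact (2 * bb i + 1)"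
      using I(3)[OF i] \<beta> by (intro esym_le) auto
    also have "\<dots> \<le> (2 * \<kappa>) ^ (2 * bb i + 1) / fact (2 * bb i + 1)"
      using s s0 by (intro divide_right_mono power_mono) auto
    also have "\<dots> = \<epsilon> i * exp (- (4 * \<kappa>))" by (simp add: \<epsilon>_def exp_minus field_simps)
    also have "\<dots> \<le> \<epsilon> i * (\<Prod>r\<in>R i. 1 - \<beta> r)"
      using V \<open>0 \<le> \<epsilon> i\<close> by (rule mult_left_mono)
    finally show "esym (R i) \<beta> (2 * bb i + 1) \<le> \<epsilon> i * (\<Prod>r\<in>R i. 1 - \<beta> r)" .
  qed
  define VA where "VA = (\<Prod>i\<in>I. \<Prod>r\<in>R i. 1 - \<beta> r)"
  define V where "V = sieve_density b L"
  define Pr where "Pr = avg (2 * q) {1..int T} (\<lambda>xs. \<Prod>i\<in>I. \<Prod>r\<in>R i. 1 - of_bool (B r xs))"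
  define \<gamma> where "\<gamma> = exp (2 * \<kappa>\<^sup>2 / real (dexp b)) - 1"
  define \<epsilon>' where "\<epsilon>' = exp (4 * \<kappa>) * exp_tail (2 * \<kappa>) b"
  have UN: "(\<Prod>i\<in>I. \<Prod>r\<in>R i. g r) = (\<Prod>r\<in>P. g r)" for g :: "nat \<Rightarrow> real"
    unfolding P using I by (intro prod.UNION_disjoint[symmetric]) (auto simp: disjoint_family_on_def)
  have 1: "\<bar>Pr - VA\<bar> \<le> VA * (sum \<epsilon> I * exp (sum \<epsilon> I)) + (real (card I) + 1) * (real N * \<delta>)"
    unfolding Pr_def VA_def by (rule brun_hooley_sieve[OF S I \<beta> approx K e])
  have \<epsilon>0: "0 \<le> sum \<epsilon> I" using e by (intro sum_nonneg) auto
  have \<epsilon>: "sum \<epsilon> I \<le> \<epsilon>'"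
  proof -
    \<comment> \<open>Different ranges use different orders, all at least b. Hence the errors of all
      ranges together are part of a single tail of the exponential series, whatever L is.\<close>
    have inj: "inj_on (\<lambda>i. 2 * bb i + 1) I" unfolding inj_on_def I_def bb_def by auto
    have "sum \<epsilon> I = exp (4 * \<kappa>) * (\<Sum>j\<in>(\<lambda>i. 2 * bb i + 1) ` I. (2 * \<kappa>) ^ j / fact j)"
      using inj by (simp add: \<epsilon>_def sum.reindex sum_distrib_left del: fact_Suc power_Suc)
    also have "\<dots> \<le> \<epsilon>'" unfolding \<epsilon>'_def
      by (intro mult_left_mono sum_le_exp_tail) (auto simp: I_def bb_def \<kappa>_def)
    finally show ?thesis .
  qed
  have VA_V: "\<bar>VA / V ^ a - 1\<bar> \<le> \<gamma>"
    unfolding VA_def UN V_def P_def \<gamma>_def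
    by (rule sieve_density_compare[OF bL \<kappa>w a \<beta>2])
  have Vpos: "V > 0" unfolding V_def sieve_density_def
    using sieve_product_lower[OF bL] by (meson exp_gt_zero less_le_trans)
  have VA0: "0 \<le> VA" unfolding VA_def using \<beta> by (intro prod_nonneg) auto
  have "\<bar>Pr / V ^ a - VA / V ^ a\<bar> = \<bar>Pr - VA\<bar> / V ^ a"
    using Vpos by (simp add: diff_divide_distrib[symmetric] abs_divide)
  also have "\<dots> \<le> (VA * (sum \<epsilon> I * exp (sum \<epsilon> I)) + (real (card I) + 1) * (real N * \<delta>)) / V ^ a"
    using 1 Vpos by (intro divide_right_mono) auto
  also have "\<dots> = (VA / V ^ a) * (sum \<epsilon> I * exp (sum \<epsilon> I)) + (real (card I) + 1) * (real N * \<delta>) / V ^ a"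
    by (simp add: add_divide_distrib)
  also have "(real (card I) + 1) * (real N * \<delta>) / V ^ a \<le> 2 * real q / real (dexp b)"
    unfolding I_def N_def \<delta>_def V_def using sieve_remainder_le[OF bL _ T, of a] A(3) by (simp add: a_def)
  also have "(VA / V ^ a) * (sum \<epsilon> I * exp (sum \<epsilon> I)) \<le> (1 + \<gamma>) * (\<epsilon>' * exp \<epsilon>')"
    using VA_V VA0 Vpos \<epsilon>0 \<epsilon> by (intro mult_mono) auto
  finally have 2: "\<bar>Pr / V ^ a - VA / V ^ a\<bar> \<le> (1 + \<gamma>) * (\<epsilon>' * exp \<epsilon>') + 2 * real q / real (dexp b)" by simp
  have "(\<Prod>\<omega>\<in>A. sieve_weight b L (c + cube_form \<omega> xs)) = (1 / V ^ a) * (\<Prod>i\<in>I. \<Prod>r\<in>R i. 1 - of_bool (B r xs))" for xs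
  proof -
    have "(\<Prod>\<omega>\<in>A. of_bool (\<forall>r\<in>P. \<not> int r dvd c + cube_form \<omega> xs) :: real) = of_bool (\<forall>r\<in>P. \<not> B r xs)"
      using A(1) by (subst prod_of_bool) (auto simp: B_def)
    also have "\<dots> = (\<Prod>r\<in>P. of_bool (\<not> B r xs))" by (subst prod_of_bool) (auto simp: P_def)
    also have "\<dots> = (\<Prod>r\<in>P. 1 - of_bool (B r xs))" by (intro prod.cong) auto
    finally have "(\<Prod>\<omega>\<in>A. of_bool (\<forall>r\<in>P. \<not> int r dvd c + cube_form \<omega> xs) :: real) = (\<Prod>r\<in>P. 1 - of_bool (B r xs))" .
    then show ?thesis
      unfolding UN by (simp add: sieve_weight_def prod_dividef P_def V_def a_def)
  qed
  then have "avg (2 * q) {1..int T} (\<lambda>xs. \<Prod>\<omega>\<in>A. sieve_weight b L (c + cube_form \<omega> xs)) = Pr / V ^ a"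
    unfolding Pr_def by (simp only: avg_cmult) simp
  then show ?thesis
    using 2 VA_V unfolding sieve_error_def Let_def \<kappa>_def[symmetric] \<gamma>_def[symmetric] \<epsilon>'_def[symmetric] by linarith
qed

text \<open>Multiplied out, the product of the centred weights is an alternating sum over all
  subsets A of the cube. The signs sum to zero, so the main terms 1 cancel and only 2^(2^q) errors
  remain.\<close>

lemma sieve_cube_centered:
  assumes q: "q > 0" and b: "2 * 2 ^ q \<le> dexp b" and bL: "b \<le> L" and T: "dexp L ^ sieve_exponent q b \<le> T"
  shows "avg (2 * q) {1..int T} (\<lambda>xs. \<Prod>\<omega> | length \<omega> = q. sieve_weight b L (c + cube_form \<omega> xs) - 1)
     \<le> 2 ^ 2 ^ q * sieve_error q b"
proof -
  define C where "C = {\<omega> :: bool list. length \<omega> = q}"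
  have C: "finite C" "card C = 2 ^ q"
    using card_lists_length_eq[of "UNIV :: bool set" q] finite_lists_length_eq[of "UNIV :: bool set" q]
    by (auto simp: C_def)
  let ?\<nu> = "\<lambda>xs \<omega>. sieve_weight b L (c + cube_form \<omega> xs)"
  let ?E = "avg (2 * q) {1..int T}"
  have "(\<Prod>\<omega>\<in>C. ?\<nu> xs \<omega> - 1) = (\<Sum>A\<in>Pow C. (- 1) ^ card (C - A) * (\<Prod>\<omega>\<in>A. ?\<nu> xs \<omega>))" for xs
    using C(1) prod_add[of C "?\<nu> xs" "\<lambda>_. - 1"] by (simp add: mult.commute)
  then have "?E (\<lambda>xs. \<Prod>\<omega>\<in>C. ?\<nu> xs \<omega> - 1) = (\<Sum>A\<in>Pow C. (- 1) ^ card (C - A) * ?E (\<lambda>xs. \<Prod>\<omega>\<in>A. ?\<nu> xs \<omega>))"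
    by (simp add: avg_sum avg_cmult)
  also have "\<dots> = (\<Sum>A\<in>Pow C. (- 1) ^ card (C - A) * (?E (\<lambda>xs. \<Prod>\<omega>\<in>A. ?\<nu> xs \<omega>) - 1))"
  proof -
    have "(\<Prod>\<omega>\<in>C. (1 :: real) + - 1) = 0" using C q by (auto simp: card_gt_0_iff[symmetric])
    then have "(\<Sum>A\<in>Pow C. (- 1) ^ card (C - A) :: real) = 0"
      using C(1) prod_add[of C "\<lambda>_. 1 :: real" "\<lambda>_. - 1"] by (simp only: prod.neutral_const mult_1_left prod_constant)
    then show ?thesis by (simp add: right_diff_distrib sum_subtractf)
  qed
  also have "\<dots> \<le> (\<Sum>A\<in>Pow C. sieve_error q b)"
  proof (rule sum_mono)
    fix A assume A: "A \<in> Pow C"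
    have "\<bar>?E (\<lambda>xs. \<Prod>\<omega>\<in>A. ?\<nu> xs \<omega>) - 1\<bar> \<le> sieve_error q b"
    proof (rule sieve_cube_average[OF q _ _ _ b bL T])
      show "finite A" using A C finite_subset by auto
      show "length \<omega> = q" if "\<omega> \<in> A" for \<omega> using A that by (auto simp: C_def)
      show "card A \<le> 2 ^ q" using A C card_mono[of C A] by auto
    qed
    moreover have "\<bar>(- 1) ^ card (C - A) * (?E (\<lambda>xs. \<Prod>\<omega>\<in>A. ?\<nu> xs \<omega>) - 1)\<bar> = \<bar>?E (\<lambda>xs. \<Prod>\<omega>\<in>A. ?\<nu> xs \<omega>) - 1\<bar>"
      by (simp add: abs_mult power_abs)
    ultimately show "(- 1) ^ card (C - A) * (?E (\<lambda>xs. \<Prod>\<omega>\<in>A. ?\<nu> xs \<omega>) - 1) \<le> sieve_error q b"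
      by linarith
  qed
  also have "\<dots> = 2 ^ 2 ^ q * sieve_error q b" using C by (simp add: card_Pow)
  finally show ?thesis by (simp add: C_def)
qed

section \<open>Box norms and the Cauchy--Schwarz inequality\<close>

text \<open>A direction is a map from the parameter t to a translation, so that multiples of t on
  the line and skew steps in the plane are treated alike.\<close>

primrec shift_avg :: "nat \<Rightarrow> (int \<Rightarrow> 'a::ab_group_add) list \<Rightarrow> ('a \<Rightarrow> real) \<Rightarrow> 'a \<Rightarrow> real" where
  "shift_avg T [] F P = F P"
| "shift_avg T (v # vs) F P = (\<Sum>t\<in>{1..int T}. shift_avg T vs F (P + v t)) / real T"

text \<open>Local box norm without its root: \<phi> is multiplied over the 2^n corners that arise
  from two independent steps t and t' in each of the n directions.\<close>

primrec box_avg :: "nat \<Rightarrow> (int \<Rightarrow> 'a::ab_group_add) list \<Rightarrow> ('a \<Rightarrow> real) \<Rightarrow> 'a \<Rightarrow> real" where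
  "box_avg T [] \<phi> P = \<phi> P"
| "box_avg T (v # vs) \<phi> P =
    (\<Sum>(t, t')\<in>{1..int T} \<times> {1..int T}. box_avg T vs (\<lambda>Q. \<phi> (Q + v t) * \<phi> (Q + v t')) P) / real T ^ 2"

lemma shift_avg_add: "shift_avg T vs (\<lambda>Q. F Q + G Q) P = shift_avg T vs F P + shift_avg T vs G P"
  by (induction vs arbitrary: P) (simp_all add: sum.distrib add_divide_distrib)

lemma shift_avg_zero: "shift_avg T vs (\<lambda>Q. 0) P = 0"
  by (induction vs arbitrary: P) simp_all

lemma shift_avg_cmult: "shift_avg T vs (\<lambda>Q. c * F Q) P = c * shift_avg T vs F P"
  by (induction vs arbitrary: P) (simp_all flip: sum_distrib_left)

lemma shift_avg_sum: "shift_avg T vs (\<lambda>Q. \<Sum>a\<in>A. F a Q) P = (\<Sum>a\<in>A. shift_avg T vs (F a) P)"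
  by (induction A rule: infinite_finite_induct) (simp_all add: shift_avg_zero shift_avg_add)

lemma shift_avg_mono: "(\<And>Q. F Q \<le> G Q) \<Longrightarrow> shift_avg T vs F P \<le> shift_avg T vs G P"
  by (induction vs arbitrary: P) (auto intro!: divide_right_mono sum_mono)

lemma shift_avg_nonneg: "(\<And>Q. 0 \<le> F Q) \<Longrightarrow> 0 \<le> shift_avg T vs F P"
  using shift_avg_mono[of "\<lambda>_. 0" F T vs P] by (simp add: shift_avg_zero)

lemma shift_avg_translate: "shift_avg T vs F (P + w) = shift_avg T vs (\<lambda>Q. F (Q + w)) P"
proof (induction vs arbitrary: P)
  case (Cons v vs)
  have "shift_avg T vs F (P + w + v t) = shift_avg T vs (\<lambda>Q. F (Q + w)) (P + v t)" for t
    using Cons.IH[of "P + v t"] by (simp add: add.assoc add.commute[of w])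
  then show ?case by simp
qed simp

lemma shift_avg_Cons_inner:
  "shift_avg T (v # vs) F P = shift_avg T vs (\<lambda>Q. (\<Sum>t\<in>{1..int T}. F (Q + v t)) / real T) P"
proof -
  have "shift_avg T vs (\<lambda>Q. (1 / real T) * (\<Sum>t\<in>{1..int T}. F (Q + v t))) P
      = (1 / real T) * (\<Sum>t\<in>{1..int T}. shift_avg T vs F (P + v t))"
    by (simp only: shift_avg_cmult shift_avg_sum shift_avg_translate)
  then show ?thesis by simp
qed

text \<open>Jensen's inequality for the exponent 2^n, by repeated Cauchy--Schwarz.\<close>

lemma mean_power_le:
  fixes a :: "'i \<Rightarrow> real"
  assumes "finite A" "A \<noteq> {}"
  shows "(sum a A / real (card A)) ^ (2 ^ n) \<le> (\<Sum>i\<in>A. a i ^ (2 ^ n)) / real (card A)"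
proof (induction n arbitrary: a)
  case (Suc n)
  have "(sum a A)\<^sup>2 \<le> (\<Sum>i\<in>A. (a i)\<^sup>2) * (\<Sum>i\<in>A. 1\<^sup>2)"
    using Cauchy_Schwarz_ineq_sum[of a "\<lambda>_. 1" A] by simp
  then have "(sum a A)\<^sup>2 \<le> (\<Sum>i\<in>A. (a i)\<^sup>2) * real (card A)" by simp
  then have sq: "(sum a A / real (card A))\<^sup>2 \<le> (\<Sum>i\<in>A. (a i)\<^sup>2) / real (card A)"
    using assms by (simp add: power_divide divide_simps power2_eq_square)
  have "(sum a A / real (card A)) ^ (2 ^ Suc n) = ((sum a A / real (card A))\<^sup>2) ^ (2 ^ n)"
    by (simp add: power_mult)
  also have "\<dots> \<le> ((\<Sum>i\<in>A. (a i)\<^sup>2) / real (card A)) ^ (2 ^ n)"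
    using sq by (intro power_mono) auto
  also have "\<dots> \<le> (\<Sum>i\<in>A. ((a i)\<^sup>2) ^ (2 ^ n)) / real (card A)" by (rule Suc)
  finally show ?case by (simp add: power_mult)
qed simp

lemma shift_avg_square:
  assumes "T > 0"
  shows "(shift_avg T vs F P)\<^sup>2 \<le> shift_avg T vs (\<lambda>Q. (F Q)\<^sup>2) P"
proof (induction vs arbitrary: P)
  case (Cons v vs)
  have "(shift_avg T (v # vs) F P)\<^sup>2 \<le> (\<Sum>t\<in>{1..int T}. (shift_avg T vs F (P + v t))\<^sup>2) / real T"
    using mean_power_le[of "{1..int T}" "\<lambda>t. shift_avg T vs F (P + v t)" 1] assms by simp
  also have "\<dots> \<le> (\<Sum>t\<in>{1..int T}. shift_avg T vs (\<lambda>Q. (F Q)\<^sup>2) (P + v t)) / real T"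
    using Cons by (intro divide_right_mono sum_mono) auto
  finally show ?case by simp
qed simp

definition invariant_along :: "('a::ab_group_add \<Rightarrow> real) \<Rightarrow> (int \<Rightarrow> 'a) \<Rightarrow> bool" where
  "invariant_along g v \<longleftrightarrow> (\<forall>P t. g (P + v t) = g P) \<and> (\<forall>P. \<bar>g P\<bar> \<le> 1)"

text \<open>One direction at a time: g does not change along its own direction v, so it comes out of
  the average over t and disappears by Cauchy--Schwarz and the bound 1. Every other function k is
  doubled to k(Q + v t) k(Q + v t'), which stays invariant along its own direction because
  translations commute.\<close>

lemma box_cauchy_schwarz_aux:
  assumes T: "T > 0"
  shows "map fst gs = vs \<Longrightarrow> (\<And>v g. (v, g) \<in> set gs \<Longrightarrow> invariant_along g v) \<Longrightarrow>
    shift_avg T (map fst gs) (\<lambda>P. \<phi> P * (\<Prod>(v, g)\<leftarrow>gs. g P)) P ^ (2 ^ length gs) \<le> box_avg T (map fst gs) \<phi> P"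
proof (induction vs arbitrary: gs \<phi>)
  case (Cons v vs gs1)
  obtain g gs where gs1: "gs1 = (v, g) # gs" and vs: "map fst gs = vs"
    using Cons.prems(1) by (cases gs1) auto
  define vg where vg: "vg = (v, g)"
  define pg where "pg P = (\<Prod>(v, g)\<leftarrow>gs. g P)" for P
  have g: "g (P + v t) = g P" "\<bar>g P\<bar> \<le> 1" for P t
    using Cons.prems(2)[of v g] by (auto simp: gs1 invariant_along_def)
  let ?S = "{1..int T}"
  define G where "G Q = (\<Sum>t\<in>?S. \<phi> (Q + v t) * pg (Q + v t)) / real T" for Q
  define H where "H t t' Q = (\<phi> (Q + v t) * \<phi> (Q + v t')) * (pg (Q + v t) * pg (Q + v t'))" for t t' Q
  have "shift_avg T (map fst (vg # gs)) (\<lambda>P. \<phi> P * (\<Prod>(v, g)\<leftarrow>vg # gs. g P)) P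
      = shift_avg T (map fst gs) (\<lambda>Q. g Q * G Q) P"
    unfolding list.map vg fst_conv shift_avg_Cons_inner
    by (simp add: g pg_def G_def sum_distrib_left mult_ac)
  then have "shift_avg T (map fst (vg # gs)) (\<lambda>P. \<phi> P * (\<Prod>(v, g)\<leftarrow>vg # gs. g P)) P ^ (2 ^ length (vg # gs))
      = ((shift_avg T (map fst gs) (\<lambda>Q. g Q * G Q) P)\<^sup>2) ^ (2 ^ length gs)"
    by (simp add: power_mult)
  also have "\<dots> \<le> ((\<Sum>(t, t')\<in>?S \<times> ?S. shift_avg T (map fst gs) (H t t') P) / real (card (?S \<times> ?S))) ^ (2 ^ length gs)"
  proof (rule power_mono)
    have "(shift_avg T (map fst gs) (\<lambda>Q. g Q * G Q) P)\<^sup>2 \<le> shift_avg T (map fst gs) (\<lambda>Q. (g Q * G Q)\<^sup>2) P"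
      using T by (rule shift_avg_square)
    also have "\<dots> \<le> shift_avg T (map fst gs) (\<lambda>Q. (1 / real T ^ 2) * (\<Sum>(t, t')\<in>?S \<times> ?S. H t t' Q)) P"
    proof (rule shift_avg_mono)
      fix Q
      have "(g Q * G Q)\<^sup>2 = (g Q)\<^sup>2 * (G Q)\<^sup>2" by (rule power_mult_distrib)
      also have "\<dots> \<le> 1 * (G Q)\<^sup>2"
        using g(2)[of Q] by (intro mult_right_mono) (simp_all add: abs_square_le_1)
      also have "\<dots> = (1 / real T ^ 2) * ((\<Sum>t\<in>?S. \<phi> (Q + v t) * pg (Q + v t)) * (\<Sum>t\<in>?S. \<phi> (Q + v t) * pg (Q + v t)))"
        by (simp add: G_def power_divide power2_eq_square)
      also have "\<dots> = (1 / real T ^ 2) * (\<Sum>(t, t')\<in>?S \<times> ?S. H t t' Q)"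
        unfolding sum_product sum.cartesian_product H_def by (simp add: mult_ac)
      finally show "(g Q * G Q)\<^sup>2 \<le> (1 / real T ^ 2) * (\<Sum>(t, t')\<in>?S \<times> ?S. H t t' Q)" .
    qed
    also have "\<dots> = (\<Sum>(t, t')\<in>?S \<times> ?S. shift_avg T (map fst gs) (H t t') P) / real (card (?S \<times> ?S))"
      unfolding shift_avg_cmult case_prod_beta shift_avg_sum by (simp add: power2_eq_square)
    finally show "(shift_avg T (map fst gs) (\<lambda>Q. g Q * G Q) P)\<^sup>2
        \<le> (\<Sum>(t, t')\<in>?S \<times> ?S. shift_avg T (map fst gs) (H t t') P) / real (card (?S \<times> ?S))" .
  qed simp
  also have "\<dots> \<le> (\<Sum>(t, t')\<in>?S \<times> ?S. shift_avg T (map fst gs) (H t t') P ^ (2 ^ length gs)) / real (card (?S \<times> ?S))"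
    unfolding case_prod_beta using T by (intro mean_power_le) auto
  also have "\<dots> \<le> (\<Sum>(t, t')\<in>?S \<times> ?S. box_avg T (map fst gs) (\<lambda>Q. \<phi> (Q + v t) * \<phi> (Q + v t')) P) / real (card (?S \<times> ?S))"
  proof (intro divide_right_mono sum_mono, clarsimp)
    fix t t'
    define gs' where "gs' = map (\<lambda>(w, k). (w, \<lambda>Q. k (Q + v t) * k (Q + v t'))) gs"
    have fst: "map fst gs' = map fst gs" "length gs' = length gs" by (simp_all add: gs'_def o_def case_prod_beta)
    have "(\<Prod>(w, k)\<leftarrow>gs'. k Q) = pg (Q + v t) * pg (Q + v t')" for Q
      unfolding gs'_def pg_def by (induction gs) (auto simp: mult_ac)
    then have H: "H t t' = (\<lambda>Q. (\<phi> (Q + v t) * \<phi> (Q + v t')) * (\<Prod>(w, k)\<leftarrow>gs'. k Q))"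
      by (simp add: H_def fun_eq_iff)
    have inv': "invariant_along k' w" if k': "(w, k') \<in> set gs'" for w k'
    proof -
      obtain k where k: "(w, k) \<in> set gs" "k' = (\<lambda>Q. k (Q + v t) * k (Q + v t'))"
        using k' by (auto simp: gs'_def)
      have inv: "k (Q + w s) = k Q" "\<bar>k Q\<bar> \<le> 1" for Q s
        using Cons.prems(2)[of w k] k(1) by (auto simp: gs1 invariant_along_def)
      have "k (Q + w s + u) = k (Q + u)" for Q s u
        using inv(1)[of "Q + u" s] by (simp add: add_ac)
      then show ?thesis
        unfolding k(2) invariant_along_def using inv(2) by (auto simp: abs_mult intro!: mult_le_one)
    qed
    have "shift_avg T (map fst gs') (\<lambda>Q. (\<phi> (Q + v t) * \<phi> (Q + v t')) * (\<Prod>(w, k)\<leftarrow>gs'. k Q)) P ^ (2 ^ length gs')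
        \<le> box_avg T (map fst gs') (\<lambda>Q. \<phi> (Q + v t) * \<phi> (Q + v t')) P"
      using fst(1) vs inv' by (intro Cons.IH) auto
    then show "shift_avg T (map fst gs) (H t t') P ^ (2 ^ length gs)
        \<le> box_avg T (map fst gs) (\<lambda>Q. \<phi> (Q + v t) * \<phi> (Q + v t')) P"
      unfolding fst H .
  qed simp
  finally show ?case unfolding gs1 using T by (simp add: vg power2_eq_square)
qed simp

lemmas box_cauchy_schwarz = box_cauchy_schwarz_aux[OF _ refl]

lemma box_cauchy_schwarz_abs:
  assumes T: "T > 0" and gs: "gs \<noteq> []" "\<And>v g. (v, g) \<in> set gs \<Longrightarrow> invariant_along g v"
  shows "\<bar>shift_avg T (map fst gs) (\<lambda>P. \<phi> P * (\<Prod>(v, g)\<leftarrow>gs. g P)) P\<bar> ^ (2 ^ length gs) \<le> box_avg T (map fst gs) \<phi> P"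
proof -
  have "even ((2::nat) ^ length gs)" using gs(1) by (cases gs) auto
  then show ?thesis using box_cauchy_schwarz[OF T gs(2)] by (simp add: power_even_abs)
qed

lemma box_avg_snd:
  fixes vs :: "(int \<Rightarrow> 'a::ab_group_add \<times> 'b::ab_group_add) list"
  shows "box_avg T vs (\<lambda>P. \<phi> (snd P)) P = box_avg T (map (\<lambda>v t. snd (v t)) vs) \<phi> (snd P)"
proof (induction vs arbitrary: \<phi>)
  case (Cons v vs)
  show ?case using Cons.IH[of "\<lambda>R. \<phi> (R + snd (v _)) * \<phi> (R + snd (v _))"] by simp
qed simp

lemma box_avg_fst:
  fixes vs :: "(int \<Rightarrow> 'a::ab_group_add \<times> 'b::ab_group_add) list"
  shows "box_avg T vs (\<lambda>P. \<phi> (fst P)) P = box_avg T (map (\<lambda>v t. fst (v t)) vs) \<phi> (fst P)"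
proof (induction vs arbitrary: \<phi>)
  case (Cons v vs)
  show ?case using Cons.IH[of "\<lambda>R. \<phi> (R + fst (v _)) * \<phi> (R + fst (v _))"] by simp
qed simp

lemma prod_bool_lists_Suc:
  fixes f :: "bool list \<Rightarrow> real"
  shows "(\<Prod>\<omega> | length \<omega> = Suc q. f \<omega>) = (\<Prod>\<omega> | length \<omega> = q. f (False # \<omega>) * f (True # \<omega>))"
proof -
  have fin: "finite {\<omega> :: bool list. length \<omega> = q}"
    using finite_lists_length_eq[of "UNIV :: bool set" q] by simp
  have "{\<omega> :: bool list. length \<omega> = Suc q} = Cons False ` {\<omega>. length \<omega> = q} \<union> Cons True ` {\<omega>. length \<omega> = q}"
    by (auto simp: length_Suc_conv)
  then have "(\<Prod>\<omega> | length \<omega> = Suc q. f \<omega>)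
      = (\<Prod>\<omega>\<in>Cons False ` {\<omega>. length \<omega> = q}. f \<omega>) * (\<Prod>\<omega>\<in>Cons True ` {\<omega>. length \<omega> = q}. f \<omega>)"
    using fin by (simp only:) (rule prod.union_disjoint, auto)
  then show ?thesis by (simp add: prod.reindex prod.distrib)
qed

text \<open>Connects box averages with the sieve: all directions are unit steps, so the corner at
  the vertex \<omega> is displaced by \<open>cube_form \<omega>\<close>.\<close>

lemma box_avg_cube:
  assumes "T > 0"
  shows "box_avg T (replicate q (\<lambda>t. t)) \<phi> d = avg (2 * q) {1..int T} (\<lambda>xs. \<Prod>\<omega> | length \<omega> = q. \<phi> (d + cube_form \<omega> xs))"
proof (induction q arbitrary: \<phi>)
  case 0
  have "{\<omega> :: bool list. length \<omega> = 0} = {[]}" by auto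
  then show ?case by simp
next
  case (Suc q)
  have len: "2 * Suc q = Suc (Suc (2 * q))" by simp
  have eq: "(\<Prod>\<omega> | length \<omega> = q. \<phi> (d + cube_form \<omega> xs + t) * \<phi> (d + cube_form \<omega> xs + t'))
      = (\<Prod>\<omega> | length \<omega> = Suc q. \<phi> (d + cube_form \<omega> (t # t' # xs)))" for xs t t'
    unfolding prod_bool_lists_Suc by (simp add: add_ac)
  have "box_avg T (replicate (Suc q) (\<lambda>t. t)) \<phi> d
      = (\<Sum>t\<in>{1..int T}. \<Sum>t'\<in>{1..int T}. avg (2 * q) {1..int T}
          (\<lambda>xs. \<Prod>\<omega> | length \<omega> = Suc q. \<phi> (d + cube_form \<omega> (t # t' # xs)))) / real T ^ 2"
    unfolding eq[symmetric] by (simp add: Suc sum.cartesian_product del: avg.simps)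
  also have "\<dots> = avg (2 * Suc q) {1..int T} (\<lambda>xs. \<Prod>\<omega> | length \<omega> = Suc q. \<phi> (d + cube_form \<omega> xs))"
    unfolding len avg_add_two avg_sum by simp
  finally show ?case .
qed

text \<open>With the left end lowered by T for each direction, every translate of the window still
  covers the original one.\<close>

lemma sum_le_sum_shift_avg:
  fixes G :: "int \<Rightarrow> real"
  assumes T: "T > 0" and G: "\<And>d. 0 \<le> G d"
  shows "(\<Sum>d\<in>{a..b}. G d) \<le> (\<Sum>d\<in>{a - int q * int T..b}. shift_avg T (replicate q (\<lambda>t. t)) G d)"
proof (induction q arbitrary: a b)
  case (Suc q)
  let ?A = "shift_avg T (replicate q (\<lambda>t. t)) G"
  have "(\<Sum>d\<in>{a..b}. G d) \<le> (\<Sum>x\<in>{a - int q * int T..b}. ?A x)" by (rule Suc)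
  also have "\<dots> = (\<Sum>t\<in>{1..int T}. \<Sum>x\<in>{a - int q * int T..b}. ?A x) / real T" using T by simp
  also have "\<dots> \<le> (\<Sum>t\<in>{1..int T}. \<Sum>d\<in>{a - int (Suc q) * int T..b}. ?A (d + t)) / real T"
  proof (intro divide_right_mono sum_mono)
    fix t assume t: "t \<in> {1..int T}"
    have "(\<Sum>x\<in>{a - int q * int T..b}. ?A x) = (\<Sum>d\<in>{a - int q * int T - t..b - t}. ?A (d + t))"
      by (rule sum.reindex_bij_witness[of _ "\<lambda>d. d + t" "\<lambda>x. x - t"]) auto
    also have "\<dots> \<le> (\<Sum>d\<in>{a - int (Suc q) * int T..b}. ?A (d + t))"
      using t G by (intro sum_mono2 shift_avg_nonneg) (auto simp: algebra_simps)
    finally show "(\<Sum>x\<in>{a - int q * int T..b}. ?A x) \<le> (\<Sum>d\<in>{a - int (Suc q) * int T..b}. ?A (d + t))" .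
  qed simp
  also have "\<dots> = (\<Sum>d\<in>{a - int (Suc q) * int T..b}. shift_avg T (replicate (Suc q) (\<lambda>t. t)) G d)"
    by (subst sum.swap) (simp add: sum_divide_distrib)
  finally show ?case .
qed simp

lemma sum_shift_avg_le:
  fixes G :: "int \<Rightarrow> real"
  assumes T: "T > 0" and G: "\<And>d. 0 \<le> G d"
  shows "(\<Sum>d\<in>{a..b}. shift_avg T (replicate q (\<lambda>t. t)) G d) \<le> (\<Sum>d\<in>{a..b + int q * int T}. G d)"
proof (induction q arbitrary: a b)
  case (Suc q)
  let ?A = "shift_avg T (replicate q (\<lambda>t. t)) G"
  have "(\<Sum>d\<in>{a..b}. shift_avg T (replicate (Suc q) (\<lambda>t. t)) G d) = (\<Sum>t\<in>{1..int T}. \<Sum>d\<in>{a..b}. ?A (d + t)) / real T"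
    by (subst sum.swap) (simp add: sum_divide_distrib)
  also have "\<dots> \<le> (\<Sum>t\<in>{1..int T}. \<Sum>x\<in>{a..b + int T}. ?A x) / real T"
  proof (intro divide_right_mono sum_mono)
    fix t assume t: "t \<in> {1..int T}"
    have "(\<Sum>d\<in>{a..b}. ?A (d + t)) = (\<Sum>x\<in>{a + t..b + t}. ?A x)"
      by (rule sum.reindex_bij_witness[of _ "\<lambda>x. x - t" "\<lambda>d. d + t"]) auto
    also have "\<dots> \<le> (\<Sum>x\<in>{a..b + int T}. ?A x)"
      using t G by (intro sum_mono2 shift_avg_nonneg) auto
    finally show "(\<Sum>d\<in>{a..b}. ?A (d + t)) \<le> (\<Sum>x\<in>{a..b + int T}. ?A x)" .
  qed simp
  also have "\<dots> = (\<Sum>x\<in>{a..b + int T}. ?A x)" using T by simp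
  also have "\<dots> \<le> (\<Sum>d\<in>{a..b + int T + int q * int T}. G d)" by (rule Suc)
  finally show ?case by (simp add: algebra_simps)
qed simp

text \<open>The step in (j, d) along which j + d h stays constant; for h = 0 it fixes j.\<close>

definition skew_step :: "nat \<Rightarrow> int \<Rightarrow> int \<times> int" where
  "skew_step h t = (- int h * t, t)"

text \<open>The steps lower j by at most T times the sum of the h. Once the window for j is long
  enough to catch every translate, summing over j forgets the first component and leaves unit steps
  in d.\<close>

lemma sum_window_shift_avg:
  fixes G :: "int \<times> int \<Rightarrow> real"
  assumes G: "\<And>j d. j < 1 \<or> j > J \<Longrightarrow> G (j, d) = 0"
  shows "lo \<le> 1 \<Longrightarrow> J + int (sum_list hs) * int T \<le> hi \<Longrightarrow>
    (\<Sum>j\<in>{lo..hi}. shift_avg T (map skew_step hs) G (j, d))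
      = shift_avg T (replicate (length hs) (\<lambda>t. t)) (\<lambda>d. \<Sum>j\<in>{1..J}. G (j, d)) d"
proof (induction hs arbitrary: lo hi d)
  case Nil
  then show ?case using G by (auto intro!: sum.mono_neutral_right)
next
  case (Cons h hs)
  have "(\<Sum>j\<in>{lo..hi}. shift_avg T (map skew_step (h # hs)) G (j, d))
      = (\<Sum>t\<in>{1..int T}. \<Sum>j\<in>{lo..hi}. shift_avg T (map skew_step hs) G (j - int h * t, d + t)) / real T"
    by (subst sum.swap) (simp add: sum_divide_distrib skew_step_def)
  also have "(\<Sum>t\<in>{1..int T}. \<Sum>j\<in>{lo..hi}. shift_avg T (map skew_step hs) G (j - int h * t, d + t))
      = (\<Sum>t\<in>{1..int T}. shift_avg T (replicate (length hs) (\<lambda>t. t)) (\<lambda>d. \<Sum>j\<in>{1..J}. G (j, d)) (d + t))"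
  proof (rule sum.cong[OF refl])
    fix t assume t: "t \<in> {1..int T}"
    have ht: "0 \<le> int h * t" "int h * t \<le> int h * int T" using t by (auto intro: mult_left_mono)
    have "(\<Sum>j\<in>{lo..hi}. shift_avg T (map skew_step hs) G (j - int h * t, d + t))
        = (\<Sum>j\<in>{lo - int h * t..hi - int h * t}. shift_avg T (map skew_step hs) G (j, d + t))"
      by (rule sum.reindex_bij_witness[of _ "\<lambda>j. j + int h * t" "\<lambda>j. j - int h * t"]) auto
    also have "\<dots> = shift_avg T (replicate (length hs) (\<lambda>t. t)) (\<lambda>d. \<Sum>j\<in>{1..J}. G (j, d)) (d + t)"
      using Cons.prems ht by (intro Cons.IH) (auto simp: algebra_simps)
    finally show "(\<Sum>j\<in>{lo..hi}. shift_avg T (map skew_step hs) G (j - int h * t, d + t))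
      = shift_avg T (replicate (length hs) (\<lambda>t. t)) (\<lambda>d. \<Sum>j\<in>{1..J}. G (j, d)) (d + t)" .
  qed
  finally show ?case by simp
qed

definition dilate_mean :: "(int \<Rightarrow> real) \<Rightarrow> nat list \<Rightarrow> nat \<Rightarrow> int \<Rightarrow> real" where
  "dilate_mean f hs J d = (\<Sum>j\<in>{1..int J}. \<Prod>h\<leftarrow>hs. f (j + d * int h)) / real J"

lemma abs_prod_list_le_1: "(\<And>x. x \<in> set xs \<Longrightarrow> \<bar>g x\<bar> \<le> (1::real)) \<Longrightarrow> \<bar>\<Prod>x\<leftarrow>xs. g x\<bar> \<le> 1"
  by (induction xs) (auto simp: abs_mult intro!: mult_le_one)

lemma abs_dilate_mean_le:
  assumes "\<And>y. \<bar>f y\<bar> \<le> 1" "J > 0"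
  shows "\<bar>dilate_mean f hs J d\<bar> \<le> 1"
proof -
  have "\<bar>\<Sum>j\<in>{1..int J}. \<Prod>h\<leftarrow>hs. f (j + d * int h)\<bar> \<le> (\<Sum>j\<in>{1..int J}. \<bar>\<Prod>h\<leftarrow>hs. f (j + d * int h)\<bar>)"
    by (rule sum_abs)
  also have "\<dots> \<le> (\<Sum>j\<in>{1..int J}. 1)"
    using assms(1) by (intro sum_mono abs_prod_list_le_1) auto
  finally show ?thesis using assms(2) by (simp add: dilate_mean_def abs_divide)
qed

text \<open>Squaring \<open>dilate_mean\<close> produces pairs of positions j and j + s. For fixed s
  the summand is a product, over h, of functions of j + d h, each invariant along its own skew step,
  and of a cutoff in j, invariant along the step with h = 0. Cauchy--Schwarz removes all of them and
  leaves the box average of \<nu> - 1 in d alone, so boundedness is all that is asked of f.\<close>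

lemma sieve_transfer:
  fixes f \<nu> :: "int \<Rightarrow> real"
  assumes f: "\<And>y. \<bar>f y\<bar> \<le> 1" and \<nu>: "\<And>d. 0 \<le> \<nu> d" and T: "T > 0" and J: "J > 0"
    and q: "q = Suc (length hs)" and M: "\<And>h. h \<in> set hs \<Longrightarrow> h \<le> M"
    and D: "q * T \<le> D" "M * D \<le> J" and E: "0 \<le> E"
    and box: "\<And>c. box_avg T (replicate q (\<lambda>t. t)) (\<lambda>d. \<nu> d - 1) c \<le> E ^ (2 ^ q)"
  shows "(\<Sum>d\<in>{1..int D}. \<nu> d * (dilate_mean f hs J d)\<^sup>2)
      \<le> (\<Sum>d\<in>{- int D..2 * int D}. (dilate_mean f hs J d)\<^sup>2) + 12 * real D * E"
proof -
  define F where "F d = (dilate_mean f hs J d)\<^sup>2" for d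
  define c where "c j = (of_bool (1 \<le> j \<and> j \<le> int J) :: real)" for j
  define p where "p j d = (\<Prod>h\<leftarrow>hs. f (j + d * int h))" for j d
  define \<psi> where "\<psi> s P = (c (fst P) * c (fst P + s)) * (p (fst P) (snd P) * p (fst P + s) (snd P))" for s P
  let ?A = "shift_avg T (replicate q (\<lambda>t. t))"
  have F_eq: "F d = (\<Sum>s\<in>{- int J..int J}. \<Sum>j\<in>{1..int J}. \<psi> s (j, d)) / real J ^ 2" for d
  proof -
    have "(\<Sum>j\<in>{1..int J}. p j d)\<^sup>2 = (\<Sum>j\<in>{1..int J}. \<Sum>i\<in>{1..int J}. p j d * p i d)"
      by (simp add: power2_eq_square sum_product)
    also have "\<dots> = (\<Sum>j\<in>{1..int J}. \<Sum>s\<in>{- int J..int J}. \<psi> s (j, d))"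
    proof (rule sum.cong[OF refl])
      fix j assume j: "j \<in> {1..int J}"
      have "(\<Sum>i\<in>{1..int J}. p j d * p i d) = (\<Sum>s\<in>{1 - j..int J - j}. p j d * p (j + s) d)"
        by (rule sum.reindex_bij_witness[of _ "\<lambda>s. j + s" "\<lambda>i. i - j"]) auto
      also have "\<dots> = (\<Sum>s\<in>{1 - j..int J - j}. \<psi> s (j, d))"
        using j by (intro sum.cong) (auto simp: \<psi>_def c_def)
      also have "\<dots> = (\<Sum>s\<in>{- int J..int J}. \<psi> s (j, d))"
        using j by (intro sum.mono_neutral_left) (auto simp: \<psi>_def c_def)
      finally show "(\<Sum>i\<in>{1..int J}. p j d * p i d) = (\<Sum>s\<in>{- int J..int J}. \<psi> s (j, d))" .
    qed
    also have "\<dots> = (\<Sum>s\<in>{- int J..int J}. \<Sum>j\<in>{1..int J}. \<psi> s (j, d))" by (rule sum.swap)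
    finally show ?thesis by (simp add: F_def dilate_mean_def p_def power_divide)
  qed
  have F0: "0 \<le> F d" for d by (simp add: F_def)
  \<comment> \<open>The total displacement of j is at most J, so the window {1..2 J} suffices
    below.\<close>
  have sumh: "int (sum_list (0 # hs)) * int T \<le> int J"
  proof -
    have "sum_list hs \<le> length hs * M" using M by (induction hs) (auto intro: add_mono)
    then have "sum_list hs * T \<le> length hs * M * T" by (rule mult_right_mono) simp
    also have "\<dots> \<le> M * (q * T)" by (simp add: q)
    also have "\<dots> \<le> J" using D by (meson le_trans mult_le_mono2)
    finally show ?thesis by (simp flip: of_nat_mult)
  qed
  \<comment> \<open>The constant 6 bounds the number of pairs (s, j), which is (2 J + 1) times 2 J,
    divided by J^2.\<close>
  have err: "\<bar>?A (\<lambda>d. (\<nu> d - 1) * F d) d0\<bar> \<le> 6 * E" for d0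
  proof -
    define \<Psi> where "\<Psi> s P = (\<nu> (snd P) - 1) * \<psi> s P" for s P
    have small: "\<bar>shift_avg T (map skew_step (0 # hs)) (\<Psi> s) (j0, d0)\<bar> \<le> E" for s j0
    proof -
      define gs where "gs = (skew_step 0, \<lambda>P. c (fst P) * c (fst P + s)) #
        map (\<lambda>h. (skew_step h, \<lambda>P. f (fst P + snd P * int h) * f (fst P + s + snd P * int h))) hs"
      have fst: "map fst gs = map skew_step (0 # hs)" "length gs = q" by (simp_all add: gs_def q o_def)
      have pp: "p (fst P) (snd P) * p (fst P + s) (snd P)
          = (\<Prod>h\<leftarrow>hs. f (fst P + snd P * int h) * f (fst P + s + snd P * int h))" for P
        unfolding p_def by (induction hs) (auto simp: mult_ac)
      have \<Psi>: "\<Psi> s = (\<lambda>P. (\<nu> (snd P) - 1) * (\<Prod>(v, g)\<leftarrow>gs. g P))"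
        by (rule ext) (simp add: \<Psi>_def \<psi>_def gs_def pp o_def)
      have inv: "invariant_along g v" if "(v, g) \<in> set gs" for v g
        using that f unfolding gs_def invariant_along_def
        by (auto simp: skew_step_def c_def algebra_simps abs_mult intro!: mult_le_one)
      have "\<bar>shift_avg T (map fst gs) (\<lambda>P. (\<nu> (snd P) - 1) * (\<Prod>(v, g)\<leftarrow>gs. g P)) (j0, d0)\<bar> ^ (2 ^ length gs)
          \<le> box_avg T (map fst gs) (\<lambda>P. \<nu> (snd P) - 1) (j0, d0)"
        using inv by (intro box_cauchy_schwarz_abs[OF T]) (auto simp: gs_def)
      also have "\<dots> = box_avg T (map (\<lambda>v t. snd (v t)) (map fst gs)) (\<lambda>d. \<nu> d - 1) d0"
        by (subst box_avg_snd) simp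
      also have "map (\<lambda>v t. snd (v t)) (map fst gs) = replicate q (\<lambda>t. t)"
        unfolding fst q by (simp add: skew_step_def o_def map_replicate_const)
      also have "box_avg T (replicate q (\<lambda>t. t)) (\<lambda>d. \<nu> d - 1) d0 \<le> E ^ (2 ^ q)" by (rule box)
      finally have "\<bar>shift_avg T (map skew_step (0 # hs)) (\<Psi> s) (j0, d0)\<bar> ^ (2 ^ q) \<le> E ^ (2 ^ q)"
        unfolding \<Psi> fst .
      then show ?thesis using E by (simp add: power_mono_iff)
    qed
    have "?A (\<lambda>d. (\<nu> d - 1) * F d) d0
        = ?A (\<lambda>d. (1 / real J ^ 2) * (\<Sum>s\<in>{- int J..int J}. \<Sum>j\<in>{1..int J}. \<Psi> s (j, d))) d0"
      by (simp add: F_eq \<Psi>_def sum_distrib_left sum_divide_distrib)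
    also have "\<dots> = (1 / real J ^ 2) * (\<Sum>s\<in>{- int J..int J}. ?A (\<lambda>d. \<Sum>j\<in>{1..int J}. \<Psi> s (j, d)) d0)"
      by (simp only: shift_avg_cmult shift_avg_sum)
    also have "(\<Sum>s\<in>{- int J..int J}. ?A (\<lambda>d. \<Sum>j\<in>{1..int J}. \<Psi> s (j, d)) d0)
        = (\<Sum>s\<in>{- int J..int J}. \<Sum>j\<in>{1..2 * int J}. shift_avg T (map skew_step (0 # hs)) (\<Psi> s) (j, d0))"
    proof (rule sum.cong[OF refl])
      fix s
      have len: "q = length (0 # hs)" by (simp add: q)
      show "?A (\<lambda>d. \<Sum>j\<in>{1..int J}. \<Psi> s (j, d)) d0
          = (\<Sum>j\<in>{1..2 * int J}. shift_avg T (map skew_step (0 # hs)) (\<Psi> s) (j, d0))"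
        unfolding len
        by (rule sum_window_shift_avg[symmetric]) (use sumh in \<open>auto simp: \<Psi>_def \<psi>_def c_def\<close>)
    qed
    finally have "\<bar>?A (\<lambda>d. (\<nu> d - 1) * F d) d0\<bar>
        = (1 / real J ^ 2) * \<bar>\<Sum>s\<in>{- int J..int J}. \<Sum>j\<in>{1..2 * int J}. shift_avg T (map skew_step (0 # hs)) (\<Psi> s) (j, d0)\<bar>"
      by (simp add: abs_mult)
    also have "\<dots> \<le> (1 / real J ^ 2) * (\<Sum>s\<in>{- int J..int J}. \<Sum>j\<in>{1..2 * int J}. E)"
      using small by (intro mult_left_mono order.trans[OF sum_abs] sum_mono order.trans[OF sum_abs]) auto
    also have "\<dots> = (1 / real J ^ 2) * ((2 * real J + 1) * (2 * real J) * E)" by simp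
    also have "\<dots> \<le> (1 / real J ^ 2) * ((3 * real J) * (2 * real J) * E)"
      using J E by (intro mult_left_mono mult_right_mono) auto
    also have "\<dots> = 6 * E" using J by (simp add: power2_eq_square)
    finally show ?thesis .
  qed
  have qT: "int q * int T \<le> int D" using D(1) by (simp flip: of_nat_mult)
  have "(\<Sum>d\<in>{1..int D}. \<nu> d * F d) \<le> (\<Sum>d\<in>{1 - int q * int T..int D}. ?A (\<lambda>d. \<nu> d * F d) d)"
    using T \<nu> F0 by (intro sum_le_sum_shift_avg) auto
  also have "\<dots> = (\<Sum>d\<in>{1 - int q * int T..int D}. ?A F d) + (\<Sum>d\<in>{1 - int q * int T..int D}. ?A (\<lambda>d. (\<nu> d - 1) * F d) d)"
    by (simp add: shift_avg_add[symmetric] sum.distrib[symmetric] algebra_simps)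
  also have "(\<Sum>d\<in>{1 - int q * int T..int D}. ?A F d) \<le> (\<Sum>d\<in>{1 - int q * int T..int D + int q * int T}. F d)"
    using T F0 by (rule sum_shift_avg_le)
  also have "\<dots> \<le> (\<Sum>d\<in>{- int D..2 * int D}. F d)"
    using qT F0 by (intro sum_mono2) auto
  also have "(\<Sum>d\<in>{1 - int q * int T..int D}. ?A (\<lambda>d. (\<nu> d - 1) * F d) d) \<le> (\<Sum>d\<in>{1 - int q * int T..int D}. 6 * E)"
  proof (rule sum_mono)
    fix d show "?A (\<lambda>d. (\<nu> d - 1) * F d) d \<le> 6 * E" using err[of d] by linarith
  qed
  also have "\<dots> = real_of_int (int D + int q * int T) * (6 * E)" by simp
  also have "\<dots> \<le> real_of_int (2 * int D) * (6 * E)"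
    using qT E by (intro mult_right_mono) (auto simp flip: of_int_mult of_int_add)
  finally show ?thesis by (simp add: F_def)
qed

section \<open>Gowers norms and dilated means\<close>

lemma sum_translate_rect:
  fixes F :: "int \<times> int \<Rightarrow> real"
  shows "(\<Sum>P\<in>{a..b} \<times> {c..e}. F (P + w)) = (\<Sum>P\<in>{a + fst w..b + fst w} \<times> {c + snd w..e + snd w}. F P)"
  by (cases w, rule sum.reindex_bij_witness[of _ "\<lambda>P. P - w" "\<lambda>P. P + w"]) auto

text \<open>Translations preserve the total as long as the rectangle contains the support enlarged
  by B for every step.\<close>

lemma sum_rect_shift_avg:
  fixes \<Phi> :: "int \<times> int \<Rightarrow> real"
  assumes T: "T > 0" and B: "0 \<le> B"
    and supp: "\<And>y d. \<not> (y1 \<le> y \<and> y \<le> y2 \<and> d1 \<le> d \<and> d \<le> d2) \<Longrightarrow> \<Phi> (y, d) = 0"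
  shows "(\<And>v t. v \<in> set vs \<Longrightarrow> t \<in> {1..int T} \<Longrightarrow> \<bar>fst (v t)\<bar> \<le> B \<and> \<bar>snd (v t)\<bar> \<le> B) \<Longrightarrow>
    a \<le> y1 - int (length vs) * B \<Longrightarrow> y2 + int (length vs) * B \<le> b \<Longrightarrow>
    c \<le> d1 - int (length vs) * B \<Longrightarrow> d2 + int (length vs) * B \<le> e \<Longrightarrow>
    (\<Sum>P\<in>{a..b} \<times> {c..e}. shift_avg T vs \<Phi> P) = (\<Sum>P\<in>{y1..y2} \<times> {d1..d2}. \<Phi> P)"
proof (induction vs arbitrary: a b c e)
  case Nil
  have "(\<Sum>P\<in>{a..b} \<times> {c..e}. \<Phi> P) = (\<Sum>P\<in>{y1..y2} \<times> {d1..d2}. \<Phi> P)"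
  proof (rule sum.mono_neutral_right)
    show "\<forall>P\<in>{a..b} \<times> {c..e} - {y1..y2} \<times> {d1..d2}. \<Phi> P = 0"
    proof
      fix P assume "P \<in> {a..b} \<times> {c..e} - {y1..y2} \<times> {d1..d2}"
      then show "\<Phi> P = 0" using supp[of "fst P" "snd P"] by (cases P) auto
    qed
  qed (use Nil in auto)
  then show ?case by simp
next
  case (Cons v vs)
  have "(\<Sum>P\<in>{a..b} \<times> {c..e}. shift_avg T (v # vs) \<Phi> P)
      = (\<Sum>t\<in>{1..int T}. \<Sum>P\<in>{a..b} \<times> {c..e}. shift_avg T vs \<Phi> (P + v t)) / real T"
    by (subst sum.swap) (simp add: sum_divide_distrib)
  also have "(\<Sum>t\<in>{1..int T}. \<Sum>P\<in>{a..b} \<times> {c..e}. shift_avg T vs \<Phi> (P + v t))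
      = (\<Sum>t\<in>{1..int T}. \<Sum>P\<in>{y1..y2} \<times> {d1..d2}. \<Phi> P)"
  proof (rule sum.cong[OF refl])
    fix t assume t: "t \<in> {1..int T}"
    have v: "\<bar>fst (v t)\<bar> \<le> B" "\<bar>snd (v t)\<bar> \<le> B" using Cons.prems(1)[of v t] t by auto
    show "(\<Sum>P\<in>{a..b} \<times> {c..e}. shift_avg T vs \<Phi> (P + v t)) = (\<Sum>P\<in>{y1..y2} \<times> {d1..d2}. \<Phi> P)"
      unfolding sum_translate_rect
    proof (rule Cons.IH)
      show "\<bar>fst (u s)\<bar> \<le> B \<and> \<bar>snd (u s)\<bar> \<le> B" if "u \<in> set vs" "s \<in> {1..int T}" for u s
        using Cons.prems(1)[of u s] that by auto
    qed (use Cons.prems v in \<open>auto simp: algebra_simps\<close>)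
  qed
  finally show ?case using T by simp
qed

text \<open>
  The box norms have steps \<open>b * t\<close>. Keeping absolute values of the differences \<open>\<Sum>y. \<Delta>\<^sub>h \<phi> y\<close> allows
  to drop the restriction to multiples of \<open>b\<close>; a further Cauchy--Schwarz step (\<open>gowers_abs_square_le\<close>) then
  bounds the sum by a Gowers norm of degree one higher.
\<close>

primrec gowers_abs :: "int \<Rightarrow> nat \<Rightarrow> (int \<Rightarrow> real) \<Rightarrow> real" where
  "gowers_abs K 0 \<phi> = \<bar>\<Sum>\<^sub>\<infinity>y. \<phi> y\<bar>"
| "gowers_abs K (Suc n) \<phi> = (\<Sum>h\<in>{- K..K}. gowers_abs K n (\<lambda>y. \<phi> y * \<phi> (y + h)))"

text \<open>The 2^(n+1)-th power of the Gowers norm of degree n + 1. The restriction to differences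
  up to K loses nothing once K is at least the length of the support.\<close>

primrec gowers_sq :: "int \<Rightarrow> nat \<Rightarrow> (int \<Rightarrow> real) \<Rightarrow> real" where
  "gowers_sq K 0 \<phi> = (\<Sum>\<^sub>\<infinity>y. \<phi> y)\<^sup>2"
| "gowers_sq K (Suc n) \<phi> = (\<Sum>h\<in>{- K..K}. gowers_sq K n (\<lambda>y. \<phi> y * \<phi> (y + h)))"

lemma gowers_abs_nonneg: "0 \<le> gowers_abs K n \<phi>"
  by (induction n arbitrary: \<phi>) (auto intro: sum_nonneg)

lemma gowers_sq_nonneg: "0 \<le> gowers_sq K n \<phi>"
  by (induction n arbitrary: \<phi>) (auto intro: sum_nonneg)

lemma gowers_abs_zero: "gowers_abs K n (\<lambda>y. 0) = 0"
  by (induction n) simp_all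

lemma infsum_int_translate: "(\<Sum>\<^sub>\<infinity>y. \<phi> (y + c :: int)) = (\<Sum>\<^sub>\<infinity>y. \<phi> y :: real)"
proof -
  have "bij_betw (\<lambda>y. y + c) UNIV (UNIV :: int set)"
    by (rule bij_betwI[of _ _ _ "\<lambda>y. y - c"]) auto
  then show ?thesis by (rule infsum_reindex_bij_betw)
qed

lemma gowers_abs_translate: "gowers_abs K n (\<lambda>y. \<phi> (y + c)) = gowers_abs K n \<phi>"
proof (induction n arbitrary: \<phi>)
  case 0
  then show ?case by (simp add: infsum_int_translate)
next
  case (Suc n)
  have "gowers_abs K n (\<lambda>y. \<phi> (y + c) * \<phi> (y + h + c)) = gowers_abs K n (\<lambda>y. \<phi> y * \<phi> (y + h))" for h
    using Suc[of "\<lambda>y. \<phi> y * \<phi> (y + h)"] by (simp add: add_ac)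
  then show ?case by simp
qed

lemma infsum_eq_window:
  fixes \<phi> :: "int \<Rightarrow> real"
  assumes "\<And>y. \<not> (a \<le> y \<and> y \<le> b) \<Longrightarrow> \<phi> y = 0"
  shows "(\<Sum>\<^sub>\<infinity>y. \<phi> y) = (\<Sum>y\<in>{a..b}. \<phi> y)"
proof -
  have "(\<Sum>\<^sub>\<infinity>y. \<phi> y) = (\<Sum>\<^sub>\<infinity>y\<in>{a..b}. \<phi> y)"
    using assms by (intro infsum_cong_neutral) auto
  then show ?thesis by simp
qed

text \<open>After a translation the pair t, t' enters only through b (t' - t). For fixed t this is
  injective in t' as b is nonzero, and differences beyond K kill the product; so the sum over t' is
  at most the sum over all h between -K and K. Of the factor 1 / T^2, one T is spent on the sum over
  t.\<close>

lemma sum_box_avg_le: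
  fixes M :: int
  assumes T: "T > 0" and M: "0 \<le> M"
  shows "(\<And>y. \<not> (y1 \<le> y \<and> y \<le> y2) \<Longrightarrow> \<phi> y = 0) \<Longrightarrow> y2 - y1 \<le> K \<Longrightarrow>
    (\<And>b. b \<in> set bs \<Longrightarrow> b \<noteq> 0 \<and> \<bar>b\<bar> \<le> M) \<Longrightarrow>
    lo \<le> y1 - int (length bs) * (M * int T) \<Longrightarrow> y2 + int (length bs) * (M * int T) \<le> hi \<Longrightarrow>
    (\<Sum>y\<in>{lo..hi}. box_avg T (map (\<lambda>b t. b * t) bs) \<phi> y) \<le> gowers_abs K (length bs) \<phi> / real T ^ length bs"
proof (induction bs arbitrary: \<phi> y1 y2)
  case Nil
  have "(\<Sum>\<^sub>\<infinity>y. \<phi> y) = (\<Sum>y\<in>{lo..hi}. \<phi> y)"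
    using Nil by (intro infsum_eq_window) force
  then show ?case by simp
next
  case (Cons b bs)
  let ?S = "{1..int T}"
  let ?n = "length bs"
  have b: "b \<noteq> 0" "\<bar>b\<bar> \<le> M" using Cons.prems(3)[of b] by auto
  have "(\<Sum>y\<in>{lo..hi}. box_avg T (map (\<lambda>b t. b * t) (b # bs)) \<phi> y)
      = (\<Sum>t\<in>?S. \<Sum>t'\<in>?S. \<Sum>y\<in>{lo..hi}. box_avg T (map (\<lambda>b t. b * t) bs) (\<lambda>Q. \<phi> (Q + b * t) * \<phi> (Q + b * t')) y) / real T ^ 2"
  proof -
    define H where "H t t' = (\<Sum>y\<in>{lo..hi}. box_avg T (map (\<lambda>b t. b * t) bs) (\<lambda>Q. \<phi> (Q + b * t) * \<phi> (Q + b * t')) y)" for t t'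
    have "(\<Sum>y\<in>{lo..hi}. box_avg T (map (\<lambda>b t. b * t) (b # bs)) \<phi> y)
      = (\<Sum>y\<in>{lo..hi}. \<Sum>p\<in>?S \<times> ?S. box_avg T (map (\<lambda>b t. b * t) bs) (\<lambda>Q. \<phi> (Q + b * fst p) * \<phi> (Q + b * snd p)) y) / real T ^ 2"
      by (simp add: sum_divide_distrib case_prod_beta)
    also have "(\<Sum>y\<in>{lo..hi}. \<Sum>p\<in>?S \<times> ?S. box_avg T (map (\<lambda>b t. b * t) bs) (\<lambda>Q. \<phi> (Q + b * fst p) * \<phi> (Q + b * snd p)) y)
      = (\<Sum>p\<in>?S \<times> ?S. \<Sum>y\<in>{lo..hi}. box_avg T (map (\<lambda>b t. b * t) bs) (\<lambda>Q. \<phi> (Q + b * fst p) * \<phi> (Q + b * snd p)) y)"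
      by (rule sum.swap)
    also have "\<dots> = (\<Sum>p\<in>?S \<times> ?S. H (fst p) (snd p))" by (simp only: H_def)
    also have "\<dots> = (\<Sum>t\<in>?S. \<Sum>t'\<in>?S. H t t')" by (simp only: sum.cartesian_product) (simp add: case_prod_beta)
    finally show ?thesis by (simp only: H_def)
  qed
  also have "\<dots> \<le> (\<Sum>t\<in>?S. \<Sum>t'\<in>?S. gowers_abs K ?n (\<lambda>y. \<phi> y * \<phi> (y + b * (t' - t))) / real T ^ ?n) / real T ^ 2"
  proof (intro divide_right_mono sum_mono)
    fix t t' assume t: "t \<in> ?S" "t' \<in> ?S"
    have bt: "\<bar>b * t\<bar> \<le> M * int T" unfolding abs_mult using b t by (intro mult_mono) auto
    have "(\<Sum>y\<in>{lo..hi}. box_avg T (map (\<lambda>b t. b * t) bs) (\<lambda>Q. \<phi> (Q + b * t) * \<phi> (Q + b * t')) y)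
        \<le> gowers_abs K ?n (\<lambda>Q. \<phi> (Q + b * t) * \<phi> (Q + b * t')) / real T ^ ?n"
    proof (rule Cons.IH[of "y1 - b * t" "y2 - b * t"])
      show "\<phi> (y + b * t) * \<phi> (y + b * t') = 0" if "\<not> (y1 - b * t \<le> y \<and> y \<le> y2 - b * t)" for y
        using Cons.prems(1)[of "y + b * t"] that by auto
    qed (use Cons.prems bt in \<open>auto simp: algebra_simps\<close>)
    also have "gowers_abs K ?n (\<lambda>Q. \<phi> (Q + b * t) * \<phi> (Q + b * t'))
        = gowers_abs K ?n (\<lambda>y. \<phi> y * \<phi> (y + b * (t' - t)))"
      using gowers_abs_translate[of K ?n "\<lambda>y. \<phi> y * \<phi> (y + b * (t' - t))" "b * t"]
      by (simp add: algebra_simps)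
    finally show "(\<Sum>y\<in>{lo..hi}. box_avg T (map (\<lambda>b t. b * t) bs) (\<lambda>Q. \<phi> (Q + b * t) * \<phi> (Q + b * t')) y)
      \<le> gowers_abs K ?n (\<lambda>y. \<phi> y * \<phi> (y + b * (t' - t))) / real T ^ ?n" .
  qed simp
  also have "\<dots> \<le> (\<Sum>t\<in>?S. gowers_abs K (Suc ?n) \<phi> / real T ^ ?n) / real T ^ 2"
  proof (intro divide_right_mono sum_mono)
    fix t assume t: "t \<in> ?S"
    let ?g = "\<lambda>h. gowers_abs K ?n (\<lambda>y. \<phi> y * \<phi> (y + h))"
    define S' where "S' = {t' \<in> ?S. \<bar>b * (t' - t)\<bar> \<le> K}"
    have "(\<Sum>t'\<in>?S. ?g (b * (t' - t))) = (\<Sum>t'\<in>S'. ?g (b * (t' - t)))"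
    proof (rule sum.mono_neutral_right)
      show "\<forall>t'\<in>?S - S'. ?g (b * (t' - t)) = 0"
      proof
        fix t' assume "t' \<in> ?S - S'"
        then have big: "\<bar>b * (t' - t)\<bar> > K" by (auto simp: S'_def)
        have "(\<lambda>y. \<phi> y * \<phi> (y + b * (t' - t))) = (\<lambda>y. 0)"
        proof
          fix y
          have "\<not> (y1 \<le> y \<and> y \<le> y2) \<or> \<not> (y1 \<le> y + b * (t' - t) \<and> y + b * (t' - t) \<le> y2)"
            using big Cons.prems(2) by linarith
          then show "\<phi> y * \<phi> (y + b * (t' - t)) = 0"
            using Cons.prems(1)[of y] Cons.prems(1)[of "y + b * (t' - t)"] by auto
        qed
        then show "?g (b * (t' - t)) = 0" by (simp add: gowers_abs_zero)
      qed
    qed (auto simp: S'_def)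
    also have "\<dots> = (\<Sum>h\<in>(\<lambda>t'. b * (t' - t)) ` S'. ?g h)"
      using b by (subst sum.reindex) (auto simp: inj_on_def)
    also have "\<dots> \<le> (\<Sum>h\<in>{- K..K}. ?g h)"
      by (intro sum_mono2) (auto simp: S'_def gowers_abs_nonneg)
    finally have "(\<Sum>t'\<in>?S. ?g (b * (t' - t))) \<le> gowers_abs K (Suc ?n) \<phi>" by simp
    then show "(\<Sum>t'\<in>?S. ?g (b * (t' - t)) / real T ^ ?n) \<le> gowers_abs K (Suc ?n) \<phi> / real T ^ ?n"
      unfolding sum_divide_distrib[symmetric] by (intro divide_right_mono) auto
  qed simp
  also have "\<dots> = gowers_abs K (length (b # bs)) \<phi> / real T ^ length (b # bs)"
    using T by (simp add: power2_eq_square)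
  finally show ?case .
qed

lemma gowers_abs_square_le:
  assumes "K \<ge> 0"
  shows "(gowers_abs K n \<phi>)\<^sup>2 \<le> (2 * real_of_int K + 1) ^ n * gowers_sq K n \<phi>"
proof (induction n arbitrary: \<phi>)
  case (Suc n)
  let ?D = "\<lambda>h y. \<phi> y * \<phi> (y + h)"
  have card: "real (card {- K..K}) = 2 * real_of_int K + 1" using assms by simp
  have "(gowers_abs K (Suc n) \<phi>)\<^sup>2 \<le> (\<Sum>h\<in>{- K..K}. (gowers_abs K n (?D h))\<^sup>2) * (\<Sum>h\<in>{- K..K}. 1\<^sup>2)"
    using Cauchy_Schwarz_ineq_sum[of "\<lambda>h. gowers_abs K n (?D h)" "\<lambda>_. 1" "{- K..K}"] by simp
  also have "\<dots> = (2 * real_of_int K + 1) * (\<Sum>h\<in>{- K..K}. (gowers_abs K n (?D h))\<^sup>2)"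
    using card by simp
  also have "\<dots> \<le> (2 * real_of_int K + 1) * (\<Sum>h\<in>{- K..K}. (2 * real_of_int K + 1) ^ n * gowers_sq K n (?D h))"
    using Suc assms by (intro mult_left_mono sum_mono) auto
  finally show ?case by (simp add: sum_distrib_left mult_ac)
qed simp

text \<open>The substitution y = j + d h1 makes f(y) the distinguished factor. The sign of the mean
  depends on d, the cutoff on y - d h1, and each remaining factor on y + d (h - h1). This gives q
  directions, in which y moves by t, h1 t and -(h - h1) t. The coefficients are nonzero as the h are
  positive and distinct, so the box average of f is controlled by its Gowers norm on the
  window.\<close>

theorem dense_von_neumann:
  fixes f :: "int \<Rightarrow> real"
  assumes f: "\<And>y. \<bar>f y\<bar> \<le> 1" "\<And>y. \<not> (1 \<le> y \<and> y \<le> int k) \<Longrightarrow> f y = 0"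
    and T: "T > 0" and J: "J > 0" "J \<le> k" "k \<le> 3 * J"
    and hs: "distinct hs" "hs \<noteq> []" "\<And>h. h \<in> set hs \<Longrightarrow> 1 \<le> h \<and> h \<le> M"
    and q: "q = Suc (length hs)" and D: "q * T \<le> D" "M * D \<le> J"
  shows "((\<Sum>d\<in>{- int D..2 * int D}. \<bar>dilate_mean f hs J d\<bar>) / (54 * real k)) ^ (2 ^ q)
      \<le> 3 ^ q * (real k / real T) ^ q * sqrt (gowers_sq (int k) q f / real k ^ (q + 2))"
proof -
  obtain h1 hs' where hs_eq: "hs = h1 # hs'" using hs(2) by (cases hs) auto
  have h1: "1 \<le> h1" "h1 \<le> M" using hs(3) by (auto simp: hs_eq)
  have hs': "h \<noteq> h1" "1 \<le> h" "h \<le> M" if "h \<in> set hs'" for h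
    using that hs(1) hs(3)[of h] by (auto simp: hs_eq)
  define Km where "Km d = dilate_mean f hs J d" for d
  define \<epsilon> where "\<epsilon> d = sgn (Km d) * of_bool (- int D \<le> d \<and> d \<le> 2 * int D)" for d
  define c where "c j = (of_bool (1 \<le> j \<and> j \<le> int J) :: real)" for j
  define gs where "gs = (\<lambda>t. (t, 0), \<lambda>P. \<epsilon> (snd P)) # (\<lambda>t. (int h1 * t, t), \<lambda>P. c (fst P - snd P * int h1)) #
    map (\<lambda>h. (\<lambda>t. (- (int h - int h1) * t, t), \<lambda>P. f (fst P + snd P * (int h - int h1)))) hs'"
  define bs where "bs = 1 # int h1 # map (\<lambda>h. - (int h - int h1)) hs'"
  define \<Phi> where "\<Phi> P = f (fst P) * (\<Prod>(v, g)\<leftarrow>gs. g P)" for P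
  have len: "length gs = q" "length bs = q" by (simp_all add: gs_def bs_def q hs_eq)
  have fsts: "map (\<lambda>v t. fst (v t)) (map fst gs) = map (\<lambda>b t. b * t) bs"
    by (simp add: gs_def bs_def o_def fun_eq_iff)
  have bs: "b \<noteq> 0 \<and> \<bar>b\<bar> \<le> int M" if "b \<in> set bs" for b
  proof -
    consider "b = 1" | "b = int h1" | h where "h \<in> set hs'" "b = - (int h - int h1)"
      using \<open>b \<in> set bs\<close> by (auto simp: bs_def)
    then show ?thesis
    proof cases
      case 3
      then show ?thesis using hs'[OF 3(1)] h1 by linarith
    qed (use h1 in auto)
  qed
  have inv: "invariant_along g v" if "(v, g) \<in> set gs" for v g
    using that f(1) unfolding gs_def invariant_along_def
    by (auto simp: c_def \<epsilon>_def algebra_simps sgn_if)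
  have \<Phi>_eq: "\<Phi> (y, d) = f y * (\<epsilon> d * (c (y - d * int h1) * (\<Prod>h\<leftarrow>hs'. f (y + d * (int h - int h1)))))" for y d
    by (simp add: \<Phi>_def gs_def o_def)
  define S where "S = (\<Sum>P\<in>{1..int k} \<times> {- int D..2 * int D}. \<Phi> P)"
  have S_eq: "S = real J * (\<Sum>d\<in>{- int D..2 * int D}. \<bar>Km d\<bar>)"
  proof -
    have "S = (\<Sum>d\<in>{- int D..2 * int D}. \<Sum>y\<in>{1..int k}. \<Phi> (y, d))"
      unfolding S_def by (subst sum.swap) (simp add: sum.cartesian_product)
    also have "\<dots> = (\<Sum>d\<in>{- int D..2 * int D}. real J * \<bar>Km d\<bar>)"
    proof (rule sum.cong[OF refl])
      fix d assume d: "d \<in> {- int D..2 * int D}"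
      have "(\<Sum>y\<in>{1..int k}. \<Phi> (y, d)) = (\<Sum>y\<in>{1 + d * int h1..int J + d * int h1}. \<Phi> (y, d))"
      proof (rule sum.mono_neutral_cong)
        show "\<Phi> (y, d) = 0" if "y \<in> {1 + d * int h1..int J + d * int h1} - {1..int k}" for y
          using that f(2)[of y] by (auto simp: \<Phi>_eq)
        show "\<Phi> (y, d) = 0" if "y \<in> {1..int k} - {1 + d * int h1..int J + d * int h1}" for y
          using that by (auto simp: \<Phi>_eq c_def)
      qed auto
      also have "\<dots> = (\<Sum>j\<in>{1..int J}. \<Phi> (j + d * int h1, d))"
        by (rule sum.reindex_bij_witness[of _ "\<lambda>j. j + d * int h1" "\<lambda>y. y - d * int h1"]) auto
      also have "\<dots> = (\<Sum>j\<in>{1..int J}. sgn (Km d) * (\<Prod>h\<leftarrow>hs. f (j + d * int h)))"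
        using d by (intro sum.cong) (auto simp: \<Phi>_eq c_def \<epsilon>_def hs_eq algebra_simps)
      also have "\<dots> = real J * (sgn (Km d) * Km d)"
      proof -
        have "(\<Sum>j\<in>{1..int J}. \<Prod>h\<leftarrow>hs. f (j + d * int h)) = real J * Km d"
          using J by (simp add: Km_def dilate_mean_def)
        then show ?thesis unfolding sum_distrib_left[symmetric] by simp
      qed
      finally show "(\<Sum>y\<in>{1..int k}. \<Phi> (y, d)) = real J * \<bar>Km d\<bar>" by (simp add: sgn_mult_self_eq abs_sgn mult.commute)
    qed
    finally show ?thesis by (simp add: sum_distrib_left)
  qed
  \<comment> \<open>The support of \<Phi> enlarged by J on all sides: the q steps have total length
    at most q M T \<le> J.\<close>
  define Y where "Y = {1 - int J..int k + int J}"
  define DD where "DD = {- int D - int J..2 * int D + int J}"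
  define W where "W = Y \<times> DD"
  have W: "finite W" "W \<noteq> {}" using J by (auto simp: W_def Y_def DD_def)
  have qB: "int q * (int M * int T) \<le> int J"
  proof -
    have "q * (M * T) = M * (q * T)" by simp
    also have "\<dots> \<le> J" using D by (meson le_trans mult_le_mono2)
    finally show ?thesis by (simp flip: of_nat_mult)
  qed
  have S_W: "(\<Sum>P\<in>W. shift_avg T (map fst gs) \<Phi> P) = S"
    unfolding S_def W_def Y_def DD_def
  proof (rule sum_rect_shift_avg[OF T, of "int M * int T"])
    show "\<Phi> (y, d) = 0" if "\<not> (1 \<le> y \<and> y \<le> int k \<and> - int D \<le> d \<and> d \<le> 2 * int D)" for y d
      using that f(2)[of y] by (auto simp: \<Phi>_eq \<epsilon>_def)
    fix v t assume v: "v \<in> set (map fst gs)" and t: "t \<in> {1..int T}"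
    have M1: "1 \<le> int M" using h1 by simp
    have tB: "\<bar>b * t\<bar> \<le> int M * int T" if "\<bar>b\<bar> \<le> int M" for b
      unfolding abs_mult using that t by (intro mult_mono) auto
    consider "v = (\<lambda>t. (t, 0))" | "v = (\<lambda>t. (int h1 * t, t))" | h where "h \<in> set hs'" "v = (\<lambda>t. (- (int h - int h1) * t, t))"
      using v by (auto simp: gs_def)
    then show "\<bar>fst (v t)\<bar> \<le> int M * int T \<and> \<bar>snd (v t)\<bar> \<le> int M * int T"
    proof cases
      case 1
      then show ?thesis using tB[of 1] M1 by simp
    next
      case 2
      then show ?thesis using tB[of 1] tB[of "int h1"] M1 h1 by simp
    next
      case 3
      have "\<bar>- (int h - int h1)\<bar> \<le> int M" using hs'[OF 3(1)] h1 by linarith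
      then show ?thesis using tB[of 1] tB[of "- (int h - int h1)"] M1 unfolding 3(2) by simp
    qed
  qed (use qB len in auto)
  have box: "\<bar>shift_avg T (map fst gs) \<Phi> P\<bar> ^ (2 ^ q) \<le> box_avg T (map (\<lambda>b t. b * t) bs) f (fst P)" for P
  proof -
    have "\<bar>shift_avg T (map fst gs) (\<lambda>P. f (fst P) * (\<Prod>(v, g)\<leftarrow>gs. g P)) P\<bar> ^ (2 ^ length gs)
        \<le> box_avg T (map fst gs) (\<lambda>P. f (fst P)) P"
      using inv by (intro box_cauchy_schwarz_abs[OF T]) (auto simp: gs_def)
    also have "\<dots> = box_avg T (map (\<lambda>b t. b * t) bs) f (fst P)"
      unfolding box_avg_fst fsts ..
    finally show ?thesis unfolding len \<Phi>_def[abs_def] .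
  qed
  have cardW: "real (card W) = real (card Y) * real (card DD)" by (simp add: W_def card_cartesian_product)
  have cardY: "real (card Y) = real k + 2 * real J" by (simp add: Y_def)
  have cardD: "real (card DD) = 3 * real D + 2 * real J + 1" by (simp add: DD_def)
  have "(\<bar>S\<bar> / real (card W)) ^ (2 ^ q) \<le> ((\<Sum>P\<in>W. \<bar>shift_avg T (map fst gs) \<Phi> P\<bar>) / real (card W)) ^ (2 ^ q)"
    unfolding S_W[symmetric] by (intro power_mono divide_right_mono sum_abs) auto
  also have "\<dots> \<le> (\<Sum>P\<in>W. \<bar>shift_avg T (map fst gs) \<Phi> P\<bar> ^ (2 ^ q)) / real (card W)"
    using W by (rule mean_power_le)
  also have "\<dots> \<le> (\<Sum>P\<in>W. box_avg T (map (\<lambda>b t. b * t) bs) f (fst P)) / real (card W)"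
    using box by (intro divide_right_mono sum_mono) auto
  also have "(\<Sum>P\<in>W. box_avg T (map (\<lambda>b t. b * t) bs) f (fst P)) = real (card DD) * (\<Sum>y\<in>Y. box_avg T (map (\<lambda>b t. b * t) bs) f y)"
    unfolding W_def by (simp add: sum.cartesian_product' sum_distrib_left)
  also have "\<dots> / real (card W) = (\<Sum>y\<in>Y. box_avg T (map (\<lambda>b t. b * t) bs) f y) / real (card Y)"
    unfolding cardW using cardD by simp
  also have "\<dots> \<le> (gowers_abs (int k) q f / real T ^ q) / real (card Y)"
    unfolding Y_def len(2)[symmetric]
    by (intro divide_right_mono sum_box_avg_le[OF T, of "int M" 1 "int k"]) (use f(2) bs qB len in auto)
  also have "\<dots> \<le> (gowers_abs (int k) q f / real T ^ q) / real k"
    using J cardY gowers_abs_nonneg by (intro divide_left_mono mult_pos_pos divide_nonneg_nonneg) auto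
  also have "gowers_abs (int k) q f \<le> 3 ^ q * real k ^ (q + 1) * sqrt (gowers_sq (int k) q f / real k ^ (q + 2))"
  proof -
    define g where "g = gowers_sq (int k) q f / real k ^ (q + 2)"
    have k: "real k > 0" using J by simp
    have g: "gowers_sq (int k) q f = g * real k ^ (q + 2)" "0 \<le> g" using k gowers_sq_nonneg by (auto simp: g_def)
    have "(gowers_abs (int k) q f)\<^sup>2 \<le> (2 * real_of_int (int k) + 1) ^ q * gowers_sq (int k) q f"
      by (rule gowers_abs_square_le) simp
    also have "\<dots> \<le> (3 * real k) ^ q * gowers_sq (int k) q f"
      using J gowers_sq_nonneg by (intro mult_right_mono power_mono) auto
    also have "\<dots> = 3 ^ q * (real k ^ (q + 1))\<^sup>2 * g"
      unfolding g(1) by (simp add: power_mult_distrib power_add power2_eq_square)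
    also have "\<dots> \<le> (3 ^ q)\<^sup>2 * (real k ^ (q + 1))\<^sup>2 * g"
      using g(2) by (intro mult_right_mono) (auto simp: power2_eq_square)
    also have "\<dots> = (3 ^ q * real k ^ (q + 1) * sqrt g)\<^sup>2"
      by (simp only: power_mult_distrib real_sqrt_pow2[OF g(2)])
    finally have "(gowers_abs (int k) q f)\<^sup>2 \<le> (3 ^ q * real k ^ (q + 1) * sqrt g)\<^sup>2" .
    moreover have "0 \<le> 3 ^ q * real k ^ (q + 1) * sqrt g" using g(2) by (intro mult_nonneg_nonneg) simp_all
    ultimately show ?thesis unfolding g_def[symmetric] by (rule power2_le_imp_le)
  qed
  also have "3 ^ q * real k ^ (q + 1) * sqrt (gowers_sq (int k) q f / real k ^ (q + 2)) / real T ^ q / real k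
      = 3 ^ q * (real k / real T) ^ q * sqrt (gowers_sq (int k) q f / real k ^ (q + 2))"
    using J by (simp add: power_divide)
  finally have main: "(\<bar>S\<bar> / real (card W)) ^ (2 ^ q) \<le> 3 ^ q * (real k / real T) ^ q * sqrt (gowers_sq (int k) q f / real k ^ (q + 2))"
    using T J by (simp add: divide_right_mono)
  have DJ: "D \<le> J"
  proof -
    have "D \<le> M * D" using h1 by simp
    then show ?thesis using D(2) by linarith
  qed
  have card_le: "real (card W) \<le> 18 * real k ^ 2"
  proof -
    have "real (card W) \<le> (3 * real k) * (6 * real k)"
      unfolding cardW cardY cardD using J DJ by (intro mult_mono) auto
    then show ?thesis by (simp add: power2_eq_square)
  qed
  have W0: "real (card W) > 0" using W by (simp add: card_gt_0_iff)
  \<comment> \<open>54 = 3 * 18, from J \<ge> k / 3 and card W \<le> 18 k^2.\<close>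
  have "(\<Sum>d\<in>{- int D..2 * int D}. \<bar>Km d\<bar>) / (54 * real k) \<le> \<bar>S\<bar> / real (card W)"
  proof -
    define s where "s = (\<Sum>d\<in>{- int D..2 * int D}. \<bar>Km d\<bar>)"
    have s: "0 \<le> s" unfolding s_def by (rule sum_nonneg) simp
    have "s / (54 * real k) = (real k / 3) * s / (18 * real k ^ 2)" using J by (simp add: power2_eq_square)
    also have "\<dots> \<le> real J * s / (18 * real k ^ 2)"
      using J s by (intro divide_right_mono mult_right_mono) auto
    also have "\<dots> \<le> real J * s / real (card W)"
      using card_le W0 s J by (intro divide_left_mono mult_pos_pos) auto
    also have "real J * s = \<bar>S\<bar>" using s by (simp add: S_eq s_def[symmetric])
    finally show ?thesis unfolding s_def .
  qed
  then have "((\<Sum>d\<in>{- int D..2 * int D}. \<bar>Km d\<bar>) / (54 * real k)) ^ (2 ^ q) \<le> (\<bar>S\<bar> / real (card W)) ^ (2 ^ q)"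
    by (intro power_mono divide_nonneg_nonneg sum_nonneg) auto
  then show ?thesis using main unfolding Km_def by linarith
qed

section \<open>Agreement of \<open>gowers_sq\<close> with the defining sum of the Gowers
  norm\<close>

lemma sum_PiE_insert:
  fixes F :: "('a \<Rightarrow> 'b) \<Rightarrow> 'c::comm_monoid_add"
  assumes "x \<notin> I"
  shows "(\<Sum>h\<in>PiE (insert x I) (\<lambda>_. A). F h) = (\<Sum>t\<in>A. \<Sum>g\<in>PiE I (\<lambda>_. A). F (g(x := t)))"
proof -
  have "(\<Sum>h\<in>PiE (insert x I) (\<lambda>_. A). F h) = (\<Sum>p\<in>A \<times> PiE I (\<lambda>_. A). F ((\<lambda>(t, g). g(x := t)) p))"
    unfolding PiE_insert_eq using inj_combinator[OF assms, of "\<lambda>_. A"]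
    by (subst sum.reindex) (auto simp: o_def)
  then show ?thesis by (simp add: sum.cartesian_product case_prod_beta)
qed

lemma prod_PiE_insert:
  fixes F :: "('a \<Rightarrow> 'b) \<Rightarrow> 'c::comm_monoid_mult"
  assumes "x \<notin> I"
  shows "(\<Prod>h\<in>PiE (insert x I) (\<lambda>_. A). F h) = (\<Prod>t\<in>A. \<Prod>g\<in>PiE I (\<lambda>_. A). F (g(x := t)))"
proof -
  have "(\<Prod>h\<in>PiE (insert x I) (\<lambda>_. A). F h) = (\<Prod>p\<in>A \<times> PiE I (\<lambda>_. A). F ((\<lambda>(t, g). g(x := t)) p))"
    unfolding PiE_insert_eq using inj_combinator[OF assms, of "\<lambda>_. A"]
    by (subst prod.reindex) (auto simp: o_def)
  then show ?thesis by (simp add: prod.cartesian_product case_prod_beta)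
qed

definition cube_prod :: "nat \<Rightarrow> (int \<Rightarrow> real) \<Rightarrow> int \<Rightarrow> (nat \<Rightarrow> int) \<Rightarrow> real" where
  "cube_prod d f y h = (\<Prod>\<omega>\<in>PiE {1..d} (\<lambda>_. {0, 1::nat}). f (y + (\<Sum>i=1..d. int (\<omega> i) * h i)))"

lemma cube_prod_Suc:
  "cube_prod (Suc d) f y (h(Suc d := t)) = cube_prod d (\<lambda>y. f y * f (y + t)) y h"
proof -
  have ins: "{1..Suc d} = insert (Suc d) {1..d}" "Suc d \<notin> {1..d}" by auto
  have s: "(\<Sum>i=1..Suc d. int (fun_upd \<omega> (Suc d) e i) * fun_upd h (Suc d) t i) = (\<Sum>i=1..d. int (\<omega> i) * h i) + int e * t" for \<omega> e
  proof -
    have "(\<Sum>i=1..d. int (fun_upd \<omega> (Suc d) e i) * fun_upd h (Suc d) t i) = (\<Sum>i=1..d. int (\<omega> i) * h i)"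
      by (intro sum.cong) auto
    then show ?thesis by simp
  qed
  show ?thesis
    unfolding cube_prod_def unfolding ins(1) prod_PiE_insert[OF ins(2)] unfolding ins(1)[symmetric] s
    by (simp add: prod.distrib add.assoc)
qed

definition cube_sum :: "int \<Rightarrow> int \<Rightarrow> nat \<Rightarrow> (int \<Rightarrow> real) \<Rightarrow> real" where
  "cube_sum N K d f = (\<Sum>y\<in>{1..N}. \<Sum>h\<in>PiE {1..d} (\<lambda>_. {- K..K}). cube_prod d f y h)"

lemma cube_sum_Suc: "cube_sum N K (Suc d) f = (\<Sum>t\<in>{- K..K}. cube_sum N K d (\<lambda>y. f y * f (y + t)))"
proof -
  have ins: "{1..Suc d} = insert (Suc d) {1..d}" "Suc d \<notin> {1..d}" by auto
  have "cube_sum N K (Suc d) f = (\<Sum>y\<in>{1..N}. \<Sum>t\<in>{- K..K}. \<Sum>h\<in>PiE {1..d} (\<lambda>_. {- K..K}). cube_prod d (\<lambda>y. f y * f (y + t)) y h)"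
    unfolding cube_sum_def ins(1) sum_PiE_insert[OF ins(2)] cube_prod_Suc ..
  also have "\<dots> = (\<Sum>t\<in>{- K..K}. cube_sum N K d (\<lambda>y. f y * f (y + t)))"
    unfolding cube_sum_def by (rule sum.swap)
  finally show ?thesis .
qed

text \<open>In degree 1 the sum of f(y) f(y + t) over all y and t is the square of the sum of f;
  hence degree n + 1 corresponds to n differences and one square.\<close>

lemma cube_sum_eq_gowers_sq:
  assumes "N \<le> K"
  shows "(\<And>y. \<not> (1 \<le> y \<and> y \<le> N) \<Longrightarrow> f y = 0) \<Longrightarrow> cube_sum N K (Suc n) f = gowers_sq K n f"
proof (induction n arbitrary: f)
  case 0
  have base: "cube_sum N K 0 g = (\<Sum>y\<in>{1..N}. g y)" for g
    by (simp add: cube_sum_def cube_prod_def)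
  have "cube_sum N K (Suc 0) f = (\<Sum>y\<in>{1..N}. \<Sum>t\<in>{- K..K}. f y * f (y + t))"
    unfolding cube_sum_Suc base by (rule sum.swap)
  also have "\<dots> = (\<Sum>y\<in>{1..N}. f y * (\<Sum>x\<in>{1..N}. f x))"
  proof (rule sum.cong[OF refl])
    fix y assume y: "y \<in> {1..N}"
    have "(\<Sum>t\<in>{- K..K}. f (y + t)) = (\<Sum>x\<in>{y - K..y + K}. f x)"
      by (rule sum.reindex_bij_witness[of _ "\<lambda>x. x - y" "\<lambda>t. y + t"]) auto
    also have "\<dots> = (\<Sum>x\<in>{1..N}. f x)"
      using y assms 0 by (intro sum.mono_neutral_right) auto
    finally show "(\<Sum>t\<in>{- K..K}. f y * f (y + t)) = f y * (\<Sum>x\<in>{1..N}. f x)"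
      by (simp add: sum_distrib_left[symmetric])
  qed
  also have "\<dots> = (\<Sum>x\<in>{1..N}. f x)\<^sup>2" by (simp add: sum_distrib_right[symmetric] power2_eq_square)
  also have "(\<Sum>x\<in>{1..N}. f x) = (\<Sum>\<^sub>\<infinity>y. f y)" using 0 by (intro infsum_eq_window[symmetric]) auto
  finally show ?case by simp
next
  case (Suc n)
  have "cube_sum N K (Suc n) (\<lambda>y. f y * f (y + t)) = gowers_sq K n (\<lambda>y. f y * f (y + t))" for t
    using Suc.prems by (intro Suc.IH) auto
  then show ?case by (subst cube_sum_Suc) simp
qed

lemma cnj_funpow_of_real: "(cnj ^^ n) (complex_of_real x) = complex_of_real x"
  by (induction n) simp_all

text \<open>The vertex 0 of the cube forces y into the support, and the j-th unit vertex forces y +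
  h j into it, which bounds h j.\<close>

lemma cube_prod_eq_0:
  assumes "\<And>y. \<not> (1 \<le> y \<and> y \<le> N) \<Longrightarrow> f y = 0" and "N \<le> K" and "h \<in> PiE {1..d} (\<lambda>_. UNIV)"
    and "\<not> (y \<in> {1..N} \<and> h \<in> PiE {1..d} (\<lambda>_. {- K..K}))"
  shows "cube_prod d f y h = 0"
proof -
  have fin: "finite (PiE {1..d} (\<lambda>_. {0, 1::nat}))" by (intro finite_PiE) auto
  have "\<exists>\<omega>\<in>PiE {1..d} (\<lambda>_. {0, 1::nat}). f (y + (\<Sum>i=1..d. int (\<omega> i) * h i)) = 0"
  proof (cases "y \<in> {1..N}")
    case False
    have "(\<lambda>i\<in>{1..d}. 0) \<in> PiE {1..d} (\<lambda>_. {0, 1::nat})" by auto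
    moreover have "f (y + (\<Sum>i=1..d. int ((\<lambda>i\<in>{1..d}. 0) i) * h i)) = 0"
      using False assms(1)[of y] by simp
    ultimately show ?thesis by blast
  next
    case True
    then have "h \<notin> PiE {1..d} (\<lambda>_. {- K..K})" using assms(4) by blast
    then obtain j where j: "j \<in> {1..d}" "h j \<notin> {- K..K}" using assms(3) by (auto simp: PiE_iff)
    define \<omega> where "\<omega> = (\<lambda>i\<in>{1..d}. if i = j then 1 else 0 :: nat)"
    have "(\<Sum>i=1..d. int (\<omega> i) * h i) = (\<Sum>i=1..d. if i = j then h i else 0)"
      by (intro sum.cong) (auto simp: \<omega>_def)
    also have "\<dots> = h j" using j(1) by simp
    finally have "f (y + (\<Sum>i=1..d. int (\<omega> i) * h i)) = f (y + h j)" by simp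
    also have "\<dots> = 0" using True j(2) assms(1)[of "y + h j"] assms(2) by auto
    finally have "f (y + (\<Sum>i=1..d. int (\<omega> i) * h i)) = 0" .
    moreover have "\<omega> \<in> PiE {1..d} (\<lambda>_. {0, 1})" by (auto simp: \<omega>_def)
    ultimately show ?thesis by blast
  qed
  then show ?thesis unfolding cube_prod_def using fin by (rule prod_zero[rotated])
qed

lemma gowers_sum_eq:
  assumes "\<And>y. \<not> (1 \<le> y \<and> y \<le> N) \<Longrightarrow> f y = 0" and "N \<le> K"
  shows "gowers_sum d (\<lambda>y. complex_of_real (f y)) = of_real (cube_sum N K d f)"
proof -
  let ?H = "PiE {1..d} (\<lambda>_. {- K..K})"
  have fin: "finite ?H" by (intro finite_PiE) auto
  have "gowers_sum d (\<lambda>y. complex_of_real (f y))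
      = (\<Sum>\<^sub>\<infinity>p\<in>UNIV \<times> PiE {1..d} (\<lambda>_. UNIV). complex_of_real (cube_prod d f (fst p) (snd p)))"
    unfolding gowers_sum_def cube_prod_def by (simp add: cnj_funpow_of_real case_prod_unfold)
  also have "\<dots> = (\<Sum>\<^sub>\<infinity>p\<in>{1..N} \<times> ?H. complex_of_real (cube_prod d f (fst p) (snd p)))"
  proof (rule infsum_cong_neutral)
    fix p :: "int \<times> (nat \<Rightarrow> int)" assume p: "p \<in> UNIV \<times> PiE {1..d} (\<lambda>_. UNIV) - {1..N} \<times> ?H"
    have "cube_prod d f (fst p) (snd p) = 0"
      by (rule cube_prod_eq_0[OF assms]) (use p in \<open>auto simp: mem_Times_iff\<close>)
    then show "complex_of_real (cube_prod d f (fst p) (snd p)) = 0" by simp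
  qed (auto simp: PiE_iff)
  also have "\<dots> = (\<Sum>p\<in>{1..N} \<times> ?H. complex_of_real (cube_prod d f (fst p) (snd p)))"
    using fin by (intro infsum_finite) auto
  also have "\<dots> = of_real (cube_sum N K d f)"
    unfolding cube_sum_def of_real_sum sum.cartesian_product by (simp add: case_prod_beta)
  finally show ?thesis .
qed

lemma gowers_sum_eq_gowers_sq:
  assumes "\<And>y. \<not> (1 \<le> y \<and> y \<le> int k) \<Longrightarrow> f y = 0"
  shows "gowers_sum (Suc n) (\<lambda>y. complex_of_real (f y)) = of_real (gowers_sq (int k) n f)"
  using gowers_sum_eq[of "int k" f "int k" "Suc n"] assms cube_sum_eq_gowers_sq[of "int k" "int k" f n] assms by simp

lemma gowers_sq_le:
  assumes "\<And>y. \<bar>f y\<bar> \<le> 1" "\<And>y. \<not> (1 \<le> y \<and> y \<le> int k) \<Longrightarrow> f y = 0" and k: "k > 0"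
  shows "gowers_sq (int k) n f \<le> 3 ^ n * real k ^ (n + 2)"
  using assms(1,2)
proof (induction n arbitrary: f)
  case 0
  have "\<bar>\<Sum>y\<in>{1..int k}. f y\<bar> \<le> (\<Sum>y\<in>{1..int k}. 1)"
    using 0 by (intro order.trans[OF sum_abs] sum_mono) auto
  then have "\<bar>\<Sum>y\<in>{1..int k}. f y\<bar>\<^sup>2 \<le> (real k)\<^sup>2" by (intro power_mono) auto
  moreover have "(\<Sum>\<^sub>\<infinity>y. f y) = (\<Sum>y\<in>{1..int k}. f y)" using 0 by (intro infsum_eq_window) auto
  ultimately show ?case by (simp add: power2_eq_square)
next
  case (Suc n)
  have "gowers_sq (int k) (Suc n) f \<le> (\<Sum>h\<in>{- int k..int k}. 3 ^ n * real k ^ (n + 2))"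
    unfolding gowers_sq.simps using Suc.prems by (intro sum_mono Suc.IH) (auto simp: abs_mult intro!: mult_le_one)
  also have "\<dots> = (2 * real k + 1) * (3 ^ n * real k ^ (n + 2))" by simp
  also have "\<dots> \<le> (3 * real k) * (3 ^ n * real k ^ (n + 2))" using k by (intro mult_right_mono) auto
  finally show ?case by (simp add: mult_ac)
qed

section \<open>Dilated means over the primes\<close>

text \<open>
  The condition \<open>D < p * p\<close> keeps these primes above the sieving limit, a small power of \<open>D\<close>.
\<close>

definition big_primes :: "nat \<Rightarrow> nat set" where
  "big_primes D = {p. prime p \<and> p \<le> D \<and> D < p * p}"

lemma finite_big_primes [simp, intro]: "finite (big_primes D)"
  by (rule finite_subset[of _ "{..D}"]) (auto simp: big_primes_def)

text \<open>The condition on p * p removes at most sqrt D primes, which is absorbed by giving up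
  half of the Chebyshev bound.\<close>

lemma card_big_primes_lower:
  "\<forall>\<^sub>F D in sequentially. real D / (12 * ln (real D)) \<le> real (card (big_primes D))"
proof -
  have "\<forall>\<^sub>F x in at_top. sqrt x \<le> x / (12 * ln x)" by real_asymp
  then have "\<forall>\<^sub>F D in sequentially. sqrt (real D) \<le> real D / (12 * ln (real D))"
    by (rule eventually_compose_filterlim) (rule filterlim_real_sequentially)
  then show ?thesis using eventually_ge_at_top[of 2]
  proof eventually_elim
    case (elim D)
    define S where "S = {p::nat. 1 \<le> p \<and> p * p \<le> D}"
    have S: "S \<subseteq> {1..nat \<lfloor>sqrt (real D)\<rfloor>}"
    proof
      fix p assume "p \<in> S"
      then have p: "1 \<le> p" "real p * real p \<le> real D" unfolding S_def by (auto simp flip: of_nat_mult)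
      then have "real p \<le> sqrt (real D)" by (simp add: real_le_rsqrt power2_eq_square)
      then show "p \<in> {1..nat \<lfloor>sqrt (real D)\<rfloor>}" using p by (simp add: le_nat_floor)
    qed
    then have "card S \<le> nat \<lfloor>sqrt (real D)\<rfloor>" using card_mono[OF _ S] by simp
    then have "real (card S) \<le> sqrt (real D)" by (metis le_nat_iff of_int_floor_le of_nat_floor order_trans real_sqrt_ge_zero of_nat_0_le_iff of_nat_mono)
    moreover have "primes_between 0 D \<subseteq> big_primes D \<union> S"
      by (auto simp: primes_between_def big_primes_def S_def)
    then have "card (primes_between 0 D) \<le> card (big_primes D \<union> S)"
      using finite_subset[OF S] by (intro card_mono) auto
    then have "card (primes_between 0 D) \<le> card (big_primes D) + card S"
      using card_Un_le[of "big_primes D" S] by linarith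
    then have "real (card (primes_between 0 D)) \<le> real (card (big_primes D)) + real (card S)" by linarith
    moreover have "real D / (6 * ln (real D)) \<le> real (card (primes_between 0 D))"
      using elim by (intro card_primes_lower)
    moreover have "real D / (6 * ln (real D)) = real D / (12 * ln (real D)) + real D / (12 * ln (real D))"
      using elim by (simp add: field_simps)
    ultimately show ?case using elim by linarith
  qed
qed

section \<open>Decay of the sieve error and choice of the sieving limit\<close>

lemma exp_tail_tendsto_0:
  assumes "x \<ge> 0"
  shows "(\<lambda>b. exp_tail x b) \<longlonglongrightarrow> 0"
proof -
  define g where "g j = x ^ j / fact j" for j
  have sm: "summable g" unfolding g_def using summable_exp[of x] by (simp add: divide_inverse mult.commute)
  have "exp_tail x b = suminf g - sum g {..<b}" for b
    unfolding exp_tail_def using suminf_minus_initial_segment[OF sm, of b] by (simp add: g_def[abs_def])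
  moreover have "(\<lambda>b. suminf g - sum g {..<b}) \<longlonglongrightarrow> suminf g - suminf g"
    using sm by (intro tendsto_intros summable_LIMSEQ)
  ultimately show ?thesis by simp
qed

lemma exp_tail_nonneg: "x \<ge> 0 \<Longrightarrow> 0 \<le> exp_tail x b"
  unfolding exp_tail_def
  by (intro suminf_nonneg summable_exp_tail) auto

text \<open>Every exponent in the tail is at least b, so exp (A b) can be absorbed into the base.
  This turns mere convergence of the exponential series into decay faster than any exponential in
  b.\<close>

lemma exp_exp_tail_le:
  assumes "x \<ge> 0" "A \<ge> 0"
  shows "exp (A * real b) * exp_tail x b \<le> exp_tail (exp A * x) b"
proof -
  have "exp (A * real b) * exp_tail x b = (\<Sum>j. exp (A * real b) * (x ^ (j + b) / fact (j + b)))"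
    unfolding exp_tail_def by (rule suminf_mult[symmetric, OF summable_exp_tail])
  also have "\<dots> \<le> exp_tail (exp A * x) b"
    unfolding exp_tail_def
  proof (intro suminf_le summable_mult summable_exp_tail)
    fix j
    have "exp (A * real b) \<le> exp A ^ (j + b)"
      using assms by (simp add: exp_of_nat_mult[symmetric] mult.commute mult_left_mono)
    then have "exp (A * real b) * (x ^ (j + b) / fact (j + b)) \<le> exp A ^ (j + b) * (x ^ (j + b) / fact (j + b))"
      using assms by (intro mult_right_mono) auto
    then show "exp (A * real b) * (x ^ (j + b) / fact (j + b)) \<le> (exp A * x) ^ (j + b) / fact (j + b)"
      by (simp add: power_mult_distrib)
  qed
  finally show ?thesis .
qed

lemma exp_over_dexp_tendsto_0: "(\<lambda>b. exp (A * real b) / real (dexp b)) \<longlonglongrightarrow> 0"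
proof -
  \<comment> \<open>In terms of x = 2^b the claim compares a power of x with 2^x.\<close>
  have "((\<lambda>x::real. x powr (A / ln 2) / 2 powr x) \<longlongrightarrow> 0) at_top" by real_asymp
  moreover have "filterlim (\<lambda>b. 2 ^ b :: real) at_top sequentially" by real_asymp
  ultimately have "(\<lambda>b. (2 ^ b :: real) powr (A / ln 2) / 2 powr (2 ^ b)) \<longlonglongrightarrow> 0"
    by (rule filterlim_compose)
  moreover have "(2 ^ b :: real) powr (A / ln 2) / 2 powr (2 ^ b) = exp (A * real b) / real (dexp b)" for b
    by (simp add: powr_def dexp_def ln_realpow flip: powr_realpow)
  ultimately show ?thesis by simp
qed

lemma sieve_error_decay:
  assumes "A \<ge> 0"
  shows "(\<lambda>b. exp (A * real b) * sieve_error q b) \<longlonglongrightarrow> 0"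
proof -
  define \<kappa> where "\<kappa> = (2 :: real) ^ q"
  define \<epsilon> where "\<epsilon> b = exp (4 * \<kappa>) * exp_tail (2 * \<kappa>) b" for b
  define \<gamma> where "\<gamma> b = exp (2 * \<kappa>\<^sup>2 / real (dexp b)) - 1" for b
  have \<kappa>: "\<kappa> \<ge> 0" by (simp add: \<kappa>_def)
  have dinv: "(\<lambda>b. 1 / real (dexp b)) \<longlonglongrightarrow> 0" using exp_over_dexp_tendsto_0[of 0] by simp
  have \<gamma>0: "\<gamma> \<longlonglongrightarrow> 0"
  proof -
    have "(\<lambda>b. exp (2 * \<kappa>\<^sup>2 * (1 / real (dexp b))) - 1) \<longlonglongrightarrow> exp (2 * \<kappa>\<^sup>2 * 0) - 1"
      by (intro tendsto_intros dinv)
    then show ?thesis by (simp add: \<gamma>_def[abs_def])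
  qed
  have \<epsilon>0: "\<epsilon> \<longlonglongrightarrow> 0"
    unfolding \<epsilon>_def using \<kappa> by (intro tendsto_mult_right_zero exp_tail_tendsto_0) auto
  have e\<epsilon>: "(\<lambda>b. exp (A * real b) * \<epsilon> b) \<longlonglongrightarrow> 0"
  proof (rule tendsto_sandwich[of "\<lambda>_. 0"])
    show "\<forall>\<^sub>F b in sequentially. 0 \<le> exp (A * real b) * \<epsilon> b"
      unfolding \<epsilon>_def using \<kappa> exp_tail_nonneg by auto
    show "\<forall>\<^sub>F b in sequentially. exp (A * real b) * \<epsilon> b \<le> exp (4 * \<kappa>) * exp_tail (exp A * (2 * \<kappa>)) b"
    proof (rule always_eventually, rule allI)
      fix b
      have "exp (A * real b) * exp_tail (2 * \<kappa>) b \<le> exp_tail (exp A * (2 * \<kappa>)) b"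
        using \<kappa> assms by (intro exp_exp_tail_le) auto
      from mult_left_mono[OF this, of "exp (4 * \<kappa>)"]
      show "exp (A * real b) * \<epsilon> b \<le> exp (4 * \<kappa>) * exp_tail (exp A * (2 * \<kappa>)) b"
        unfolding \<epsilon>_def by (simp only: mult_ac exp_ge_zero)
    qed
    show "(\<lambda>b. exp (4 * \<kappa>) * exp_tail (exp A * (2 * \<kappa>)) b) \<longlonglongrightarrow> 0"
      using \<kappa> by (intro tendsto_mult_right_zero exp_tail_tendsto_0) auto
  qed simp
  have e\<gamma>: "(\<lambda>b. exp (A * real b) * \<gamma> b) \<longlonglongrightarrow> 0"
  proof (rule tendsto_sandwich[of "\<lambda>_. 0"])
    show "\<forall>\<^sub>F b in sequentially. 0 \<le> exp (A * real b) * \<gamma> b" by (simp add: \<gamma>_def)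
    have "(\<lambda>b. 2 * \<kappa>\<^sup>2 * (1 / real (dexp b))) \<longlonglongrightarrow> 2 * \<kappa>\<^sup>2 * 0" by (intro tendsto_intros dinv)
    then have "\<forall>\<^sub>F b in sequentially. 2 * \<kappa>\<^sup>2 * (1 / real (dexp b)) < 1"
      by (intro order_tendstoD(2)[where y = 0]) auto
    then show "\<forall>\<^sub>F b in sequentially. exp (A * real b) * \<gamma> b \<le> 4 * \<kappa>\<^sup>2 * (exp (A * real b) / real (dexp b))"
    proof eventually_elim
      case (elim b)
      define y where "y = 2 * \<kappa>\<^sup>2 / real (dexp b)"
      have y: "0 \<le> y" "y \<le> 1" using elim by (auto simp: y_def)
      have "exp y \<le> 1 + y + y\<^sup>2" using y by (rule exp_bound)
      moreover have "y\<^sup>2 \<le> y" using y by (simp add: power2_eq_square mult_left_le)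
      ultimately have "\<gamma> b \<le> 2 * y" unfolding \<gamma>_def y_def[symmetric] by linarith
      from mult_left_mono[OF this, of "exp (A * real b)"] show ?case
        unfolding y_def by (simp add: mult_ac)
    qed
    have "(\<lambda>b. 4 * \<kappa>\<^sup>2 * (exp (A * real b) / real (dexp b))) \<longlonglongrightarrow> 4 * \<kappa>\<^sup>2 * 0"
      by (intro tendsto_intros exp_over_dexp_tendsto_0)
    then show "(\<lambda>b. 4 * \<kappa>\<^sup>2 * (exp (A * real b) / real (dexp b))) \<longlonglongrightarrow> 0" by simp
  qed simp
  have "(\<lambda>b. (1 + \<gamma> b) * ((exp (A * real b) * \<epsilon> b) * exp (\<epsilon> b)) + 2 * real q * (exp (A * real b) / real (dexp b)) + exp (A * real b) * \<gamma> b)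
      \<longlonglongrightarrow> (1 + 0) * (0 * exp 0) + 2 * real q * 0 + 0"
    by (intro tendsto_intros \<gamma>0 \<epsilon>0 e\<epsilon> e\<gamma> exp_over_dexp_tendsto_0)
  moreover have "exp (A * real b) * sieve_error q b
      = (1 + \<gamma> b) * ((exp (A * real b) * \<epsilon> b) * exp (\<epsilon> b)) + 2 * real q * (exp (A * real b) / real (dexp b)) + exp (A * real b) * \<gamma> b" for b
    unfolding sieve_error_def Let_def \<kappa>_def[symmetric] \<epsilon>_def \<gamma>_def by (simp add: algebra_simps)
  ultimately show ?thesis by simp
qed

text \<open>L is taken maximal, so that \<open>dexp (Suc L)\<close>, the square of
  \<open>dexp L\<close>, violates the condition. Hence 2^L is at least a constant times ln T, which
  makes the sieve density O(1 / ln T).\<close>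

lemma sieve_limit_exists:
  assumes "dexp b ^ \<Gamma> \<le> T" "\<Gamma> > 0"
  obtains L where "b \<le> L" "dexp L ^ \<Gamma> \<le> T" "ln (real T) \<le> 2 * real \<Gamma> * 2 ^ L"
proof -
  have "\<exists>L\<ge>b. dexp L ^ \<Gamma> \<le> T \<and> \<not> dexp (Suc L) ^ \<Gamma> \<le> T"
  proof (rule ccontr)
    assume contra: "\<not> ?thesis"
    have all: "dexp L ^ \<Gamma> \<le> T" if "b \<le> L" for L
      using that by (induction L rule: dec_induct) (use assms contra in auto)
    \<comment> \<open>The condition fails for some L, since T < \<open>dexp T\<close>.\<close>
    have "T < 2 ^ T" "2 ^ T < (2::nat) ^ 2 ^ T" by (rule less_exp)+
    then have "T < dexp T" unfolding dexp_def by (rule less_trans)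
    also have "dexp T \<le> dexp (b + T)" by (rule dexp_mono) simp
    also have "\<dots> \<le> dexp (b + T) ^ \<Gamma>" using assms(2) dexp_pos by (intro self_le_power) (auto simp: Suc_leI)
    finally show False using all[of "b + T"] by simp
  qed
  then obtain L where L: "b \<le> L" "dexp L ^ \<Gamma> \<le> T" "T < dexp (Suc L) ^ \<Gamma>" by force
  have T0: "T > 0" using L(2) dexp_pos by (metis gr0I le_zero_eq power_eq_0_iff less_numeral_extra(3))
  have "ln (real T) \<le> ln (real (dexp (Suc L) ^ \<Gamma>))"
    using L(3) T0 by (subst ln_le_cancel_iff) auto
  also have "\<dots> = real \<Gamma> * (2 * 2 ^ L * ln 2)"
    by (simp add: dexp_def ln_realpow)
  also have "\<dots> \<le> real \<Gamma> * (2 * 2 ^ L * 1)"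
    using ln_2_less_1 by (intro mult_left_mono) auto
  finally show ?thesis using that L by (simp add: mult_ac)
qed

text \<open>The constant in the bound \<open>transfer_loss q b / ln T\<close> for the sieve density:
  2 exp (4b + 1) from \<open>sieve_product_upper\<close>, and twice the sieve exponent from
  \<open>sieve_limit_exists\<close>.\<close>

definition transfer_loss :: "nat \<Rightarrow> nat \<Rightarrow> real" where
  "transfer_loss q b = 4 * exp (4 * real b + 1) * real (sieve_exponent q b)"

text \<open>On the big primes the weight \<nu> equals 1 / V, where V is the sieve density. A sum of
  squares over them is thus at most V times the sum over all d weighted by \<nu>, and V = O(1 / ln
  T) makes up for the sparsity of the primes. Cauchy--Schwarz comes first because
  \<open>sieve_transfer\<close> treats squares.\<close>

lemma big_primes_transfer:
  fixes f :: "int \<Rightarrow> real"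
  assumes f: "\<And>y. \<bar>f y\<bar> \<le> 1" and J: "J > 0" and T: "T > 1" "dexp b ^ sieve_exponent q b \<le> T"
    and q: "q = Suc (length hs)" and M: "\<And>h. h \<in> set hs \<Longrightarrow> h \<le> M"
    and D: "q * T \<le> D" "M * D \<le> J" and E: "0 \<le> E" "2 ^ 2 ^ q * sieve_error q b \<le> E ^ (2 ^ q)"
    and b: "2 * 2 ^ q \<le> dexp b"
  shows "(\<Sum>p\<in>big_primes D. \<bar>dilate_mean f hs J (int p)\<bar>)\<^sup>2 \<le> real (card (big_primes D)) *
     (transfer_loss q b / ln (real T) * ((\<Sum>d\<in>{- int D..2 * int D}. \<bar>dilate_mean f hs J d\<bar>) + 12 * real D * E))"
proof -
  define \<Gamma> where "\<Gamma> = sieve_exponent q b"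
  have \<Gamma>: "\<Gamma> \<ge> 2" by (simp add: \<Gamma>_def sieve_exponent_def)
  obtain L where L: "b \<le> L" "dexp L ^ \<Gamma> \<le> T" "ln (real T) \<le> 2 * real \<Gamma> * 2 ^ L"
    using sieve_limit_exists[of b \<Gamma> T] T(2) \<Gamma> by (auto simp: \<Gamma>_def)
  define V where "V = sieve_density b L"
  define \<nu> where "\<nu> = sieve_weight b L"
  define K where "K d = dilate_mean f hs J d" for d
  have V0: "V > 0" unfolding V_def sieve_density_def
    using sieve_product_lower[OF L(1)] exp_gt_zero less_le_trans by blast
  have \<nu>0: "0 \<le> \<nu> d" for d using V0 by (simp add: \<nu>_def sieve_weight_def V_def)
  have TD: "T \<le> D"
  proof -
    have "T \<le> q * T" by (simp add: q)
    then show ?thesis using D(1) by linarith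
  qed
  have rough: "V * \<nu> (int p) = 1" if p: "p \<in> big_primes D" for p
  proof -
    have "\<not> int r dvd int p" if r: "r \<in> primes_between (dexp b) (dexp L)" for r
    proof
      assume "int r dvd int p"
      then have "r = p" using r p by (simp add: primes_between_def big_primes_def primes_dvd_imp_eq)
      then have "p \<le> dexp L" using r by (simp add: primes_between_def)
      then have "p * p \<le> dexp L ^ 2" by (simp add: power2_eq_square mult_le_mono)
      also have "\<dots> \<le> dexp L ^ \<Gamma>" using \<Gamma> Suc_leI[OF dexp_pos[of L]] by (intro power_increasing) auto
      also have "\<dots> \<le> D" using L(2) TD by linarith
      finally show False using p by (simp add: big_primes_def)
    qed
    then show ?thesis using V0 by (simp add: \<nu>_def sieve_weight_def V_def)
  qed
  have "(\<Sum>p\<in>big_primes D. \<bar>K (int p)\<bar>)\<^sup>2 \<le> real (card (big_primes D)) * (\<Sum>p\<in>big_primes D. (K (int p))\<^sup>2)"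
    using Cauchy_Schwarz_ineq_sum[of "\<lambda>_. 1" "\<lambda>p. \<bar>K (int p)\<bar>" "big_primes D"] by simp
  also have "(\<Sum>p\<in>big_primes D. (K (int p))\<^sup>2) \<le> V * (\<Sum>d\<in>{1..int D}. \<nu> d * (K d)\<^sup>2)"
  proof -
    have "(\<Sum>p\<in>big_primes D. (K (int p))\<^sup>2) = (\<Sum>p\<in>big_primes D. V * (\<nu> (int p) * (K (int p))\<^sup>2))"
      using rough by (intro sum.cong) (simp_all add: mult.assoc[symmetric])
    also have "\<dots> = (\<Sum>d\<in>int ` big_primes D. V * (\<nu> d * (K d)\<^sup>2))"
      by (subst sum.reindex) auto
    also have "\<dots> \<le> (\<Sum>d\<in>{1..int D}. V * (\<nu> d * (K d)\<^sup>2))"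
      using V0 \<nu>0 by (intro sum_mono2) (auto simp: big_primes_def prime_gt_0_nat Suc_leI intro!: mult_nonneg_nonneg)
    finally show ?thesis by (simp add: sum_distrib_left)
  qed
  also have "(\<Sum>d\<in>{1..int D}. \<nu> d * (K d)\<^sup>2) \<le> (\<Sum>d\<in>{- int D..2 * int D}. (K d)\<^sup>2) + 12 * real D * E"
    unfolding K_def
  proof (rule sieve_transfer[OF f \<nu>0 _ J q M D E(1)])
    show "T > 0" using T by simp
    fix c
    have "box_avg T (replicate q (\<lambda>t. t)) (\<lambda>d. \<nu> d - 1) c
        = avg (2 * q) {1..int T} (\<lambda>xs. \<Prod>\<omega> | length \<omega> = q. sieve_weight b L (c + cube_form \<omega> xs) - 1)"
      using T(1) by (simp add: box_avg_cube \<nu>_def)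
    also have "\<dots> \<le> 2 ^ 2 ^ q * sieve_error q b"
      using L b by (intro sieve_cube_centered) (auto simp: q \<Gamma>_def)
    finally show "box_avg T (replicate q (\<lambda>t. t)) (\<lambda>d. \<nu> d - 1) c \<le> E ^ 2 ^ q" using E(2) by linarith
  qed
  \<comment> \<open>Squares are weakened to absolute values, which is the form bounded by
    \<open>dense_von_neumann\<close>.\<close>
  also have "(\<Sum>d\<in>{- int D..2 * int D}. (K d)\<^sup>2) \<le> (\<Sum>d\<in>{- int D..2 * int D}. \<bar>K d\<bar>)"
  proof (rule sum_mono)
    fix d
    have "\<bar>K d\<bar> \<le> 1" unfolding K_def using f J by (rule abs_dilate_mean_le)
    then have "\<bar>K d\<bar> * \<bar>K d\<bar> \<le> \<bar>K d\<bar>" by (intro mult_left_le) auto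
    then show "(K d)\<^sup>2 \<le> \<bar>K d\<bar>" by (simp add: power2_eq_square abs_mult_self_eq)
  qed
  finally have 1: "(\<Sum>p\<in>big_primes D. \<bar>K (int p)\<bar>)\<^sup>2
      \<le> real (card (big_primes D)) * (V * ((\<Sum>d\<in>{- int D..2 * int D}. \<bar>K d\<bar>) + 12 * real D * E))"
    using V0 by (simp add: mult_left_mono)
  have "V \<le> 2 * exp (4 * real b + 1) / 2 ^ L" unfolding V_def sieve_density_def using L(1) by (rule sieve_product_upper)
  also have "\<dots> = 2 * exp (4 * real b + 1) * (1 / 2 ^ L)" by simp
  also have "1 / 2 ^ L \<le> 2 * real \<Gamma> / ln (real T)"
    using L(3) T(1) by (simp add: field_simps)
  finally have "V \<le> transfer_loss q b / ln (real T)"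
    by (simp add: transfer_loss_def \<Gamma>_def mult_left_mono)
  then have "V * ((\<Sum>d\<in>{- int D..2 * int D}. \<bar>K d\<bar>) + 12 * real D * E)
      \<le> transfer_loss q b / ln (real T) * ((\<Sum>d\<in>{- int D..2 * int D}. \<bar>K d\<bar>) + 12 * real D * E)"
    using E(1) by (intro mult_right_mono add_nonneg_nonneg sum_nonneg) auto
  then have "real (card (big_primes D)) * (V * ((\<Sum>d\<in>{- int D..2 * int D}. \<bar>K d\<bar>) + 12 * real D * E))
      \<le> real (card (big_primes D)) * (transfer_loss q b / ln (real T) * ((\<Sum>d\<in>{- int D..2 * int D}. \<bar>K d\<bar>) + 12 * real D * E))"
    by (rule mult_left_mono) simp
  with 1 show ?thesis unfolding K_def by linarith
qed

lemma transfer_loss_pos: "0 < transfer_loss q b"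
proof -
  have "sieve_exponent q b > 0" by (simp add: sieve_exponent_def)
  then show ?thesis by (simp add: transfer_loss_def)
qed

text \<open>The allowed error is the 2^q-th power of c / \<open>transfer_loss\<close>, so it decays
  only exponentially in b, whereas \<open>sieve_error\<close> decays faster. Hence some b depending
  on c and q alone works.\<close>

lemma transfer_loss_choice:
  fixes c :: real
  assumes c: "c > 0"
  obtains b where "2 * 2 ^ q \<le> dexp b"
    "2 ^ 2 ^ q * sieve_error q b \<le> (c / transfer_loss q b) ^ (2 ^ q)"
proof -
  define N :: nat where "N = 2 ^ q"
  define C where "C = 4 * exp 1 * (22 + 8 * 2 ^ q :: real)"
  have loss: "0 < transfer_loss q b" "transfer_loss q b \<le> C * exp (5 * real b)" for b
  proof -
    show "0 < transfer_loss q b" by (rule transfer_loss_pos)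
    have "1 \<le> exp (real b)" by simp
    moreover have "real b \<le> exp (real b)" using exp_ge_add_one_self[of "real b"] by linarith
    moreover have "(14 + 8 * 2 ^ q) * 1 \<le> (14 + 8 * 2 ^ q) * exp (real b)" by (intro mult_left_mono) auto
    ultimately have "real (sieve_exponent q b) \<le> (22 + 8 * 2 ^ q) * exp (real b)"
      by (simp add: sieve_exponent_def algebra_simps)
    then have "transfer_loss q b \<le> 4 * exp (4 * real b + 1) * ((22 + 8 * 2 ^ q) * exp (real b))"
      unfolding transfer_loss_def by (intro mult_left_mono) auto
    also have "\<dots> = C * (exp (4 * real b) * exp (real b))" by (simp add: C_def exp_add mult_ac)
    also have "exp (4 * real b) * exp (real b) = exp (5 * real b)" by (simp flip: exp_add)
    finally show "transfer_loss q b \<le> C * exp (5 * real b)" .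
  qed
  define A where "A = 5 * real N"
  have "(\<lambda>b. (2 ^ N * (C / c) ^ N) * (exp (A * real b) * sieve_error q b)) \<longlonglongrightarrow> 2 ^ N * (C / c) ^ N * 0"
    by (intro tendsto_intros sieve_error_decay) (simp add: A_def)
  then have "\<forall>\<^sub>F b in sequentially. (2 ^ N * (C / c) ^ N) * (exp (A * real b) * sieve_error q b) < 1"
    by (intro order_tendstoD(2)[where y = 0]) auto
  moreover have "\<forall>\<^sub>F b in sequentially. 2 * 2 ^ q \<le> dexp b"
  proof -
    have "2 * 2 ^ q \<le> dexp b" if "b \<ge> Suc q" for b
    proof -
      have "2 * 2 ^ q = (2::nat) ^ Suc q" by simp
      also have "\<dots> \<le> 2 ^ 2 ^ b"
      proof (rule power_increasing)
        have "b < 2 ^ b" by (rule less_exp)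
        with that show "Suc q \<le> 2 ^ b" by linarith
      qed simp
      finally show ?thesis by (simp add: dexp_def)
    qed
    then show ?thesis unfolding eventually_sequentially by blast
  qed
  ultimately have "\<forall>\<^sub>F b in sequentially. (2 ^ N * (C / c) ^ N) * (exp (A * real b) * sieve_error q b) < 1 \<and> 2 * 2 ^ q \<le> dexp b"
    by (rule eventually_conj)
  then obtain b where b: "(2 ^ N * (C / c) ^ N) * (exp (A * real b) * sieve_error q b) < 1" "2 * 2 ^ q \<le> dexp b"
    unfolding eventually_sequentially by blast
  have "2 ^ N * sieve_error q b \<le> 1 / ((C / c) ^ N * exp (A * real b))"
    using b(1) c by (simp add: C_def field_simps add_pos_pos)
  also have "exp (A * real b) = exp (5 * real b) ^ N" by (simp add: A_def mult_ac flip: exp_of_nat_mult)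
  also have "1 / ((C / c) ^ N * exp (5 * real b) ^ N) = (c / (C * exp (5 * real b))) ^ N"
    by (simp add: power_divide power_mult_distrib)
  also have "\<dots> \<le> (c / transfer_loss q b) ^ N"
    using loss[of b] c by (intro power_mono divide_left_mono mult_pos_pos) (auto simp: C_def add_pos_pos)
  finally show ?thesis using that b(2) by (simp add: N_def)
qed

text \<open>The bound of \<open>dense_von_neumann\<close> for all d is carried to the primes by
  \<open>big_primes_transfer\<close>. The constants \<open>E\<close> and \<open>\<eta>\<close> make
  the two terms of the latter contribute \<epsilon>^2 / 2 each, and \<open>\<delta>\<close> is what
  the former needs for the first of them.\<close>

theorem prime_von_neumann:
  assumes hs: "distinct hs" "hs \<noteq> []" "\<And>h. h \<in> set hs \<Longrightarrow> 1 \<le> h \<and> h \<le> M" and \<epsilon>: "\<epsilon> > (0::real)"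
  obtains \<delta> k0 where "\<delta> > 0" and "\<And>k f. k \<ge> k0 \<Longrightarrow> (\<And>y. \<bar>f y\<bar> \<le> 1) \<Longrightarrow> (\<And>y. \<not> (1 \<le> y \<and> y \<le> int k) \<Longrightarrow> f y = 0) \<Longrightarrow>
     gowers_sq (int k) (Suc (length hs)) f \<le> \<delta> * real k ^ (length hs + 3) \<Longrightarrow>
     (\<Sum>p\<in>big_primes (k div (2 * M)). \<bar>dilate_mean f hs (k div 2) (int p)\<bar>) \<le> \<epsilon> * real (card (big_primes (k div (2 * M))))"
proof -
  define q where "q = Suc (length hs)"
  have M: "M \<ge> 1" using hs(2,3) by (cases hs) fastforce+
  obtain b where b: "2 * 2 ^ q \<le> dexp b"
    "2 ^ 2 ^ q * sieve_error q b \<le> (\<epsilon>\<^sup>2 / 576 / transfer_loss q b) ^ (2 ^ q)"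
    using transfer_loss_choice[of "\<epsilon>\<^sup>2 / 576" q] \<epsilon> by auto
  define A where "A = transfer_loss q b"
  have A: "A > 0" by (simp add: A_def transfer_loss_pos)
  define E where "E = \<epsilon>\<^sup>2 / 576 / A"
  have E: "E > 0" using \<epsilon> A by (simp add: E_def)
  define \<eta> where "\<eta> = \<epsilon>\<^sup>2 / (48 * A * (216 * real M))"
  have \<eta>: "\<eta> > 0" using \<epsilon> A M by (simp add: \<eta>_def)
  \<comment> \<open>Bounds 3^q (k / T)^q, since k \<le> 4 M D and D \<le> 2 q T.\<close>
  define C where "C = (24 * real M * real q) ^ q"
  have C: "C > 0" using M by (simp add: C_def q_def)
  define \<delta> where "\<delta> = (\<eta> ^ (2 ^ q) / C)\<^sup>2"
  have \<delta>: "\<delta> > 0" using \<eta> C by (simp add: \<delta>_def)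
  obtain D0 where D0: "\<And>D. D \<ge> D0 \<Longrightarrow> real D / (12 * ln (real D)) \<le> real (card (big_primes D))"
    using card_big_primes_lower unfolding eventually_sequentially by blast
  \<comment> \<open>Large enough for \<open>card_big_primes_lower\<close>, for D \<le> T^2, and for
    T to admit a sieving limit.\<close>
  define D1 where "D1 = D0 + 4 * q\<^sup>2 + q * (dexp b ^ sieve_exponent q b + 2) + 2"
  show ?thesis
  proof (rule that[OF \<delta>])
    fix k :: nat and f :: "int \<Rightarrow> real"
    assume k: "k \<ge> 4 * M * (D1 + 1)" and f: "\<And>y. \<bar>f y\<bar> \<le> 1" "\<And>y. \<not> (1 \<le> y \<and> y \<le> int k) \<Longrightarrow> f y = 0"
      and small: "gowers_sq (int k) (Suc (length hs)) f \<le> \<delta> * real k ^ (length hs + 3)"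
    define D where "D = k div (2 * M)"
    define J where "J = k div 2"
    define T where "T = D div q"
    define K where "K d = dilate_mean f hs J d" for d
    define S where "S = (\<Sum>d\<in>{- int D..2 * int D}. \<bar>K d\<bar>)"
    have "4 * 1 * 1 \<le> 4 * M * (D1 + 1)" using M by (intro mult_le_mono) auto
    then have k4: "k \<ge> 4" using k by linarith
    have J: "J > 0" "J \<le> k" "k \<le> 3 * J" using k4 by (auto simp: J_def)
    have DD: "D \<ge> D1"
    proof -
      have "2 * M * D1 \<le> k" using k by (simp add: algebra_simps)
      then show ?thesis unfolding D_def using M by (simp add: less_eq_div_iff_mult_less_eq mult.commute)
    qed
    have kD: "real k \<le> 4 * real M * real D"
    proof -
      have "k < 2 * M * (D + 1)" unfolding D_def using M dividend_less_times_div[of "2 * M" k] by simp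
      also have "\<dots> \<le> 2 * M * (2 * D)" using DD by (intro mult_le_mono2) (simp add: D1_def)
      finally have "k \<le> 4 * M * D" by simp
      then show ?thesis using of_nat_mono[of k "4 * M * D", where 'a = real] by simp
    qed
    have MD: "M * D \<le> J"
    proof -
      have "2 * M * D \<le> k" unfolding D_def by simp
      then show ?thesis unfolding J_def by linarith
    qed
    have qT: "q * T \<le> D" unfolding T_def by simp
    have q0: "q > 0" by (simp add: q_def)
    have T: "T \<ge> dexp b ^ sieve_exponent q b + 2"
    proof -
      have "(dexp b ^ sieve_exponent q b + 2) * q \<le> D" using DD by (simp add: D1_def mult.commute)
      then show ?thesis unfolding T_def using q0 by (simp add: less_eq_div_iff_mult_less_eq)
    qed
    have TD: "real D \<le> 2 * real q * real T"
    proof -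
      have "D < q * (T + 1)" unfolding T_def using q0 dividend_less_times_div[of q D] by simp
      also have "\<dots> \<le> q * (2 * T)" using T by (intro mult_le_mono2) simp
      finally have "D \<le> 2 * q * T" by simp
      then show ?thesis using of_nat_mono[of D "2 * q * T", where 'a = real] by simp
    qed
    have D2: "D \<ge> 2" "real D \<ge> 4 * (real q)\<^sup>2"
    proof -
      show "D \<ge> 2" using DD by (simp add: D1_def)
      have "4 * q\<^sup>2 \<le> D" using DD by (simp add: D1_def)
      then show "real D \<ge> 4 * (real q)\<^sup>2" using of_nat_mono[of "4 * q\<^sup>2" D, where 'a = real] by simp
    qed
    \<comment> \<open>D \<ge> 4 q^2 renders the loss in D \<le> 2 q T harmless: squaring gives D
      \<le> T^2.\<close>
    have lnT: "ln (real D) \<le> 2 * ln (real T)"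
    proof -
      have "real D * real D \<le> (2 * real q * real T) * (2 * real q * real T)"
        using TD by (intro mult_mono) auto
      also have "\<dots> = 4 * (real q)\<^sup>2 * (real T)\<^sup>2" by (simp add: power2_eq_square)
      also have "\<dots> \<le> real D * (real T)\<^sup>2" using D2 by (intro mult_right_mono) auto
      finally have "real D \<le> (real T)\<^sup>2" using D2 by simp
      then have "ln (real D) \<le> ln ((real T)\<^sup>2)" using D2 T by (subst ln_le_cancel_iff) auto
      then show ?thesis using T by (simp add: ln_realpow)
    qed
    have lnD: "ln (real D) > 0" using D2 by simp
    have T1: "T > 1" "ln (real T) > 0" using T by auto
    define n where "n = real (card (big_primes D))"
    have n: "real D / (12 * ln (real D)) \<le> n" unfolding n_def using DD by (intro D0) (simp add: D1_def)
    have "0 < real D / (12 * ln (real D))" using D2 lnD by simp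
    then have n0: "n > 0" using n by linarith
    have Sb: "S \<le> 216 * real M * real D * \<eta>"
    proof -
      have "(S / (54 * real k)) ^ (2 ^ q) \<le> 3 ^ q * (real k / real T) ^ q * sqrt (gowers_sq (int k) q f / real k ^ (q + 2))"
        unfolding S_def K_def using f T1 J hs qT MD by (intro dense_von_neumann) (auto simp: q_def)
      also have "\<dots> \<le> 3 ^ q * (8 * real M * real q) ^ q * sqrt \<delta>"
      proof -
        have "real k \<le> 4 * real M * (2 * real q * real T)"
          using kD mult_left_mono[OF TD, of "4 * real M"] by linarith
        then have "real k / real T \<le> 8 * real M * real q" using T1 by (simp add: field_simps)
        then have pow: "(real k / real T) ^ q \<le> (8 * real M * real q) ^ q" by (rule power_mono) simp
        have eq: "length hs + 3 = q + 2" by (simp add: q_def)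
        have "gowers_sq (int k) q f \<le> \<delta> * real k ^ (q + 2)" using small unfolding eq q_def[symmetric] .
        then have "gowers_sq (int k) q f / real k ^ (q + 2) \<le> \<delta>" using k4 by (simp add: divide_le_eq)
        then have root: "sqrt (gowers_sq (int k) q f / real k ^ (q + 2)) \<le> sqrt \<delta>" by (rule real_sqrt_le_mono)
        have "0 \<le> gowers_sq (int k) q f / real k ^ (q + 2)"
          by (rule divide_nonneg_nonneg[OF gowers_sq_nonneg]) simp
        then have "0 \<le> sqrt (gowers_sq (int k) q f / real k ^ (q + 2))" by (rule real_sqrt_ge_zero)
        with root pow show ?thesis by (intro mult_mono mult_left_mono) simp_all
      qed
      also have "3 ^ q * (8 * real M * real q) ^ q = C"
        unfolding C_def power_mult_distrib[symmetric] by (rule arg_cong[where f = "\<lambda>x. x ^ q"]) simp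
      also have "sqrt \<delta> = \<eta> ^ (2 ^ q) / C"
        unfolding \<delta>_def using \<eta> C by (intro real_sqrt_unique divide_nonneg_pos zero_le_power) simp_all
      also have "C * (\<eta> ^ (2 ^ q) / C) = \<eta> ^ (2 ^ q)" using C by (simp only: times_divide_eq_right nonzero_mult_div_cancel_left[OF less_imp_neq[OF C, symmetric]])
      finally have pw: "(S / (54 * real k)) ^ (2 ^ q) \<le> \<eta> ^ (2 ^ q)" .
      have S0: "0 \<le> S / (54 * real k)" unfolding S_def by (intro divide_nonneg_nonneg sum_nonneg) simp_all
      have "S / (54 * real k) \<le> \<eta>"
        by (rule power_mono_iff[OF S0 less_imp_le[OF \<eta>], THEN iffD1, OF _ pw]) simp
      then have "S \<le> \<eta> * (54 * real k)" using k4 by (simp add: divide_le_eq)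
      also have "\<dots> \<le> \<eta> * (54 * (4 * real M * real D))" using kD \<eta> by (intro mult_left_mono) auto
      finally show ?thesis by (simp add: mult_ac)
    qed
    have "(\<Sum>p\<in>big_primes D. \<bar>K (int p)\<bar>)\<^sup>2 \<le> n * (A / ln (real T) * (S + 12 * real D * E))"
      unfolding n_def S_def K_def A_def
      by (rule big_primes_transfer[OF f(1) J(1) T1(1) _ _ _ qT MD _ _ b(1)])
         (use T hs(3) E b(2) in \<open>auto simp: q_def E_def A_def\<close>)
    also have "\<dots> \<le> n * (n * (24 * A / real D) * (S + 12 * real D * E))"
    proof -
      have "A / ln (real T) \<le> A / (ln (real D) / 2)"
        using A lnT lnD T1 by (intro divide_left_mono mult_pos_pos) auto
      also have "\<dots> = (real D / (12 * ln (real D))) * (24 * A / real D)" using D2 lnD by simp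
      also have "\<dots> \<le> n * (24 * A / real D)" using n A by (intro mult_right_mono) auto
      finally show ?thesis using n0 E by (intro mult_left_mono mult_right_mono add_nonneg_nonneg) (auto simp: S_def intro!: sum_nonneg)
    qed
    also have "\<dots> = n\<^sup>2 * (24 * A * (S / real D + 12 * E))"
      using D2 by (simp add: power2_eq_square field_simps)
    also have "\<dots> \<le> n\<^sup>2 * (24 * A * (216 * real M * \<eta> + 12 * E))"
    proof -
      have "S / real D \<le> 216 * real M * \<eta>" using Sb D2 by (simp add: divide_le_eq mult_ac)
      then show ?thesis using A by (intro mult_left_mono add_right_mono) auto
    qed
    also have "24 * A * (216 * real M * \<eta> + 12 * E) = \<epsilon>\<^sup>2"
      using A M by (simp add: \<eta>_def E_def field_simps)
    also have "n\<^sup>2 * \<epsilon>\<^sup>2 = (\<epsilon> * n)\<^sup>2" unfolding power_mult_distrib by (rule mult.commute)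
    finally have sq: "(\<Sum>p\<in>big_primes D. \<bar>K (int p)\<bar>)\<^sup>2 \<le> (\<epsilon> * n)\<^sup>2" .
    have "0 \<le> \<epsilon> * n" using \<epsilon> n0 by simp
    with sq have "(\<Sum>p\<in>big_primes D. \<bar>K (int p)\<bar>) \<le> \<epsilon> * n" by (rule power2_le_imp_le)
    then show "(\<Sum>p\<in>big_primes (k div (2 * M)). \<bar>dilate_mean f hs (k div 2) (int p)\<bar>) \<le> \<epsilon> * real (card (big_primes (k div (2 * M))))"
      by (simp add: K_def D_def J_def n_def)
  qed
qed

section \<open>Two ingredients of the moment bound\<close>

lemma sum_periodic_mean_zero_le:
  fixes a :: "int \<Rightarrow> real"
  assumes e: "e > 0" and a: "\<And>x. a (x mod e) = a x" "\<And>x. \<bar>a x\<bar> \<le> B" "(\<Sum>x\<in>{0..<e}. a x) = 0"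
  shows "\<bar>\<Sum>x\<in>{c..<c + int N}. a x\<bar> \<le> of_int e * B"
proof -
  define g where "g = N div nat e"
  define m where "m = int g * e"
  define h where "h = int N - m"
  have m: "m = int N div e * e" unfolding m_def g_def using e by (simp add: zdiv_int)
  have h: "0 \<le> h" "h < e" unfolding h_def m using e pos_mod_bound[of e "int N"] pos_mod_sign[of e "int N"]
    by (simp_all add: minus_div_mult_eq_mod)
  have m0: "0 \<le> m" using e by (simp add: m_def)
  have "{c..<c + int N} = {c..<c + m} \<union> {c + m..<c + int N}" using h m0 by (auto simp: h_def)
  then have "(\<Sum>x\<in>{c..<c + int N}. a x) = (\<Sum>x\<in>{c..<c + m}. a x) + (\<Sum>x\<in>{c + m..<c + int N}. a x)"
    by (simp add: sum.union_disjoint)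
  also have "(\<Sum>x\<in>{c..<c + m}. a x) = 0"
    unfolding m_def using sum_period_blocks[of e a c g] e a by simp
  finally have "\<bar>\<Sum>x\<in>{c..<c + int N}. a x\<bar> = \<bar>\<Sum>x\<in>{c + m..<c + int N}. a x\<bar>" by simp
  also have "\<dots> \<le> (\<Sum>x\<in>{c + m..<c + int N}. B)"
    using a(2) by (intro order.trans[OF sum_abs] sum_mono) auto
  also have "\<dots> = of_int h * B" using h by (simp add: h_def)
  also have "\<dots> \<le> of_int e * B" using h a(2)[of 0] by (intro mult_right_mono) auto
  finally show ?thesis .
qed

text \<open>Such a function is described by a table \<open>u\<close> of r values, padded with
  \<open>p0\<close>, and by the index \<open>c i\<close> at which g i stands in the table.\<close>

lemma card_few_values:
  fixes P :: "nat set"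
  assumes P: "finite P" "P \<noteq> {}"
  shows "card {g \<in> PiE {..<m} (\<lambda>_. P). card (g ` {..<m}) \<le> r} \<le> card P ^ r * r ^ m"
proof -
  obtain p0 where p0: "p0 \<in> P" using P(2) by blast
  define F where "F = (\<lambda>(u :: nat \<Rightarrow> nat, c :: nat \<Rightarrow> nat). \<lambda>i\<in>{..<m}. u (c i))"
  define X where "X = PiE {..<r} (\<lambda>_. P) \<times> PiE {..<m} (\<lambda>_. {..<r})"
  have "{g \<in> PiE {..<m} (\<lambda>_. P). card (g ` {..<m}) \<le> r} \<subseteq> F ` X"
  proof
    fix g assume g: "g \<in> {g \<in> PiE {..<m} (\<lambda>_. P). card (g ` {..<m}) \<le> r}"
    define s where "s = card (g ` {..<m})"
    obtain e where e: "bij_betw e {0..<s} (g ` {..<m})"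
      using ex_bij_betw_nat_finite[of "g ` {..<m}"] by (auto simp: s_def)
    define u where "u = (\<lambda>i\<in>{..<r}. if i < s then e i else p0)"
    define c where "c = (\<lambda>i\<in>{..<m}. inv_into {0..<s} e (g i))"
    have c: "c i \<in> {0..<s}" "e (c i) = g i" if "i < m" for i
    proof -
      have gi: "g i \<in> e ` {0..<s}" using that e by (simp add: bij_betw_def)
      show "c i \<in> {0..<s}" "e (c i) = g i"
        using that inv_into_into[OF gi] f_inv_into_f[OF gi] by (simp_all add: c_def)
    qed
    have "u \<in> PiE {..<r} (\<lambda>_. P)"
    proof (rule PiE_I)
      fix i assume i: "i \<in> {..<r}"
      have "e i \<in> P" if "i < s"
      proof -
        have "e i \<in> g ` {..<m}" using e that by (auto simp: bij_betw_def)
        then show ?thesis using g by (auto simp: PiE_iff)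
      qed
      then show "u i \<in> P" using i p0 by (simp add: u_def)
    qed (simp add: u_def)
    moreover have "c \<in> PiE {..<m} (\<lambda>_. {..<r})"
    proof (rule PiE_I)
      fix i assume "i \<in> {..<m}"
      then show "c i \<in> {..<r}" using c(1)[of i] g by (simp add: s_def)
    qed (simp add: c_def)
    moreover have "g = F (u, c)"
    proof
      fix i
      show "g i = F (u, c) i"
      proof (cases "i < m")
        case True
        then have "c i < s" "s \<le> r" using c(1)[of i] g by (auto simp: s_def)
        then show ?thesis using True c(2)[of i] by (simp add: F_def u_def)
      next
        case False
        then show ?thesis using g by (auto simp: F_def PiE_def extensional_def)
      qed
    qed
    ultimately show "g \<in> F ` X" unfolding X_def by blast
  qed
  moreover have "finite X" unfolding X_def using P(1) by (intro finite_cartesian_product finite_PiE) auto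
  ultimately have "card {g \<in> PiE {..<m} (\<lambda>_. P). card (g ` {..<m}) \<le> r} \<le> card X"
    by (meson card_image_le card_mono finite_imageI le_trans)
  also have "\<dots> = card P ^ r * r ^ m" by (simp add: X_def card_cartesian_product card_PiE)
  finally show ?thesis .
qed

section \<open>Concentration of divisibility over few patterns\<close>

text \<open>The prime g i0 is coprime to all other primes that occur, so by the Chinese remainder
  theorem the sum over a full period factors, and the factor of g i0 vanishes. What remains is less
  than one period, of length at most D^m.\<close>

lemma sum_prod_single_value:
  fixes Y :: "nat \<Rightarrow> int \<Rightarrow> real"
  assumes prime: "\<And>p. p \<in> P \<Longrightarrow> prime p" and D: "\<And>p. p \<in> P \<Longrightarrow> p \<le> D"
    and Y: "\<And>p x. p \<in> P \<Longrightarrow> Y p (x mod int p) = Y p x" "\<And>p x. p \<in> P \<Longrightarrow> \<bar>Y p x\<bar> \<le> B"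
      "\<And>p. p \<in> P \<Longrightarrow> (\<Sum>x\<in>{0..<int p}. Y p x) = 0"
    and g: "g \<in> PiE {..<m} (\<lambda>_. P)" and i0: "i0 < m" "\<And>i. i < m \<Longrightarrow> i \<noteq> i0 \<Longrightarrow> g i \<noteq> g i0"
  shows "\<bar>\<Sum>x\<in>{c..<c + int N}. \<Prod>i<m. Y (g i) x\<bar> \<le> real D ^ m * B ^ m"
proof -
  have gP: "g i \<in> P" if "i < m" for i using g that by (auto simp: PiE_iff)
  define I where "I = {..<m} - {i0}"
  define E where "E = g ` I"
  define p0 where "p0 = g i0"
  define q where "q = \<Prod>E"
  define G where "G x = (\<Prod>i\<in>I. Y (g i) x)" for x
  have p0: "p0 \<in> P" "prime p0" using gP[OF i0(1)] prime by (auto simp: p0_def)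
  have EP: "E \<subseteq> P" using gP by (auto simp: E_def I_def)
  have finE: "finite E" by (simp add: E_def I_def)
  have B0: "0 \<le> B" using Y(2)[OF p0(1), of 0] by linarith
  have D1: "D \<ge> 1" using D[OF p0(1)] prime_ge_1_nat[OF p0(2)] by linarith
  have "p0 \<notin> E"
  proof
    assume "p0 \<in> E"
    then obtain i where "i < m" "i \<noteq> i0" "g i0 = g i" by (auto simp: E_def I_def p0_def)
    with i0(2)[of i] show False by simp
  qed
  then have cop: "coprime p0 q" unfolding q_def
    using EP p0(2) prime by (intro prod_coprime_right) (metis primes_coprime subsetD)
  have q0: "q > 0" unfolding q_def using EP prime prime_gt_0_nat by (intro prod_pos) auto
  have split: "(\<Prod>i<m. Y (g i) x) = Y p0 x * G x" for x
    unfolding G_def I_def p0_def using i0(1) by (subst prod.remove[of _ i0]) auto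
  have G: "G (x mod int q) = G x" for x
    unfolding G_def
  proof (rule prod.cong[OF refl])
    fix i assume i: "i \<in> I"
    then have "int (g i) dvd int q" unfolding q_def int_dvd_int_iff using finE by (intro dvd_prodI) (auto simp: E_def)
    then have "x mod int q mod int (g i) = x mod int (g i)" by (rule mod_mod_cancel)
    then show "Y (g i) (x mod int q) = Y (g i) x"
      using Y(1)[OF gP[of i], of "x mod int q"] Y(1)[OF gP[of i], of x] i by (simp add: I_def)
  qed
  have bnd: "\<bar>Y p0 x * G x\<bar> \<le> B ^ m" for x
  proof -
    have "\<bar>\<Prod>i<m. Y (g i) x\<bar> \<le> (\<Prod>i<m. B)"
      unfolding abs_prod using Y(2) gP by (intro prod_mono) auto
    then show ?thesis by (simp add: split)
  qed
  have "\<bar>\<Sum>x\<in>{c..<c + int N}. Y p0 x * G x\<bar> \<le> of_int (int p0 * int q) * B ^ m"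
  proof (rule sum_periodic_mean_zero_le)
    show "0 < int p0 * int q" using p0(2) q0 by (simp add: prime_gt_0_nat)
    fix x
    have "Y p0 (x mod (int p0 * int q)) = Y p0 x"
      using Y(1)[OF p0(1), of "x mod (int p0 * int q)"] Y(1)[OF p0(1), of x] by (simp add: mod_mod_cancel)
    moreover have "G (x mod (int p0 * int q)) = G x"
      using G[of "x mod (int p0 * int q)"] G[of x] by (simp add: mod_mod_cancel)
    ultimately show "Y p0 (x mod (int p0 * int q)) * G (x mod (int p0 * int q)) = Y p0 x * G x" by simp
  next
    have "(\<Sum>x\<in>{0..<int p0 * int q}. Y p0 (x mod int p0) * G (x mod int q)) = (\<Sum>x\<in>{0..<int p0}. Y p0 x) * (\<Sum>x\<in>{0..<int q}. G x)"
      using p0(2) q0 cop by (intro sum_crt) (auto simp: prime_gt_0_nat)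
    then show "(\<Sum>x\<in>{0..<int p0 * int q}. Y p0 x * G x) = 0"
      using Y(1)[OF p0(1)] Y(3)[OF p0(1)] G by simp
  qed (rule bnd)
  also have "of_int (int p0 * int q) * B ^ m \<le> real D ^ m * B ^ m"
  proof (rule mult_right_mono)
    have "q \<le> D ^ card E"
    proof -
      have "(\<Prod>p\<in>E. p) \<le> (\<Prod>p\<in>E. D)" using EP D by (intro prod_mono) auto
      then show ?thesis by (simp add: q_def)
    qed
    also have "\<dots> \<le> D ^ (m - 1)"
    proof (rule power_increasing[OF _ D1])
      have "card E \<le> card I" unfolding E_def by (rule card_image_le) (simp add: I_def)
      then show "card E \<le> m - 1" using i0(1) by (simp add: I_def)
    qed
    finally have "p0 * q \<le> D * D ^ (m - 1)" using D[OF p0(1)] by (rule mult_le_mono[rotated])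
    also have "\<dots> = D ^ m" using i0(1) by (cases m) auto
    finally have "real (p0 * q) \<le> real (D ^ m)" by (rule of_nat_mono)
    then show "of_int (int p0 * int q) \<le> real D ^ m" by simp
  qed (use B0 in simp)
  finally show ?thesis by (simp add: split)
qed

text \<open>Expanding the power gives one term per index function g. If some index carries a prime
  that occurs only once, the term is bounded independently of N. Otherwise every prime occurs at
  least twice, so at most r different primes occur, and the count of \<open>card_few_values\<close>
  is used with the trivial bound.\<close>

theorem moment_bound:
  fixes Y :: "nat \<Rightarrow> int \<Rightarrow> real"
  assumes P: "finite P" "P \<noteq> {}" and prime: "\<And>p. p \<in> P \<Longrightarrow> prime p" and D: "\<And>p. p \<in> P \<Longrightarrow> p \<le> D"
    and Y: "\<And>p x. p \<in> P \<Longrightarrow> Y p (x mod int p) = Y p x" "\<And>p x. p \<in> P \<Longrightarrow> \<bar>Y p x\<bar> \<le> B"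
      "\<And>p. p \<in> P \<Longrightarrow> (\<Sum>x\<in>{0..<int p}. Y p x) = 0"
  shows "(\<Sum>x\<in>{c..<c + int N}. (\<Sum>p\<in>P. Y p x) ^ (2 * r))
    \<le> B ^ (2 * r) * (real N * (real (card P) ^ r * real r ^ (2 * r)) + real (card P) ^ (2 * r) * real D ^ (2 * r))"
proof -
  define m where "m = 2 * r"
  define PG where "PG = PiE {..<m} (\<lambda>_. P)"
  define few where "few = {g \<in> PG. card (g ` {..<m}) \<le> r}"
  obtain p where "p \<in> P" using P(2) by blast
  then have B0: "0 \<le> B" using Y(2)[of p 0] by linarith
  have finPG: "finite PG" unfolding PG_def using P(1) by (intro finite_PiE) auto
  have "(\<Sum>x\<in>{c..<c + int N}. (\<Sum>p\<in>P. Y p x) ^ m) = (\<Sum>x\<in>{c..<c + int N}. \<Sum>g\<in>PG. \<Prod>i<m. Y (g i) x)"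
  proof (rule sum.cong[OF refl])
    fix x
    have "(\<Sum>p\<in>P. Y p x) ^ m = (\<Prod>i<m. \<Sum>p\<in>P. Y p x)" by simp
    also have "\<dots> = (\<Sum>g\<in>PG. \<Prod>i<m. Y (g i) x)" unfolding PG_def using P(1) by (intro prod_sum_PiE) auto
    finally show "(\<Sum>p\<in>P. Y p x) ^ m = (\<Sum>g\<in>PG. \<Prod>i<m. Y (g i) x)" .
  qed
  also have "\<dots> = (\<Sum>g\<in>PG. \<Sum>x\<in>{c..<c + int N}. \<Prod>i<m. Y (g i) x)" by (rule sum.swap)
  also have "\<dots> \<le> (\<Sum>g\<in>PG. (if g \<in> few then real N * B ^ m else 0) + real D ^ m * B ^ m)"
  proof (rule sum_mono)
    fix g assume g: "g \<in> PG"
    have gP: "g i \<in> P" if "i < m" for i using g that by (auto simp: PG_def PiE_iff)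
    show "(\<Sum>x\<in>{c..<c + int N}. \<Prod>i<m. Y (g i) x) \<le> (if g \<in> few then real N * B ^ m else 0) + real D ^ m * B ^ m"
    proof (cases "g \<in> few")
      case True
      have "(\<Sum>x\<in>{c..<c + int N}. \<Prod>i<m. Y (g i) x) \<le> (\<Sum>x\<in>{c..<c + int N}. B ^ m)"
      proof (rule sum_mono)
        fix x
        have "\<bar>\<Prod>i<m. Y (g i) x\<bar> \<le> (\<Prod>i<m. B)" unfolding abs_prod using Y(2) gP by (intro prod_mono) auto
        then show "(\<Prod>i<m. Y (g i) x) \<le> B ^ m" by simp
      qed
      then show ?thesis using True B0 by (simp add: add_increasing2)
    next
      case False
      have "\<exists>i0<m. \<forall>i<m. i \<noteq> i0 \<longrightarrow> g i \<noteq> g i0"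
      proof (rule ccontr)
        assume contra: "\<not> ?thesis"
        have two: "2 \<le> card {i \<in> {..<m}. g i = y}" if y: "y \<in> g ` {..<m}" for y
        proof -
          obtain i0 where i0: "i0 < m" "y = g i0" using y by auto
          then obtain i where i: "i < m" "i \<noteq> i0" "g i = g i0" using contra by blast
          have "card {i0, i} \<le> card {i \<in> {..<m}. g i = y}"
            using i0 i by (intro card_mono) auto
          then show ?thesis using i by simp
        qed
        have "2 * card (g ` {..<m}) = (\<Sum>y\<in>g ` {..<m}. 2)" by simp
        also have "\<dots> \<le> (\<Sum>y\<in>g ` {..<m}. card {i \<in> {..<m}. g i = y})" using two by (rule sum_mono)
        also have "\<dots> = m" using sum.image_gen[of "{..<m}" "\<lambda>_. 1 :: nat" g] by simp
        finally have "card (g ` {..<m}) \<le> r" by (simp add: m_def)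
        with False g show False by (simp add: few_def)
      qed
      then obtain i0 where "i0 < m" "\<And>i. i < m \<Longrightarrow> i \<noteq> i0 \<Longrightarrow> g i \<noteq> g i0" by blast
      then have "\<bar>\<Sum>x\<in>{c..<c + int N}. \<Prod>i<m. Y (g i) x\<bar> \<le> real D ^ m * B ^ m"
        using g unfolding PG_def by (intro sum_prod_single_value[OF prime D Y]) auto
      then show ?thesis using False by simp
    qed
  qed
  also have "\<dots> = real (card few) * (real N * B ^ m) + real (card PG) * (real D ^ m * B ^ m)"
  proof -
    have "PG \<inter> few = few" by (auto simp: few_def)
    moreover have "(\<Sum>g\<in>PG. if g \<in> few then real N * B ^ m else 0) = (\<Sum>g\<in>PG \<inter> few. real N * B ^ m)"
      using finPG by (rule sum.inter_restrict[symmetric])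
    ultimately show ?thesis by (simp add: sum.distrib)
  qed
  also have "\<dots> \<le> real (card P ^ r * r ^ m) * (real N * B ^ m) + real (card P ^ m) * (real D ^ m * B ^ m)"
  proof (rule add_mono)
    have "card few \<le> card P ^ r * r ^ m" unfolding few_def PG_def using P by (rule card_few_values)
    then show "real (card few) * (real N * B ^ m) \<le> real (card P ^ r * r ^ m) * (real N * B ^ m)"
      using B0 by (intro mult_right_mono of_nat_mono) auto
    have "card PG = card P ^ m" by (simp add: PG_def card_PiE)
    then show "real (card PG) * (real D ^ m * B ^ m) \<le> real (card P ^ m) * (real D ^ m * B ^ m)" by simp
  qed
  finally show ?thesis by (simp add: m_def algebra_simps)
qed

definition divisor_deviation :: "(nat \<Rightarrow> nat \<Rightarrow> real) \<Rightarrow> nat \<Rightarrow> nat \<Rightarrow> int \<Rightarrow> real" where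
  "divisor_deviation c J p x = (\<Sum>j\<in>{1..J}. c p j * (real p * of_bool (int p dvd x + int j) - 1)) / real J"

lemma divisor_deviation_periodic: "divisor_deviation c J p (x mod int p) = divisor_deviation c J p x"
proof -
  have "(int p dvd x mod int p + int j) = (int p dvd x + int j)" for j
    unfolding dvd_eq_mod_eq_0 by (simp only: mod_add_left_eq)
  then show ?thesis by (simp add: divisor_deviation_def)
qed

text \<open>Single terms can be about as large as p, but among J consecutive integers at most J / p
  + 1 are divisible by p. Averaging over j thus gives the moment method bounded variables, as p
  \<le> J.\<close>

lemma divisor_deviation_bound:
  assumes c: "\<And>j. \<bar>c p j\<bar> \<le> 1" and p: "p > 0" "p \<le> J"
  shows "\<bar>divisor_deviation c J p x\<bar> \<le> 3"
proof -
  define a where "a y = (of_bool (int p dvd x + y) :: real)" for y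
  define g where "g = J div p + 1"
  have per: "a (y mod int p) = a y" for y
    unfolding a_def dvd_eq_mod_eq_0 by (simp only: mod_add_right_eq)
  have "(\<Sum>j\<in>{1..J}. of_bool (int p dvd x + int j)) = (\<Sum>y\<in>int ` {1..J}. a y)"
    by (subst sum.reindex) (auto simp: a_def)
  also have "\<dots> \<le> (\<Sum>y\<in>{1..<1 + int g * int p}. a y)"
  proof (rule sum_mono2)
    have "J < g * p" unfolding g_def using p(1) dividend_less_div_times[of p J] by (simp add: algebra_simps)
    then have "int J < int g * int p" by (simp flip: of_nat_mult)
    then show "int ` {1..J} \<subseteq> {1..<1 + int g * int p}" by auto
  qed (auto simp: a_def)
  also have "\<dots> = real g * (\<Sum>y\<in>{0..<int p}. a y)"
    using p per by (intro sum_period_blocks) auto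
  also have "(\<Sum>y\<in>{0..<int p}. a y) = 1" unfolding a_def using p by (intro sum_dvd_residues) auto
  finally have count: "(\<Sum>j\<in>{1..J}. of_bool (int p dvd x + int j)) \<le> real g" by simp
  have "\<bar>\<Sum>j\<in>{1..J}. c p j * (real p * of_bool (int p dvd x + int j) - 1)\<bar>
      \<le> (\<Sum>j\<in>{1..J}. \<bar>c p j * (real p * of_bool (int p dvd x + int j) - 1)\<bar>)" by (rule sum_abs)
  also have "\<dots> \<le> (\<Sum>j\<in>{1..J}. real p * of_bool (int p dvd x + int j) + 1)"
  proof (rule sum_mono)
    fix j
    have "\<bar>c p j\<bar> * \<bar>real p * of_bool (int p dvd x + int j) - 1\<bar> \<le> 1 * \<bar>real p * of_bool (int p dvd x + int j) - 1\<bar>"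
      using c by (intro mult_right_mono) auto
    then show "\<bar>c p j * (real p * of_bool (int p dvd x + int j) - 1)\<bar> \<le> real p * of_bool (int p dvd x + int j) + 1"
      by (auto simp: abs_mult split: if_splits)
  qed
  also have "\<dots> = real p * (\<Sum>j\<in>{1..J}. of_bool (int p dvd x + int j)) + real J"
    by (simp add: sum.distrib sum_distrib_left)
  also have "\<dots> \<le> real p * real g + real J" using count by (intro add_right_mono mult_left_mono) auto
  also have "\<dots> \<le> 3 * real J"
  proof -
    have "p * g \<le> J + p" unfolding g_def by (simp add: algebra_simps)
    then have "real p * real g \<le> real J + real p" using of_nat_mono[of "p * g" "J + p", where 'a = real] by simp
    then show ?thesis using p by simp
  qed
  finally show ?thesis using p by (simp add: divisor_deviation_def abs_divide divide_le_eq)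
qed

lemma divisor_deviation_mean:
  assumes "p > 0"
  shows "(\<Sum>x\<in>{0..<int p}. divisor_deviation c J p x) = 0"
proof -
  have "(\<Sum>x\<in>{0..<int p}. divisor_deviation c J p x)
      = (\<Sum>j\<in>{1..J}. \<Sum>x\<in>{0..<int p}. c p j * (real p * of_bool (int p dvd int j + x) - 1)) / real J"
    unfolding divisor_deviation_def sum_divide_distrib[symmetric]
    by (subst sum.swap) (simp add: add.commute)
  also have "\<dots> = (\<Sum>j\<in>{1..J}. c p j * (real p * (\<Sum>x\<in>{0..<int p}. of_bool (int p dvd int j + x)) - real p)) / real J"
    using assms by (simp only: sum_distrib_left[symmetric] sum_subtractf) simp
  also have "\<dots> = 0" using assms by (simp only: sum_dvd_residues of_nat_0_less_iff) simp
  finally show ?thesis .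
qed

text \<open>Union bound over the possible coefficient systems (one per sign pattern), through a high moment.\<close>

theorem deviation_concentration:
  fixes c :: "'v \<Rightarrow> nat \<Rightarrow> nat \<Rightarrow> real"
  assumes P: "finite P" "P \<noteq> {}" "\<And>p. p \<in> P \<Longrightarrow> prime p" "\<And>p. p \<in> P \<Longrightarrow> p \<le> D" and DJ: "D \<le> J"
    and V: "finite V" "\<And>v p j. v \<in> V \<Longrightarrow> \<bar>c v p j\<bar> \<le> 1"
    and v: "\<And>x. x \<in> {a..<a + int N} \<Longrightarrow> v x \<in> V" and r: "r > 0" and \<epsilon>: "\<epsilon> > 0"
  shows "(\<Sum>x\<in>{a..<a + int N}. \<bar>\<Sum>p\<in>P. divisor_deviation (c (v x)) J p x\<bar>)
     \<le> \<epsilon> * real (card P) * real N * (1 + (9 / \<epsilon>\<^sup>2) ^ r * real (card V) * (((real r)\<^sup>2 / real (card P)) ^ r + real D ^ (2 * r) / real N))"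
proof (cases "N = 0")
  case False
  define Z where "Z u x = (\<Sum>p\<in>P. divisor_deviation (c u) J p x)" for u x
  define n where "n = real (card P)"
  have n: "n > 0" unfolding n_def using P by (simp add: card_gt_0_iff)
  define M where "M = 3 ^ (2 * r) * (real N * (n ^ r * real r ^ (2 * r)) + n ^ (2 * r) * real D ^ (2 * r))"
  have mom: "(\<Sum>x\<in>{a..<a + int N}. Z u x ^ (2 * r)) \<le> M" if u: "u \<in> V" for u
    unfolding Z_def M_def n_def
  proof (rule moment_bound[OF P])
    fix p x assume p: "p \<in> P"
    show "divisor_deviation (c u) J p (x mod int p) = divisor_deviation (c u) J p x" by (rule divisor_deviation_periodic)
    show "\<bar>divisor_deviation (c u) J p x\<bar> \<le> 3"
      using p P(3,4) DJ V(2)[OF u] by (intro divisor_deviation_bound) (auto simp: prime_gt_0_nat intro: order_trans)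
    show "(\<Sum>x\<in>{0..<int p}. divisor_deviation (c u) J p x) = 0"
      using p P(3) by (intro divisor_deviation_mean) (simp add: prime_gt_0_nat)
  qed
  define t where "t = \<epsilon> * n"
  have t: "t > 0" using \<epsilon> n by (simp add: t_def)
  \<comment> \<open>Avoids a separate treatment of exceptional x: values up to t are kept, and
    larger ones are dominated by the even moment.\<close>
  have pt: "\<bar>z\<bar> \<le> t + t * (z / t) ^ (2 * r)" for z
  proof (cases "\<bar>z\<bar> \<le> t")
    case True
    have "0 \<le> t * (z / t) ^ (2 * r)" using t by (simp add: power_mult)
    then show ?thesis using True by linarith
  next
    case False
    then have "1 \<le> \<bar>z\<bar> / t" using t by simp
    then have "(\<bar>z\<bar> / t) ^ 1 \<le> (\<bar>z\<bar> / t) ^ (2 * r)" using r by (intro power_increasing) auto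
    then have "\<bar>z\<bar> / t \<le> (z / t) ^ (2 * r)" by (simp add: power_mult power_divide)
    then have "t * (\<bar>z\<bar> / t) \<le> t * (z / t) ^ (2 * r)" using t by (intro mult_left_mono) auto
    moreover have "t * (\<bar>z\<bar> / t) = \<bar>z\<bar>" using t by simp
    ultimately show ?thesis using t by linarith
  qed
  have "(\<Sum>x\<in>{a..<a + int N}. \<bar>Z (v x) x\<bar>) \<le> (\<Sum>x\<in>{a..<a + int N}. t + t / t ^ (2 * r) * (\<Sum>u\<in>V. Z u x ^ (2 * r)))"
  proof (rule sum_mono)
    fix x assume x: "x \<in> {a..<a + int N}"
    \<comment> \<open>The union bound: the coefficient system v x varies with x, but even powers are
      nonnegative, so the sum over all systems dominates.\<close>
    have "Z (v x) x ^ (2 * r) \<le> (\<Sum>u\<in>V. Z u x ^ (2 * r))"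
      using V(1) v[OF x] by (intro member_le_sum) (auto simp: power_mult)
    then have "t / t ^ (2 * r) * Z (v x) x ^ (2 * r) \<le> t / t ^ (2 * r) * (\<Sum>u\<in>V. Z u x ^ (2 * r))"
      using t by (intro mult_left_mono) auto
    then show "\<bar>Z (v x) x\<bar> \<le> t + t / t ^ (2 * r) * (\<Sum>u\<in>V. Z u x ^ (2 * r))"
      using pt[of "Z (v x) x"] by (simp add: power_divide)
  qed
  also have "\<dots> = real N * t + t / t ^ (2 * r) * (\<Sum>u\<in>V. \<Sum>x\<in>{a..<a + int N}. Z u x ^ (2 * r))"
  proof -
    have "(\<Sum>x\<in>{a..<a + int N}. \<Sum>u\<in>V. Z u x ^ (2 * r)) = (\<Sum>u\<in>V. \<Sum>x\<in>{a..<a + int N}. Z u x ^ (2 * r))"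
      by (rule sum.swap)
    then show ?thesis by (simp only: sum.distrib sum_distrib_left[symmetric]) simp
  qed
  also have "\<dots> \<le> real N * t + t / t ^ (2 * r) * (\<Sum>u\<in>V. M)"
    using mom t by (intro add_left_mono mult_left_mono sum_mono) auto
  also have "\<dots> = \<epsilon> * n * real N * (1 + real (card V) * (M / (t ^ (2 * r) * real N)))"
    using False t by (simp add: t_def field_simps)
  also have "M / (t ^ (2 * r) * real N) = (9 / \<epsilon>\<^sup>2) ^ r * (((real r)\<^sup>2 / n) ^ r + real D ^ (2 * r) / real N)"
  proof -
    have "M / (t ^ (2 * r) * real N) = (9 ^ r / (\<epsilon>\<^sup>2) ^ r) * ((real N * (n ^ r * ((real r)\<^sup>2) ^ r) + (n ^ r * n ^ r) * real D ^ (2 * r)) / (n ^ r * n ^ r * real N))"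
      unfolding M_def t_def by (simp add: power_mult power_mult_distrib power2_eq_square)
    also have "(real N * (n ^ r * ((real r)\<^sup>2) ^ r) + (n ^ r * n ^ r) * real D ^ (2 * r)) / (n ^ r * n ^ r * real N)
        = ((real r)\<^sup>2) ^ r / n ^ r + real D ^ (2 * r) / real N"
      using n False by (simp add: field_simps)
    finally show ?thesis by (simp add: power_divide)
  qed
  finally show ?thesis by (simp add: Z_def n_def mult_ac)
qed simp

section \<open>From the uniformity hypothesis to single windows\<close>

text \<open>
  The moment \<open>2r\<close> is taken with \<open>k^(4r)\<close> just below \<open>\<Psi>^(20/\<kappa>)\<close>. Here \<open>\<Psi> \<le> exp (k^(1/2 - \<kappa>))\<close> is used: it gives
  \<open>r\<^sup>2 \<le> k^(1 - 2\<kappa>)\<close>, which is smaller than the number of primes by a power of \<open>k\<close>.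
\<close>

lemma moment_parameter:
  fixes \<kappa> C C2 \<theta> :: real
  assumes \<kappa>: "0 < \<kappa>" "\<kappa> < 1 / 2" and C: "C > 0" "C2 > 0" and \<theta>: "\<theta> > 0"
  shows "\<forall>\<^sub>F k :: nat in sequentially. \<forall>\<Psi>. real k \<le> \<Psi> \<and> \<Psi> \<le> exp (real k powr (1 / 2 - \<kappa>)) \<longrightarrow>
    (\<exists>r>0. \<forall>n N. n \<ge> real k / (C2 * ln (real k)) \<longrightarrow> N \<ge> \<Psi> powr (20 / \<kappa>) / 2 \<longrightarrow>
       C ^ r * \<Psi> * (((real r)\<^sup>2 / n) ^ r + real k ^ (2 * r) / N) \<le> \<theta>)"
proof -
  have "\<forall>\<^sub>F x::real in at_top. x \<ge> C \<and> x \<ge> 3 \<and> 1 \<le> \<kappa> / 5 * ln x \<and>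
      C * (x powr (1 - 2 * \<kappa>) * (C2 * ln x / x)) \<le> x powr (- \<kappa>) \<and> exp (- 3 * ln x) + 2 * exp (- ln x) \<le> \<theta>"
  proof (intro eventually_conj)
    show "\<forall>\<^sub>F x::real in at_top. x \<ge> C" by (rule eventually_ge_at_top)
    show "\<forall>\<^sub>F x::real in at_top. x \<ge> 3" by (rule eventually_ge_at_top)
    show "\<forall>\<^sub>F x::real in at_top. 1 \<le> \<kappa> / 5 * ln x" using \<kappa> by real_asymp
    show "\<forall>\<^sub>F x::real in at_top. C * (x powr (1 - 2 * \<kappa>) * (C2 * ln x / x)) \<le> x powr (- \<kappa>)"
    proof -
      have "((\<lambda>x::real. ln x / x powr \<kappa>) \<longlongrightarrow> 0) at_top" using \<kappa> by real_asymp
      then have "\<forall>\<^sub>F x::real in at_top. ln x / x powr \<kappa> < 1 / (C * C2)"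
        using C by (intro order_tendstoD(2)[where y = 0]) auto
      then show ?thesis using eventually_gt_at_top[of 1]
      proof eventually_elim
        case (elim x)
        have "C * (x powr (1 - 2 * \<kappa>) * (C2 * ln x / x)) = C * C2 * (ln x / x powr \<kappa>) * x powr (- \<kappa>)"
        proof -
          have "x powr (1 - 2 * \<kappa>) / x = x powr (1 - 2 * \<kappa> - 1)"
            unfolding powr_diff[of x "1 - 2 * \<kappa>" 1] using elim by simp
          also have "1 - 2 * \<kappa> - 1 = - \<kappa> - \<kappa>" by simp
          also have "x powr (- \<kappa> - \<kappa>) = x powr (- \<kappa>) / x powr \<kappa>" by (rule powr_diff)
          finally have eq: "x powr (1 - 2 * \<kappa>) / x = x powr (- \<kappa>) / x powr \<kappa>" .
          have "C * (x powr (1 - 2 * \<kappa>) * (C2 * ln x / x)) = C * C2 * ln x * (x powr (1 - 2 * \<kappa>) / x)" by simp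
          then show ?thesis unfolding eq by simp
        qed
        also have "\<dots> \<le> 1 * x powr (- \<kappa>)"
          using elim C by (intro mult_right_mono) (auto simp: field_simps)
        finally show ?case by simp
      qed
    qed
    have "((\<lambda>x::real. exp (- 3 * ln x) + 2 * exp (- ln x)) \<longlongrightarrow> 0) at_top" by real_asymp
    then have "\<forall>\<^sub>F x::real in at_top. exp (- 3 * ln x) + 2 * exp (- ln x) < \<theta>"
      using \<theta> by (rule order_tendstoD(2))
    then show "\<forall>\<^sub>F x::real in at_top. exp (- 3 * ln x) + 2 * exp (- ln x) \<le> \<theta>"
      by eventually_elim simp
  qed
  then have "\<forall>\<^sub>F k in sequentially. real k \<ge> C \<and> real k \<ge> 3 \<and> 1 \<le> \<kappa> / 5 * ln (real k) \<and>
      C * (real k powr (1 - 2 * \<kappa>) * (C2 * ln (real k) / real k)) \<le> real k powr (- \<kappa>) \<and>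
      exp (- 3 * ln (real k)) + 2 * exp (- ln (real k)) \<le> \<theta>"
    by (rule eventually_compose_filterlim) (rule filterlim_real_sequentially)
  then show ?thesis
  proof eventually_elim
    case (elim k)
    define x where "x = real k"
    have x: "x \<ge> C" "x \<ge> 3" "1 \<le> \<kappa> / 5 * ln x"
      "C * (x powr (1 - 2 * \<kappa>) * (C2 * ln x / x)) \<le> x powr (- \<kappa>)" "exp (- 3 * ln x) + 2 * exp (- ln x) \<le> \<theta>"
      using elim by (auto simp: x_def)
    have lnx: "ln x > 0" using x(2) by simp
    show ?case
    proof (intro allI impI, elim conjE)
      fix \<Psi> assume "real k \<le> \<Psi>" "\<Psi> \<le> exp (real k powr (1 / 2 - \<kappa>))"
      then have \<Psi>: "x \<le> \<Psi>" "\<Psi> \<le> exp (x powr (1 / 2 - \<kappa>))" by (auto simp: x_def)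
      have \<Psi>0: "\<Psi> > 0" using \<Psi>(1) x(2) by linarith
      define y where "y = ln \<Psi>"
      have y: "ln x \<le> y" "y \<le> x powr (1 / 2 - \<kappa>)"
      proof -
        show "ln x \<le> y" unfolding y_def using \<Psi>(1) \<Psi>0 x(2) by (subst ln_le_cancel_iff) auto
        have "ln \<Psi> \<le> ln (exp (x powr (1 / 2 - \<kappa>)))" using \<Psi>(2) \<Psi>0 by (subst ln_le_cancel_iff) auto
        then show "y \<le> x powr (1 / 2 - \<kappa>)" by (simp add: y_def)
      qed
      have \<Psi>y: "\<Psi> = exp y" using \<Psi>0 by (simp add: y_def)
      \<comment> \<open>The solution of x^(4a) = \<Psi>^(20 / \<kappa>).\<close>
      define a where "a = 5 * y / (\<kappa> * ln x)"
      define r where "r = nat \<lfloor>a\<rfloor>"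
      have a10: "a \<ge> 10"
      proof -
        have "10 * (\<kappa> * ln x) \<le> 5 * ln x" using \<kappa> lnx mult_right_mono[of "10 * \<kappa>" 5 "ln x"] by simp
        also have "\<dots> \<le> 5 * y" using y by simp
        finally show ?thesis unfolding a_def using \<kappa> lnx by (simp add: pos_le_divide_eq)
      qed
      have r: "real r \<le> a" "a - 1 < real r" "r > 0"
      proof -
        have "real r = of_int \<lfloor>a\<rfloor>" unfolding r_def using a10 by simp
        then show "real r \<le> a" "a - 1 < real r" by linarith+
        then show "r > 0" using a10 by (intro gr0I) simp
      qed
      have y0: "y > 0" using y lnx by linarith
      have a_eq: "a * ln x = 5 * y / \<kappa>" unfolding a_def using lnx by simp
      have a_y: "a \<le> y"
      proof -
        have "5 * y \<le> (\<kappa> * ln x) * y" using x(3) y0 mult_right_mono[of 5 "\<kappa> * ln x" y] by simp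
        then show ?thesis unfolding a_def using \<kappa> lnx by (simp add: divide_le_eq mult.commute)
      qed
      show "\<exists>r>0. \<forall>n N. n \<ge> real k / (C2 * ln (real k)) \<longrightarrow> N \<ge> \<Psi> powr (20 / \<kappa>) / 2 \<longrightarrow>
         C ^ r * \<Psi> * (((real r)\<^sup>2 / n) ^ r + real k ^ (2 * r) / N) \<le> \<theta>"
      proof (intro exI[of _ r] conjI allI impI r(3))
        fix n N assume "n \<ge> real k / (C2 * ln (real k))" "N \<ge> \<Psi> powr (20 / \<kappa>) / 2"
        then have n: "n \<ge> x / (C2 * ln x)" and N: "N \<ge> exp (20 / \<kappa> * y) / 2"
          using \<Psi>0 by (auto simp: x_def powr_def y_def)
        have xp: "x / (C2 * ln x) > 0" using x(2) C lnx by simp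
        then have n0: "n > 0" using n by linarith
        have "(real r)\<^sup>2 \<le> (x powr (1 / 2 - \<kappa>))\<^sup>2" using r(1) a_y y(2) by (intro power_mono) auto
        also have "\<dots> = x powr (1 - 2 * \<kappa>)" using x(2) by (simp add: power2_eq_square flip: powr_add)
        finally have r2: "(real r)\<^sup>2 \<le> x powr (1 - 2 * \<kappa>)" .
        have "(real r)\<^sup>2 / n \<le> x powr (1 - 2 * \<kappa>) / (x / (C2 * ln x))"
          using r2 n xp by (intro frac_le) auto
        also have "\<dots> = x powr (1 - 2 * \<kappa>) * (C2 * ln x / x)" by simp
        finally have "C * ((real r)\<^sup>2 / n) \<le> C * (x powr (1 - 2 * \<kappa>) * (C2 * ln x / x))"
          using C by (intro mult_left_mono) auto
        also have "\<dots> \<le> x powr (- \<kappa>)" by (rule x(4))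
        finally have "(C * ((real r)\<^sup>2 / n)) ^ r \<le> (x powr (- \<kappa>)) ^ r"
          using C n0 by (intro power_mono) auto
        also have "(x powr (- \<kappa>)) ^ r = exp (- (\<kappa> * real r * ln x))"
          using x(2) by (simp add: powr_def flip: exp_of_nat_mult)
        finally have "\<Psi> * (C * ((real r)\<^sup>2 / n)) ^ r \<le> exp y * exp (- (\<kappa> * real r * ln x))"
          unfolding \<Psi>y by (intro mult_left_mono) auto
        also have "\<dots> = exp (y - \<kappa> * real r * ln x)" by (simp flip: exp_add)
        \<comment> \<open>Each of the r factors saves x^\<kappa>. As r > a - 1, the total saving is
          at least \<Psi>^5 x^(-\<kappa>), and \<Psi> \<ge> x.\<close>
        also have "\<dots> \<le> exp (- 3 * ln x)"
        proof -
          have "(\<kappa> * ln x) * (a - 1) \<le> (\<kappa> * ln x) * real r" using r(2) \<kappa> lnx by (intro mult_left_mono) auto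
          moreover have "(\<kappa> * ln x) * (a - 1) = 5 * y - \<kappa> * ln x"
          proof -
            have "(\<kappa> * ln x) * a = 5 * y" unfolding a_def using \<kappa> lnx by simp
            then show ?thesis by (simp add: right_diff_distrib)
          qed
          moreover have "\<kappa> * ln x \<le> 1 * ln x" using \<kappa> lnx by (intro mult_right_mono) auto
          moreover have "\<kappa> * real r * ln x = (\<kappa> * ln x) * real r" by simp
          ultimately have "y - \<kappa> * real r * ln x \<le> - 3 * ln x" using y(1) by linarith
          then show ?thesis by simp
        qed
        finally have t1: "\<Psi> * (C * ((real r)\<^sup>2 / n)) ^ r \<le> exp (- 3 * ln x)" .
        \<comment> \<open>C \<le> x lets C^r be absorbed; the resulting \<Psi>^(15 / \<kappa>) is
          still well below N.\<close>
        have "C ^ r * x ^ (2 * r) \<le> x ^ r * x ^ (2 * r)" using C x by (intro mult_right_mono power_mono) auto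
        also have "\<dots> = x ^ (3 * r)" by (simp flip: power_add)
        also have "\<dots> = exp (3 * real r * ln x)"
        proof -
          have "x ^ (3 * r) = exp (ln x) ^ (3 * r)" using x(2) by simp
          also have "\<dots> = exp (real (3 * r) * ln x)" by (rule exp_of_nat_mult[symmetric])
          finally show ?thesis by simp
        qed
        also have "\<dots> \<le> exp (15 * y / \<kappa>)"
        proof -
          have "3 * real r * ln x \<le> 3 * a * ln x" using r(1) lnx by (intro mult_right_mono) auto
          also have "\<dots> = 15 * y / \<kappa>" using a_eq by simp
          finally show ?thesis by simp
        qed
        finally have "C ^ r * x ^ (2 * r) \<le> exp (15 * y / \<kappa>)" .
        then have "\<Psi> * (C ^ r * x ^ (2 * r)) / N \<le> exp y * exp (15 * y / \<kappa>) / (exp (20 / \<kappa> * y) / 2)"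
          unfolding \<Psi>y using N C x by (intro frac_le mult_left_mono) auto
        also have "\<dots> = 2 * exp (y + 15 * y / \<kappa> - 20 / \<kappa> * y)" by (simp only: exp_add exp_diff) simp
        also have "\<dots> \<le> 2 * exp (- ln x)"
        proof -
          have "2 * y \<le> 5 * y / \<kappa>" using \<kappa> y0 by (simp add: pos_le_divide_eq)
          then have "y + 15 * y / \<kappa> - 20 / \<kappa> * y \<le> - y" by (simp add: field_simps)
          then show ?thesis using y by simp
        qed
        finally have t2: "\<Psi> * (C ^ r * x ^ (2 * r)) / N \<le> 2 * exp (- ln x)" .
        have "C ^ r * \<Psi> * (((real r)\<^sup>2 / n) ^ r + real k ^ (2 * r) / N)
            = \<Psi> * (C * ((real r)\<^sup>2 / n)) ^ r + \<Psi> * (C ^ r * x ^ (2 * r)) / N"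
          unfolding x_def power_mult_distrib by (simp add: distrib_left mult_ac)
        then show "C ^ r * \<Psi> * (((real r)\<^sup>2 / n) ^ r + real k ^ (2 * r) / N) \<le> \<theta>"
          using t1 t2 x(5) by linarith
      qed
    qed
  qed
qed

section \<open>From the integral to sums over integer windows\<close>

lemma step_function_has_integral:
  fixes \<phi> :: "real \<Rightarrow> real" and G :: "int \<Rightarrow> real"
  assumes "\<And>n x. of_int n < x \<Longrightarrow> x < of_int n + 1 \<Longrightarrow> \<phi> x = G n" and "a \<le> b"
  shows "(\<phi> has_integral (\<Sum>n\<in>{a..<b}. G n)) {of_int a..of_int b}"
  using assms(2)
proof (induction b rule: int_ge_induct)
  case base
  show ?case using has_integral_refl(2)[of \<phi> "of_int a"] by simp
next
  case (step b)
  have "((\<lambda>x. G b) has_integral G b) {real_of_int b..real_of_int b + 1}"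
    using has_integral_const_real[of "G b" "of_int b" "of_int b + 1"] by simp
  then have 1: "(\<phi> has_integral G b) {real_of_int b..real_of_int b + 1}"
    by (rule has_integral_spike_finite[of "{real_of_int b, real_of_int b + 1}", rotated 2]) (use assms(1) in auto)
  have "(\<phi> has_integral ((\<Sum>n\<in>{a..<b}. G n) + G b)) {of_int a..of_int b + 1}"
    using step by (intro has_integral_combine[OF _ _ step.IH 1]) auto
  moreover have "{a..<b + 1} = insert b {a..<b}" using step by auto
  ultimately show ?case by (simp add: add.commute)
qed

text \<open>Integrability on {u..v} has to be established first, since \<open>integral\<close> is 0
  on functions that are not integrable. It is inherited from the integer hull of the interval, on
  which \<phi> is a step function up to finitely many points.\<close>

lemma sum_le_step_integral:
  fixes \<phi> :: "real \<Rightarrow> real" and G :: "int \<Rightarrow> real"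
  assumes \<phi>: "\<And>n x. of_int n < x \<Longrightarrow> x < of_int n + 1 \<Longrightarrow> \<phi> x = G n" and nonneg: "\<And>x. 0 \<le> \<phi> x"
    and ab: "a \<le> b" "u \<le> of_int a" "of_int b \<le> v"
  shows "(\<Sum>n\<in>{a..<b}. G n) \<le> integral {u..v} \<phi>"
proof -
  have "\<lfloor>u\<rfloor> \<le> \<lceil>v\<rceil>" using ab by (meson floor_le_ceiling floor_mono ceiling_mono le_of_int_ceiling of_int_le_iff of_int_floor_le order_trans)
  then have "(\<phi> has_integral (\<Sum>n\<in>{\<lfloor>u\<rfloor>..<\<lceil>v\<rceil>}. G n)) {of_int \<lfloor>u\<rfloor>..of_int \<lceil>v\<rceil>}"
    using step_function_has_integral[of \<phi> G "\<lfloor>u\<rfloor>" "\<lceil>v\<rceil>"] \<phi> by blast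
  then have "\<phi> integrable_on {of_int \<lfloor>u\<rfloor>..of_int \<lceil>v\<rceil>}" by (rule has_integral_integrable)
  then have uv: "\<phi> integrable_on {u..v}"
    by (rule integrable_on_subinterval) auto
  have I: "(\<phi> has_integral (\<Sum>n\<in>{a..<b}. G n)) {of_int a..of_int b}"
    using step_function_has_integral[of \<phi> G a b] \<phi> ab(1) by blast
  have "(\<Sum>n\<in>{a..<b}. G n) = integral {of_int a..of_int b} \<phi>" using I by (simp add: integral_unique)
  also have "\<dots> \<le> integral {u..v} \<phi>"
    using ab uv I nonneg by (intro integral_subset_le) (auto intro: has_integral_integrable)
  finally show ?thesis .
qed

text \<open>Translated so that the support always lies in {1..k}, as the von Neumann theorems
  require.\<close>

definition liouville_window :: "nat \<Rightarrow> int \<Rightarrow> int \<Rightarrow> real" where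
  "liouville_window k x y = (if 1 \<le> y \<and> y \<le> int k then real_of_int (liouville (x + y)) else 0)"

lemma abs_liouville_le: "\<bar>liouville n\<bar> \<le> 1"
  by (simp add: liouville_def power_abs)

lemma abs_liouville_window_le: "\<bar>liouville_window k x y\<bar> \<le> 1"
  using abs_liouville_le[of "x + y"] by (simp add: liouville_window_def flip: of_int_abs)

lemma gowers_sum_translate: "gowers_sum d (\<lambda>n. f (n + c)) = gowers_sum d f"
proof -
  let ?F = "\<lambda>p. \<Prod>\<omega>\<in>PiE {1..d} (\<lambda>_. {0, 1::nat}). (cnj ^^ (\<Sum>i=1..d. \<omega> i)) (f (fst p + (\<Sum>i=1..d. int (\<omega> i) * snd p i)))"
  have bij: "bij_betw (\<lambda>p. (fst p + c, snd p)) (UNIV \<times> PiE {1..d} (\<lambda>_. UNIV :: int set)) (UNIV \<times> PiE {1..d} (\<lambda>_. UNIV))"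
    by (rule bij_betwI[of _ _ _ "\<lambda>p. (fst p - c, snd p)"]) auto
  have "gowers_sum d (\<lambda>n. f (n + c)) = (\<Sum>\<^sub>\<infinity>p\<in>UNIV \<times> PiE {1..d} (\<lambda>_. UNIV). ?F (fst p + c, snd p))"
    unfolding gowers_sum_def by (simp add: case_prod_unfold add_ac)
  also have "\<dots> = (\<Sum>\<^sub>\<infinity>p\<in>UNIV \<times> PiE {1..d} (\<lambda>_. UNIV). ?F p)"
    using bij by (rule infsum_reindex_bij_betw)
  also have "\<dots> = gowers_sum d f" unfolding gowers_sum_def by (simp add: case_prod_unfold)
  finally show ?thesis .
qed

lemma gowers_norm_window:
  assumes "\<And>y. \<not> (1 \<le> y \<and> y \<le> int k) \<Longrightarrow> f y = 0"
  shows "gowers_norm (q + 1) (\<lambda>m. complex_of_real (f (m - n))) = gowers_sq (int k) q f powr (1 / 2 ^ (q + 1))"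
proof -
  have "gowers_sum (q + 1) (\<lambda>m. complex_of_real (f (m - n))) = gowers_sum (q + 1) (\<lambda>m. complex_of_real (f m))"
    using gowers_sum_translate[of "q + 1" "\<lambda>m. complex_of_real (f m)" "- n"] by simp
  also have "\<dots> = of_real (gowers_sq (int k) q f)"
    using gowers_sum_eq_gowers_sq[of k f q] assms by simp
  finally show ?thesis by (simp add: gowers_norm_def)
qed

lemma gowers_sq_indicator_pos:
  assumes "k > 0"
  shows "gowers_sq (int k) q (\<lambda>y. of_bool (1 \<le> y \<and> y \<le> int k)) > 0"
proof (induction q)
  case 0
  have "(\<Sum>\<^sub>\<infinity>y::int. of_bool (1 \<le> y \<and> y \<le> int k) :: real) = (\<Sum>y\<in>{1..int k}. of_bool (1 \<le> y \<and> y \<le> int k))"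
    by (rule infsum_eq_window) auto
  also have "\<dots> = real k" by (subst sum.cong[OF refl, of _ _ "\<lambda>_. 1"]) auto
  finally show ?case using assms by simp
next
  case (Suc q)
  let ?f = "\<lambda>y. of_bool (1 \<le> y \<and> y \<le> int k) :: real"
  have "0 < gowers_sq (int k) q ?f" by (rule Suc)
  also have "?f = (\<lambda>y. ?f y * ?f (y + 0))" by (rule ext) simp
  also have "gowers_sq (int k) q (\<lambda>y. ?f y * ?f (y + 0)) = (\<Sum>h\<in>{0}. gowers_sq (int k) q (\<lambda>y. ?f y * ?f (y + h)))" by simp
  also have "\<dots> \<le> gowers_sq (int k) (Suc q) ?f"
    unfolding gowers_sq.simps by (intro sum_mono2) (auto simp: gowers_sq_nonneg)
  finally show ?case .
qed

definition window_norm :: "nat \<Rightarrow> nat \<Rightarrow> int \<Rightarrow> real" where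
  "window_norm q k n = gowers_sq (int k) q (liouville_window k n) powr (1 / 2 ^ (q + 1)) /
     gowers_sq (int k) q (\<lambda>y. of_bool (1 \<le> y \<and> y \<le> int k)) powr (1 / 2 ^ (q + 1))"

text \<open>For x strictly between n and n + 1 the interval [x, x + k] contains exactly the k
  integers n + 1, \<dots>, n + k. For integral x it contains k + 1, but such x do not affect the
  integral.\<close>

lemma local_gowers_norm_liouville:
  assumes "of_int n < x" "x < of_int n + 1"
  shows "local_gowers_norm (q + 1) x (x + real k) (\<lambda>n. of_int (liouville n)) = window_norm q k n"
proof -
  have ind: "interval_indicator x (x + real k) m = of_real (of_bool (1 \<le> m - n \<and> m - n \<le> int k))" for m
  proof -
    have "(x \<le> of_int m \<and> of_int m \<le> x + real k) \<longleftrightarrow> (1 \<le> m - n \<and> m - n \<le> int k)"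
      using assms by linarith
    then show ?thesis by (simp add: interval_indicator_def indicator_def)
  qed
  have lam: "of_int (liouville m) * interval_indicator x (x + real k) m = of_real (liouville_window k n (m - n))" for m
    unfolding ind by (simp add: liouville_window_def)
  show ?thesis
    unfolding local_gowers_norm_def lam window_norm_def
    unfolding ind by (subst (1 2) gowers_norm_window[where k = k]) (auto simp: liouville_window_def)
qed

lemma local_gowers_norm_nonneg: "0 \<le> local_gowers_norm d a b f"
  by (simp add: local_gowers_norm_def gowers_norm_def)

lemma window_norm_ge:
  assumes k: "k > 0" and \<delta>: "\<delta> > 0" and big: "gowers_sq (int k) q (liouville_window k n) > \<delta> * real k ^ (q + 2)"
  shows "(\<delta> / 3 ^ q) powr (1 / 2 ^ (q + 1)) \<le> window_norm q k n"
proof -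
  define g where "g = gowers_sq (int k) q (liouville_window k n)"
  define d where "d = gowers_sq (int k) q (\<lambda>y. of_bool (1 \<le> y \<and> y \<le> int k))"
  have d: "0 < d" "d \<le> 3 ^ q * real k ^ (q + 2)"
  proof -
    show "0 < d" unfolding d_def using k by (rule gowers_sq_indicator_pos)
    show "d \<le> 3 ^ q * real k ^ (q + 2)" unfolding d_def by (rule gowers_sq_le) (use k in auto)
  qed
  have "\<delta> / 3 ^ q * d \<le> \<delta> / 3 ^ q * (3 ^ q * real k ^ (q + 2))" using d \<delta> by (intro mult_left_mono) auto
  also have "\<dots> \<le> g" using big by (simp add: g_def)
  finally have "\<delta> / 3 ^ q \<le> g / d" using d by (simp add: pos_le_divide_eq)
  then have "(\<delta> / 3 ^ q) powr (1 / 2 ^ (q + 1)) \<le> (g / d) powr (1 / 2 ^ (q + 1))"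
    using \<delta> by (intro powr_mono2) auto
  also have "\<dots> = g powr (1 / 2 ^ (q + 1)) / d powr (1 / 2 ^ (q + 1))"
    using d gowers_sq_nonneg by (intro powr_divide)
  finally show ?thesis by (simp add: window_norm_def g_def d_def)
qed

definition scale_length :: "real \<Rightarrow> (real \<Rightarrow> real) \<Rightarrow> nat \<Rightarrow> nat" where
  "scale_length \<eta> \<Psi> k = nat \<lfloor>\<Psi> (real k) powr (1 / \<eta>)\<rfloor>"

text \<open>Markov's inequality: a window with large Gowers sum has normalised norm at least
  \<open>\<tau>\<close>, so the bound for the integral limits the number of such windows.\<close>

lemma gowers_exceptional:
  fixes \<Psi> :: "real \<Rightarrow> real"
  assumes mono: "strict_mono_on {1..} \<Psi>" and ge: "\<forall>\<^sub>F X in at_top. X \<le> \<Psi> X"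
    and uniform: "(\<lambda>X::real. integral {X..2 * X} (\<lambda>x.
          local_gowers_norm (q + 1) x (x + increasing_inverse \<Psi> (X powr \<eta>)) (\<lambda>n. of_int (liouville n)))) \<in> o[at_top](\<lambda>X. X)"
    and \<eta>: "\<eta> > 0" and \<delta>: "\<delta> > 0" and \<epsilon>: "\<epsilon> > 0"
  shows "\<forall>\<^sub>F k in sequentially. real (card {x \<in> {int (scale_length \<eta> \<Psi> k) + 1..<int (scale_length \<eta> \<Psi> k) + 1 + int (scale_length \<eta> \<Psi> k)}.
       gowers_sq (int k) q (liouville_window k x) > \<delta> * real k ^ (q + 2)}) \<le> \<epsilon> * real (scale_length \<eta> \<Psi> k)"
proof -
  define X where "X k = \<Psi> (real k) powr (1 / \<eta>)" for k :: nat
  define \<tau> where "\<tau> = (\<delta> / 3 ^ q) powr (1 / 2 ^ (q + 1))"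
  have \<tau>: "\<tau> > 0" using \<delta> by (simp add: \<tau>_def)
  have ge': "\<forall>\<^sub>F k in sequentially. real k \<le> \<Psi> (real k)"
    using ge by (rule eventually_compose_filterlim) (rule filterlim_real_sequentially)
  have limX: "filterlim X at_top sequentially"
  proof (rule filterlim_at_top_mono)
    have "filterlim (\<lambda>x::real. x powr (1 / \<eta>)) at_top at_top" using \<eta> by real_asymp
    then show "filterlim (\<lambda>k. real k powr (1 / \<eta>)) at_top sequentially"
      by (rule filterlim_compose) (rule filterlim_real_sequentially)
    show "\<forall>\<^sub>F k in sequentially. real k powr (1 / \<eta>) \<le> X k"
      using ge' by eventually_elim (use \<eta> in \<open>auto simp: X_def intro!: powr_mono2\<close>)
  qed
  define \<epsilon>' where "\<epsilon>' = \<epsilon> * \<tau> / 4"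
  have "\<epsilon>' > 0" using \<epsilon> \<tau> by (simp add: \<epsilon>'_def)
  with uniform have "\<forall>\<^sub>F Y in at_top. norm (integral {Y..2 * Y} (\<lambda>x.
          local_gowers_norm (q + 1) x (x + increasing_inverse \<Psi> (Y powr \<eta>)) (\<lambda>n. of_int (liouville n)))) \<le> \<epsilon>' * norm Y"
    by (rule landau_o.smallD)
  then have "\<forall>\<^sub>F k in sequentially. norm (integral {X k..2 * X k} (\<lambda>x.
          local_gowers_norm (q + 1) x (x + increasing_inverse \<Psi> (X k powr \<eta>)) (\<lambda>n. of_int (liouville n)))) \<le> \<epsilon>' * norm (X k)"
    by (rule eventually_compose_filterlim) (rule limX)
  moreover have "\<forall>\<^sub>F k in sequentially. X k \<ge> 4 + 8 / \<epsilon>"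
    using limX by (simp add: filterlim_at_top)
  ultimately show ?thesis using ge' eventually_ge_at_top[of 1]
  proof eventually_elim
    case (elim k)
    define N where "N = scale_length \<eta> \<Psi> k"
    have \<Psi>0: "\<Psi> (real k) > 0" using elim by linarith
    have X0: "X k \<ge> 4" using elim(2) \<epsilon> by (smt (verit) divide_nonneg_pos)
    have N: "real N \<le> X k" "X k < real N + 1"
      unfolding N_def scale_length_def X_def[symmetric] using X0 by linarith+
    have "X k powr \<eta> = \<Psi> (real k)" using \<Psi>0 \<eta> by (simp add: X_def powr_powr)
    then have inv: "increasing_inverse \<Psi> (X k powr \<eta>) = real k"
      using increasing_inverse_eq[OF mono, of "real k"] elim(4) by simp
    define Bad where "Bad = {x \<in> {int N + 1..<int N + 1 + int N}. gowers_sq (int k) q (liouville_window k x) > \<delta> * real k ^ (q + 2)}"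
    have finB: "finite Bad"
      unfolding Bad_def by (rule finite_subset[of _ "{int N + 1..<int N + 1 + int N}"]) auto
    have "(\<Sum>n\<in>{int N + 1..<2 * int N}. window_norm q k n)
        \<le> integral {X k..2 * X k} (\<lambda>x. local_gowers_norm (q + 1) x (x + real k) (\<lambda>n. of_int (liouville n)))"
    proof (rule sum_le_step_integral[OF local_gowers_norm_liouville local_gowers_norm_nonneg])
      show "int N + 1 \<le> 2 * int N" "X k \<le> of_int (int N + 1)" "of_int (2 * int N) \<le> 2 * X k"
        using N X0 by auto
    qed
    also have "\<dots> \<le> \<epsilon>' * X k" using elim(1) X0 unfolding inv by simp
    finally have int: "(\<Sum>n\<in>{int N + 1..<2 * int N}. window_norm q k n) \<le> \<epsilon>' * X k" .
    have wn: "0 \<le> window_norm q k n" for n by (simp add: window_norm_def)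
    have "\<tau> * real (card (Bad - {2 * int N})) = (\<Sum>n\<in>Bad - {2 * int N}. \<tau>)" by simp
    also have "\<dots> \<le> (\<Sum>n\<in>Bad - {2 * int N}. window_norm q k n)"
    proof (rule sum_mono)
      fix n assume "n \<in> Bad - {2 * int N}"
      then have "gowers_sq (int k) q (liouville_window k n) > \<delta> * real k ^ (q + 2)" by (simp only: Bad_def Diff_iff mem_Collect_eq)
      then show "\<tau> \<le> window_norm q k n" unfolding \<tau>_def using elim(4) \<delta> by (intro window_norm_ge) auto
    qed
    also have "\<dots> \<le> (\<Sum>n\<in>{int N + 1..<2 * int N}. window_norm q k n)"
      using wn by (intro sum_mono2) (auto simp: Bad_def)
    also have "\<dots> \<le> \<epsilon>' * X k" by (rule int)
    finally have "\<tau> * real (card (Bad - {2 * int N})) \<le> \<tau> * (\<epsilon> / 4 * X k)" by (simp add: \<epsilon>'_def mult_ac)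
    then have c: "real (card (Bad - {2 * int N})) \<le> \<epsilon> / 4 * X k" using \<tau> by simp
    \<comment> \<open>The unit interval starting at 2 N need not lie inside [X, 2 X]; it is left out
      above and counted here. X \<ge> 8 / \<epsilon> absorbs it.\<close>
    have "card Bad \<le> card (Bad - {2 * int N}) + 1"
      using finB card_insert_le_m1 by (metis card_Diff1_le card_Diff_singleton_if add.commute diff_le_self le_add_diff_inverse2 le_diff_conv order_refl)
    then have "real (card Bad) \<le> \<epsilon> / 4 * X k + 1" using c by linarith
    also have "\<dots> \<le> \<epsilon> * real N"
    proof -
      have "8 \<le> \<epsilon> * X k" using elim(2) \<epsilon> mult_left_mono[of "4 + 8 / \<epsilon>" "X k" \<epsilon>] by (simp add: distrib_left)
      moreover have "X k \<le> 2 * real N" using N X0 by linarith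
      then have "\<epsilon> * X k \<le> \<epsilon> * (2 * real N)" using \<epsilon> by (intro mult_left_mono) auto
      ultimately show ?thesis by simp
    qed
    finally show ?case by (simp add: Bad_def N_def)
  qed
qed

section \<open>Correlations along dilates and sign patterns\<close>

lemma liouville_mult:
  assumes "a > 0" "b > 0"
  shows "liouville (a * b) = liouville a * liouville b"
  using assms by (simp add: liouville_def prime_factorization_mult power_add)

lemma liouville_prime: "prime p \<Longrightarrow> liouville (int p) = - 1"
  by (simp add: liouville_def prime_gt_0_nat prime_factorization_prime)

lemma liouville_pos: "n > 0 \<Longrightarrow> liouville n \<in> {- 1, 1}"
  unfolding liouville_def by (cases "even (size (prime_factorization n))") auto

definition tuple_prod :: "nat list \<Rightarrow> nat \<Rightarrow> int \<Rightarrow> real" where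
  "tuple_prod hs p x = (\<Prod>h\<leftarrow>hs. real_of_int (liouville (x + int p * int h)))"

lemma abs_tuple_prod_le: "\<bar>tuple_prod hs p x\<bar> \<le> 1"
  unfolding tuple_prod_def
  by (rule abs_prod_list_le_1) (metis abs_liouville_le of_int_1_le_iff of_int_abs of_int_le_1_iff)

definition dilated_range :: "nat \<Rightarrow> nat \<Rightarrow> int set" where
  "dilated_range N p = {n. int N < int p * n \<and> int p * n \<le> 2 * int N}"

lemma dilated_range_subset: "p > 0 \<Longrightarrow> dilated_range N p \<subseteq> {1..2 * int N}"
proof
  fix n assume p: "p > 0" and n: "n \<in> dilated_range N p"
  have "0 < int p * n" using n by (simp add: dilated_range_def)
  then have n0: "n > 0" using p by (simp add: zero_less_mult_iff)
  have "1 * n \<le> int p * n" using n0 p by (intro mult_right_mono) auto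
  then have "n \<le> 2 * int N" using n unfolding dilated_range_def mem_Collect_eq mult_1 by linarith
  then show "n \<in> {1..2 * int N}" using n0 by simp
qed

lemma card_dilated_range_ge:
  assumes "p > 0"
  shows "real N - real p \<le> real p * real (card (dilated_range N p))"
proof -
  have div: "n \<le> z div int p \<longleftrightarrow> int p * n \<le> z" for n z :: int
  proof
    assume "n \<le> z div int p"
    then have "int p * n \<le> int p * (z div int p)" by (rule mult_left_mono) simp
    also have "\<dots> \<le> z" using pos_mod_sign[of "int p" z] assms mult_div_mod_eq[of "int p" z] by linarith
    finally show "int p * n \<le> z" .
  next
    assume "int p * n \<le> z"
    from zdiv_mono1[OF this, of "int p"] show "n \<le> z div int p" using assms by simp
  qed
  have "dilated_range N p = {int (N div p) + 1..int (2 * N div p)}"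
  proof (rule set_eqI)
    fix n
    have "int N < int p * n \<longleftrightarrow> \<not> n \<le> int N div int p" unfolding div by auto
    moreover have "int p * n \<le> 2 * int N \<longleftrightarrow> n \<le> (2 * int N) div int p" unfolding div ..
    ultimately show "n \<in> dilated_range N p \<longleftrightarrow> n \<in> {int (N div p) + 1..int (2 * N div p)}"
      unfolding dilated_range_def by (auto simp: zdiv_int)
  qed
  then have "p * card (dilated_range N p) = p * (2 * N div p) - p * (N div p)" by (simp add: diff_mult_distrib2 nat_diff_distrib')
  moreover have "2 * N < p * (2 * N div p) + p" using dividend_less_times_div[OF assms, of "2 * N"] by simp
  moreover have "p * (N div p) \<le> N" by simp
  ultimately have "2 * N < p * card (dilated_range N p) + N + p" by linarith
  then have "real (2 * N) < real (p * card (dilated_range N p) + N + p)" by (rule of_nat_less_iff[THEN iffD2])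
  then show ?thesis by simp
qed

text \<open>By complete multiplicativity \<lambda>(p n + p h) = - \<lambda>(n + h). So dilating a
  tuple by p and restricting to multiples of p changes a correlation only by a sign for each
  entry.\<close>

lemma sum_multiples_eq:
  assumes p: "prime p"
  shows "(\<Sum>x\<in>{int N + 1..<int N + 1 + int N}. of_bool (int p dvd x) * tuple_prod hs p x)
    = (- 1) ^ length hs * (\<Sum>n\<in>dilated_range N p. tuple_prod hs 1 n)"
proof -
  have p0: "p > 0" using p by (rule prime_gt_0_nat)
  have "(\<Sum>x\<in>{int N + 1..<int N + 1 + int N}. of_bool (int p dvd x) * tuple_prod hs p x)
      = (\<Sum>x\<in>(\<lambda>n. int p * n) ` dilated_range N p. tuple_prod hs p x)"
    by (rule sum.mono_neutral_cong_right) (auto simp: dilated_range_def elim!: dvdE)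
  also have "\<dots> = (\<Sum>n\<in>dilated_range N p. tuple_prod hs p (int p * n))"
    using p0 by (subst sum.reindex) (auto simp: inj_on_def)
  also have "\<dots> = (\<Sum>n\<in>dilated_range N p. (- 1) ^ length hs * tuple_prod hs 1 n)"
  proof (rule sum.cong[OF refl])
    fix n assume "n \<in> dilated_range N p"
    then have n: "n > 0" using dilated_range_subset[OF p0, of N] by auto
    have "liouville (int p * n + int p * int h) = - liouville (n + int h)" for h
      using liouville_mult[of "int p" "n + int h"] liouville_prime[OF p] p0 n by (simp add: distrib_left)
    then show "tuple_prod hs p (int p * n) = (- 1) ^ length hs * tuple_prod hs 1 n"
      unfolding tuple_prod_def by (induction hs) auto
  qed
  finally show ?thesis by (simp add: sum_distrib_left)
qed

lemma sum_shift_le: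
  fixes g :: "int \<Rightarrow> real"
  assumes g: "\<And>x. \<bar>g x\<bar> \<le> B"
  shows "\<bar>(\<Sum>x\<in>{a..<a + int N}. g (x + int j)) - (\<Sum>x\<in>{a..<a + int N}. g x)\<bar> \<le> 2 * real j * B"
proof (induction j)
  case (Suc j)
  have tele: "(\<Sum>x\<in>{a..<a + int N}. g (x + int (Suc j))) - (\<Sum>x\<in>{a..<a + int N}. g (x + int j))
      = g (a + int N + int j) - g (a + int j)"
  proof (induction N)
    case (Suc N)
    have "{a..<a + int (Suc N)} = insert (a + int N) {a..<a + int N}" by auto
    then show ?case using Suc by (simp add: algebra_simps)
  qed simp
  have "\<bar>g (a + int N + int j) - g (a + int j)\<bar> \<le> 2 * B"
    using g[of "a + int N + int j"] g[of "a + int j"] by linarith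
  with Suc tele show ?case by (simp add: algebra_simps)
qed simp

lemma finite_sign_patterns: "finite (sign_patterns k)"
proof (rule finite_subset)
  show "sign_patterns k \<subseteq> PiE {1..k} (\<lambda>_. {- 1, 1})" by (auto simp: sign_patterns_def)
qed (intro finite_PiE, auto)

definition liouville_pattern :: "nat \<Rightarrow> int \<Rightarrow> nat \<Rightarrow> int" where
  "liouville_pattern k x = (\<lambda>i\<in>{1..k}. liouville (x + int i))"

lemma liouville_pattern_in:
  assumes "x \<ge> 1"
  shows "liouville_pattern k x \<in> sign_patterns k"
proof -
  have "x = int (nat x)" "nat x \<ge> 1" using assms by auto
  then have "\<forall>i\<in>{1..k}. liouville_pattern k x i = liouville (int (nat x + i))"
    by (simp add: liouville_pattern_def)
  moreover have "liouville_pattern k x \<in> PiE {1..k} (\<lambda>_. {- 1, 1})"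
    unfolding liouville_pattern_def using assms liouville_pos by (intro restrict_PiE_iff[THEN iffD2] ballI) auto
  ultimately show ?thesis unfolding sign_patterns_def using \<open>nat x \<ge> 1\<close> by blast
qed

text \<open>Positions outside the pattern contribute 0. The value \<open>undefined\<close> of v at
  such positions would spoil the bound by 1, which \<open>deviation_concentration\<close> requires
  for all p and j.\<close>

definition pattern_prod :: "nat list \<Rightarrow> nat \<Rightarrow> (nat \<Rightarrow> int) \<Rightarrow> nat \<Rightarrow> nat \<Rightarrow> real" where
  "pattern_prod hs k v p j = (\<Prod>h\<leftarrow>hs. of_bool (j + p * h \<in> {1..k}) * real_of_int (v (j + p * h)))"

lemma abs_pattern_prod_le:
  assumes "v \<in> sign_patterns k"
  shows "\<bar>pattern_prod hs k v p j\<bar> \<le> 1"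
  unfolding pattern_prod_def
proof (rule abs_prod_list_le_1)
  fix h
  have "v i \<in> {- 1, 1}" if "i \<in> {1..k}" for i
    using assms that by (auto simp: sign_patterns_def PiE_iff)
  then show "\<bar>of_bool (j + p * h \<in> {1..k}) * real_of_int (v (j + p * h))\<bar> \<le> 1"
    by (cases "j + p * h \<in> {1..k}") fastforce+
qed

lemma window_products:
  assumes "j + p * M \<le> k" "j \<ge> 1" "\<And>h. h \<in> set hs \<Longrightarrow> h \<le> M"
  shows "pattern_prod hs k (liouville_pattern k x) p j = tuple_prod hs p (x + int j)"
    and "(\<Prod>h\<leftarrow>hs. liouville_window k x (int j + int p * int h)) = tuple_prod hs p (x + int j)"
proof -
  have le: "j + p * h \<in> {1..k}" if "h \<in> set hs" for h
  proof -
    have "p * h \<le> p * M" using assms(3)[OF that] by simp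
    then have "j + p * h \<le> k" using assms(1) by linarith
    then show ?thesis using assms(2) by simp
  qed
  show "pattern_prod hs k (liouville_pattern k x) p j = tuple_prod hs p (x + int j)"
    unfolding pattern_prod_def tuple_prod_def
    by (intro arg_cong[of _ _ prod_list] map_cong refl) (use le in \<open>simp add: liouville_pattern_def add.assoc\<close>)
  show "(\<Prod>h\<leftarrow>hs. liouville_window k x (int j + int p * int h)) = tuple_prod hs p (x + int j)"
    unfolding tuple_prod_def
  proof (intro arg_cong[of _ _ prod_list] map_cong refl)
    fix h assume "h \<in> set hs"
    from le[OF this] have "1 \<le> int (j + p * h)" "int (j + p * h) \<le> int k" by (simp_all del: of_nat_add of_nat_mult)
    then show "liouville_window k x (int j + int p * int h) = real_of_int (liouville (x + int j + int p * int h))"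
      by (simp add: liouville_window_def add.assoc)
  qed
qed

text \<open>Shifting by \<open>j\<close> turns the sum over multiples of \<open>p\<close> into the deviation of \<open>p * 1[p dvd x + j]\<close>
  from its mean value, plus a dilated mean in a window.\<close>

lemma sum_multiples_split:
  fixes N k M :: nat
  defines "J \<equiv> k div 2" and "D \<equiv> k div (2 * M)" and "I \<equiv> {int N + 1..<int N + 1 + int N}"
  assumes k: "k \<ge> 2" and M: "M \<ge> 1" and hs: "\<And>h. h \<in> set hs \<Longrightarrow> h \<le> M" and P: "finite P" "\<And>p. p \<in> P \<Longrightarrow> p \<le> D"
  shows "\<bar>\<Sum>p\<in>P. \<Sum>x\<in>I. real p * (of_bool (int p dvd x) * tuple_prod hs p x)\<bar>
    \<le> 2 * real J * real D * real (card P)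
      + (\<Sum>x\<in>I. \<bar>\<Sum>p\<in>P. divisor_deviation (pattern_prod hs k (liouville_pattern k x)) J p x\<bar>)
      + (\<Sum>x\<in>I. \<Sum>p\<in>P. \<bar>dilate_mean (liouville_window k x) hs J (int p)\<bar>)"
proof -
  have J: "J > 0" using k by (simp add: J_def)
  define g where "g p x = real p * (of_bool (int p dvd x) * tuple_prod hs p x)" for p x
  define avg where "avg p x = (\<Sum>j\<in>{1..J}. g p (x + int j)) / real J" for p x
  have g_le: "\<bar>g p x\<bar> \<le> real D" if "p \<in> P" for p x
  proof -
    have "\<bar>g p x\<bar> \<le> real p * (1 * 1)"
      unfolding g_def abs_mult using abs_tuple_prod_le by (intro mult_mono) auto
    then show ?thesis using P(2)[OF that] by simp
  qed
  have shift: "\<bar>(\<Sum>x\<in>I. avg p x) - (\<Sum>x\<in>I. g p x)\<bar> \<le> 2 * real J * real D" if p: "p \<in> P" for p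
  proof -
    have "(\<Sum>x\<in>I. avg p x) - (\<Sum>x\<in>I. g p x) = (\<Sum>j\<in>{1..J}. (\<Sum>x\<in>I. g p (x + int j)) - (\<Sum>x\<in>I. g p x)) / real J"
    proof -
      have "(\<Sum>x\<in>I. avg p x) = (\<Sum>j\<in>{1..J}. \<Sum>x\<in>I. g p (x + int j)) / real J"
        unfolding avg_def sum_divide_distrib[symmetric] by (subst sum.swap) simp
      then show ?thesis using J by (simp add: sum_subtractf diff_divide_distrib)
    qed
    also have "\<bar>\<dots>\<bar> \<le> (\<Sum>j\<in>{1..J}. \<bar>(\<Sum>x\<in>I. g p (x + int j)) - (\<Sum>x\<in>I. g p x)\<bar>) / real J"
      by (simp add: abs_divide divide_right_mono)
    also have "\<dots> \<le> (\<Sum>j\<in>{1..J}. 2 * real J * real D) / real J"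
    proof (intro divide_right_mono sum_mono)
      fix j assume j: "j \<in> {1..J}"
      have "\<bar>(\<Sum>x\<in>I. g p (x + int j)) - (\<Sum>x\<in>I. g p x)\<bar> \<le> 2 * real j * real D"
        unfolding I_def using g_le[OF p] by (rule sum_shift_le)
      also have "\<dots> \<le> 2 * real J * real D" using j by (intro mult_right_mono) auto
      finally show "\<bar>(\<Sum>x\<in>I. g p (x + int j)) - (\<Sum>x\<in>I. g p x)\<bar> \<le> 2 * real J * real D" .
    qed simp
    also have "\<dots> = 2 * real J * real D" using J by simp
    finally show ?thesis .
  qed
  have split: "avg p x = divisor_deviation (pattern_prod hs k (liouville_pattern k x)) J p x + dilate_mean (liouville_window k x) hs J (int p)"
    if p: "p \<in> P" for p x
  proof -
    have win: "pattern_prod hs k (liouville_pattern k x) p j = tuple_prod hs p (x + int j)"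
      "(\<Prod>h\<leftarrow>hs. liouville_window k x (int j + int p * int h)) = tuple_prod hs p (x + int j)" if j: "j \<in> {1..J}" for j
    proof -
      \<comment> \<open>Since j \<le> k div 2 and p M \<le> D M \<le> k div 2, all positions j + p h
        stay inside the window.\<close>
      have "p * M \<le> D * M" using P(2)[OF p] by simp
      moreover have "D * M \<le> k div 2" unfolding D_def
        by (metis div_mult2_eq div_times_less_eq_dividend)
      moreover have "j + k div 2 \<le> k" using j by (auto simp: J_def)
      ultimately have "j + p * M \<le> k" by linarith
      then show "pattern_prod hs k (liouville_pattern k x) p j = tuple_prod hs p (x + int j)"
        "(\<Prod>h\<leftarrow>hs. liouville_window k x (int j + int p * int h)) = tuple_prod hs p (x + int j)"
        using j hs by (intro window_products[of j p M]; auto)+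
    qed
    have "dilate_mean (liouville_window k x) hs J (int p) = (\<Sum>j\<in>int ` {1..J}. \<Prod>h\<leftarrow>hs. liouville_window k x (j + int p * int h)) / real J"
      unfolding dilate_mean_def image_int_atLeastAtMost by simp
    also have "(\<Sum>j\<in>int ` {1..J}. \<Prod>h\<leftarrow>hs. liouville_window k x (j + int p * int h)) = (\<Sum>j\<in>{1..J}. tuple_prod hs p (x + int j))"
      by (subst sum.reindex) (auto simp: win(2) simp del: of_nat_mult)
    finally have dm: "dilate_mean (liouville_window k x) hs J (int p) = (\<Sum>j\<in>{1..J}. tuple_prod hs p (x + int j)) / real J" .
    have dd: "divisor_deviation (pattern_prod hs k (liouville_pattern k x)) J p x
        = (\<Sum>j\<in>{1..J}. g p (x + int j) - tuple_prod hs p (x + int j)) / real J"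
      unfolding divisor_deviation_def g_def by (intro arg_cong2[of _ _ _ _ "(/)"] sum.cong refl) (simp add: win(1) algebra_simps)
    show ?thesis unfolding dm dd avg_def by (simp add: sum_subtractf diff_divide_distrib)
  qed
  have "\<bar>\<Sum>p\<in>P. \<Sum>x\<in>I. g p x\<bar> \<le> \<bar>\<Sum>p\<in>P. (\<Sum>x\<in>I. avg p x) - (\<Sum>x\<in>I. g p x)\<bar> + \<bar>\<Sum>p\<in>P. \<Sum>x\<in>I. avg p x\<bar>"
    unfolding sum_subtractf by linarith
  also have "\<bar>\<Sum>p\<in>P. (\<Sum>x\<in>I. avg p x) - (\<Sum>x\<in>I. g p x)\<bar> \<le> (\<Sum>p\<in>P. 2 * real J * real D)"
    using shift by (intro order.trans[OF sum_abs] sum_mono) auto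
  also have "(\<Sum>p\<in>P. \<Sum>x\<in>I. avg p x) = (\<Sum>x\<in>I. (\<Sum>p\<in>P. divisor_deviation (pattern_prod hs k (liouville_pattern k x)) J p x)
      + (\<Sum>p\<in>P. dilate_mean (liouville_window k x) hs J (int p)))"
    using split by (subst sum.swap) (simp add: sum.distrib)
  also have "\<bar>\<dots>\<bar> \<le> (\<Sum>x\<in>I. \<bar>\<Sum>p\<in>P. divisor_deviation (pattern_prod hs k (liouville_pattern k x)) J p x\<bar>
      + (\<Sum>p\<in>P. \<bar>dilate_mean (liouville_window k x) hs J (int p)\<bar>))"
    by (intro order.trans[OF sum_abs] sum_mono order.trans[OF abs_triangle_ineq] add_left_mono sum_abs)
  finally show ?thesis by (simp add: sum.distrib g_def mult_ac)
qed

text \<open>The condition of few patterns is kept inside the eventuality: in the final contradiction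
  such k are only known to occur infinitely often, and in this form the bounds for finitely many
  tuples hold at one common k.\<close>

lemma correlation_small:
  fixes \<kappa> \<epsilon> :: real and \<Psi> :: "real \<Rightarrow> real"
  assumes \<kappa>: "0 < \<kappa>" "\<kappa> < 1 / 2" and mono: "strict_mono_on {1..} \<Psi>"
    and growth: "\<forall>\<^sub>F X in at_top. X \<le> \<Psi> X \<and> \<Psi> X \<le> exp (X powr (1 / 2 - \<kappa>))"
    and uniform: "\<And>(k::nat) (\<eta>::real). \<eta> > 0 \<Longrightarrow>
      (\<lambda>X::real. integral {X..2 * X} (\<lambda>x.
          local_gowers_norm (k + 1) x (x + increasing_inverse \<Psi> (X powr \<eta>))
            (\<lambda>n. of_int (liouville n)))) \<in> o[at_top](\<lambda>X. X)"
    and hs: "distinct hs" "hs \<noteq> []" "\<And>h. h \<in> set hs \<Longrightarrow> 1 \<le> h \<and> h \<le> M" and \<epsilon>: "\<epsilon> > 0"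
  shows "\<forall>\<^sub>F k in sequentially. real (sign_pattern_count k) < \<Psi> (real k) \<longrightarrow>
    \<bar>\<Sum>p\<in>big_primes (k div (2 * M)). real p * (\<Sum>n\<in>dilated_range (scale_length (\<kappa> / 20) \<Psi> k) p. tuple_prod hs 1 n)\<bar>
      \<le> \<epsilon> * real (card (big_primes (k div (2 * M)))) * real (scale_length (\<kappa> / 20) \<Psi> k)"
proof -
  \<comment> \<open>The shift, the deviation and the dilated means will cost 1, 2 and 2 units of
    \<open>\<epsilon>1\<close>, five out of eight.\<close>
  define \<epsilon>1 where "\<epsilon>1 = \<epsilon> / 8"
  have \<epsilon>1: "\<epsilon>1 > 0" using \<epsilon> by (simp add: \<epsilon>1_def)
  have M: "M \<ge> 1" using hs(2,3) by (cases hs) fastforce+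
  obtain \<delta> k0 where \<delta>: "\<delta> > 0" and vn: "\<And>k f. k \<ge> k0 \<Longrightarrow> (\<And>y. \<bar>f y\<bar> \<le> 1) \<Longrightarrow> (\<And>y. \<not> (1 \<le> y \<and> y \<le> int k) \<Longrightarrow> f y = 0) \<Longrightarrow>
     gowers_sq (int k) (Suc (length hs)) f \<le> \<delta> * real k ^ (length hs + 3) \<Longrightarrow>
     (\<Sum>p\<in>big_primes (k div (2 * M)). \<bar>dilate_mean f hs (k div 2) (int p)\<bar>) \<le> \<epsilon>1 * real (card (big_primes (k div (2 * M))))"
    using prime_von_neumann[OF hs \<epsilon>1] by blast
  have growth': "\<forall>\<^sub>F k in sequentially. real k \<le> \<Psi> (real k) \<and> \<Psi> (real k) \<le> exp (real k powr (1 / 2 - \<kappa>))"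
    using growth by (rule eventually_compose_filterlim) (rule filterlim_real_sequentially)
  have ge: "\<forall>\<^sub>F X in at_top. X \<le> \<Psi> X" using growth by eventually_elim simp
  have \<eta>: "\<kappa> / 20 > 0" using \<kappa> by simp
  define q where "q = Suc (length hs)"
  have "\<forall>\<^sub>F k in sequentially. real (card {x \<in> {int (scale_length (\<kappa> / 20) \<Psi> k) + 1..<int (scale_length (\<kappa> / 20) \<Psi> k) + 1 + int (scale_length (\<kappa> / 20) \<Psi> k)}.
       gowers_sq (int k) q (liouville_window k x) > \<delta> * real k ^ (q + 2)}) \<le> \<epsilon>1 * real (scale_length (\<kappa> / 20) \<Psi> k)"
    using uniform[OF \<eta>] by (intro gowers_exceptional[OF mono ge _ \<eta> \<delta> \<epsilon>1])
  moreover have "\<forall>\<^sub>F k :: nat in sequentially. \<forall>Y. real k \<le> Y \<and> Y \<le> exp (real k powr (1 / 2 - \<kappa>)) \<longrightarrow>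
    (\<exists>r>0. \<forall>n N. n \<ge> real k / (48 * real M * ln (real k)) \<longrightarrow> N \<ge> Y powr (20 / \<kappa>) / 2 \<longrightarrow>
       (9 / \<epsilon>1\<^sup>2) ^ r * Y * (((real r)\<^sup>2 / n) ^ r + real k ^ (2 * r) / N) \<le> 1)"
    using \<kappa> \<epsilon>1 M by (intro moment_parameter) auto
  moreover have "\<forall>\<^sub>F k in sequentially. real (k div (2 * M)) / (12 * ln (real (k div (2 * M)))) \<le> real (card (big_primes (k div (2 * M))))"
  proof -
    have "filterlim (\<lambda>k. k div (2 * M)) sequentially sequentially"
      unfolding filterlim_at_top
    proof
      fix Z
      have "Z \<le> k div (2 * M)" if "k \<ge> Z * (2 * M)" for k
        using that M by (simp add: less_eq_div_iff_mult_less_eq)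
      then show "\<forall>\<^sub>F k in sequentially. Z \<le> k div (2 * M)" unfolding eventually_sequentially by blast
    qed
    with card_big_primes_lower show ?thesis by (rule eventually_compose_filterlim)
  qed
  moreover have "\<forall>\<^sub>F k in sequentially. k \<ge> k0 + 8 * M + 3 \<and> real k \<ge> 4 / \<epsilon>1"
    using eventually_ge_at_top[of "max (k0 + 8 * M + 3) (nat \<lceil>4 / \<epsilon>1\<rceil>)"]
    by eventually_elim linarith
  ultimately show ?thesis using growth'
  proof eventually_elim
    case (elim k)
    define N where "N = scale_length (\<kappa> / 20) \<Psi> k"
    define D where "D = k div (2 * M)"
    define J where "J = k div 2"
    define P where "P = big_primes D"
    define n where "n = real (card P)"
    define I where "I = {int N + 1..<int N + 1 + int N}"
    define Bad where "Bad = {x \<in> I. gowers_sq (int k) q (liouville_window k x) > \<delta> * real k ^ (q + 2)}"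
    have k: "k \<ge> 3" "k \<ge> k0" "k \<ge> 8 * M" "real k \<ge> 4 / \<epsilon>1" using elim(4) by auto
    have bad: "real (card Bad) \<le> \<epsilon>1 * real N" using elim(1) by (simp add: Bad_def I_def N_def)
    have \<Psi>: "real k \<le> \<Psi> (real k)" "\<Psi> (real k) \<le> exp (real k powr (1 / 2 - \<kappa>))" using elim(5) by auto
    \<comment> \<open>The cube is enough to absorb the shift error, which is O(k^2) for each prime;
      the exponent 20 / \<kappa> exceeds 40.\<close>
    have X: "\<Psi> (real k) powr (20 / \<kappa>) \<ge> real k ^ 3"
    proof -
      have "real k ^ 3 = real k powr 3" using k by simp
      also have "\<dots> \<le> real k powr (20 / \<kappa>)" using k \<kappa> by (intro powr_mono) (auto simp: pos_le_divide_eq)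
      also have "\<dots> \<le> \<Psi> (real k) powr (20 / \<kappa>)" using \<Psi> \<kappa> by (intro powr_mono2) auto
      finally show ?thesis .
    qed
    have "real k ^ 3 \<ge> 3 ^ 3" using k by (intro power_mono) auto
    then have N2: "real N \<ge> \<Psi> (real k) powr (20 / \<kappa>) / 2"
      unfolding N_def scale_length_def using X by simp linarith
    have Nk: "real N \<ge> real k ^ 3 / 2" using N2 X by linarith
    have D4: "D \<ge> 4" "D \<le> k" using k M by (auto simp: D_def less_eq_div_iff_mult_less_eq)
    have kD: "real k \<le> 4 * real M * real D"
    proof -
      have "k < 2 * M * (D + 1)" unfolding D_def using M dividend_less_times_div[of "2 * M" k] by simp
      also have "\<dots> \<le> 2 * M * (2 * D)" using D4 by (intro mult_le_mono2) simp
      finally have "k \<le> 4 * M * D" by simp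
      from of_nat_mono[OF this, where 'a = real] show ?thesis by simp
    qed
    have n: "n \<ge> real k / (48 * real M * ln (real k))"
    proof -
      have "real k / (48 * real M * ln (real k)) \<le> (4 * real M * real D) / (48 * real M * ln (real k))"
        using kD k M by (intro divide_right_mono) auto
      also have "\<dots> = real D / (12 * ln (real k))" using M by simp
      also have "\<dots> \<le> real D / (12 * ln (real D))"
        using D4 k by (intro divide_left_mono mult_pos_pos) auto
      also have "\<dots> \<le> n" using elim(3) by (simp add: n_def P_def D_def)
      finally show ?thesis .
    qed
    have "0 < real k / (48 * real M * ln (real k))" using k M by simp
    then have n0: "n > 0" using n by linarith
    have P: "finite P" "P \<noteq> {}" "\<And>p. p \<in> P \<Longrightarrow> prime p" "\<And>p. p \<in> P \<Longrightarrow> p \<le> D"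
    proof -
      show "P \<noteq> {}" using n0 by (auto simp: n_def)
    qed (auto simp: P_def big_primes_def)
    have DJ: "D \<le> J" unfolding D_def J_def using M by (intro div_le_mono2) auto
    show ?case
    proof
      assume few: "real (sign_pattern_count k) < \<Psi> (real k)"
      define Q where "Q = (\<Sum>p\<in>P. real p * (\<Sum>n\<in>dilated_range N p. tuple_prod hs 1 n))"
      have "\<bar>Q\<bar> = \<bar>\<Sum>p\<in>P. \<Sum>x\<in>I. real p * (of_bool (int p dvd x) * tuple_prod hs p x)\<bar>"
      proof -
        have "(\<Sum>p\<in>P. \<Sum>x\<in>I. real p * (of_bool (int p dvd x) * tuple_prod hs p x))
            = (\<Sum>p\<in>P. (- 1) ^ length hs * (real p * (\<Sum>n\<in>dilated_range N p. tuple_prod hs 1 n)))"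
        proof (rule sum.cong[OF refl])
          fix p assume "p \<in> P"
          from sum_multiples_eq[OF P(3)[OF this], of hs N]
          show "(\<Sum>x\<in>I. real p * (of_bool (int p dvd x) * tuple_prod hs p x))
              = (- 1) ^ length hs * (real p * (\<Sum>n\<in>dilated_range N p. tuple_prod hs 1 n))"
            unfolding I_def sum_distrib_left[symmetric] by simp
        qed
        also have "\<dots> = (- 1) ^ length hs * Q" by (simp only: Q_def sum_distrib_left)
        finally show ?thesis by (simp add: abs_mult power_abs)
      qed
      also have "\<dots> \<le> 2 * real J * real D * real (card P)
          + (\<Sum>x\<in>I. \<bar>\<Sum>p\<in>P. divisor_deviation (pattern_prod hs k (liouville_pattern k x)) J p x\<bar>)
          + (\<Sum>x\<in>I. \<Sum>p\<in>P. \<bar>dilate_mean (liouville_window k x) hs J (int p)\<bar>)"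
        unfolding I_def J_def D_def using k M hs(3) P by (intro sum_multiples_split[where M = M]) (auto simp: D_def)
      also have "2 * real J * real D * real (card P) \<le> \<epsilon>1 * n * real N"
      proof -
        have "2 * real J * real D \<le> 2 * real k * real k" using D4 by (intro mult_mono) (auto simp: J_def)
        also have "\<dots> \<le> (\<epsilon>1 * real k / 2) * real k * real k"
          using k(4) \<epsilon>1 by (intro mult_right_mono) (auto simp: divide_le_eq mult.commute)
        also have "\<dots> = \<epsilon>1 * (real k ^ 3 / 2)" by (simp add: power3_eq_cube)
        also have "\<dots> \<le> \<epsilon>1 * real N" using Nk \<epsilon>1 by (intro mult_left_mono) auto
        finally have "2 * real J * real D * n \<le> \<epsilon>1 * real N * n" using n0 by (intro mult_right_mono) auto
        then show ?thesis by (simp add: n_def mult_ac)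
      qed
      also have "(\<Sum>x\<in>I. \<bar>\<Sum>p\<in>P. divisor_deviation (pattern_prod hs k (liouville_pattern k x)) J p x\<bar>) \<le> 2 * (\<epsilon>1 * n * real N)"
      proof -
        obtain r where r: "r > 0" "(9 / \<epsilon>1\<^sup>2) ^ r * \<Psi> (real k) * (((real r)\<^sup>2 / n) ^ r + real k ^ (2 * r) / real N) \<le> 1"
          using elim(2) \<Psi> n N2 by blast
        have "(\<Sum>x\<in>I. \<bar>\<Sum>p\<in>P. divisor_deviation (pattern_prod hs k (liouville_pattern k x)) J p x\<bar>)
           \<le> \<epsilon>1 * real (card P) * real N * (1 + (9 / \<epsilon>1\<^sup>2) ^ r * real (card (sign_patterns k)) * (((real r)\<^sup>2 / real (card P)) ^ r + real D ^ (2 * r) / real N))"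
          unfolding I_def
          by (rule deviation_concentration[where V = "sign_patterns k" and c = "pattern_prod hs k", OF P DJ finite_sign_patterns _ _ r(1) \<epsilon>1])
             (auto intro: abs_pattern_prod_le liouville_pattern_in)
        also have "\<dots> \<le> \<epsilon>1 * real (card P) * real N * (1 + 1)"
        proof (intro mult_left_mono add_left_mono)
          \<comment> \<open>The only place where the assumed bound on the number of patterns
            enters.\<close>
          have "(9 / \<epsilon>1\<^sup>2) ^ r * real (card (sign_patterns k)) * (((real r)\<^sup>2 / real (card P)) ^ r + real D ^ (2 * r) / real N)
             \<le> (9 / \<epsilon>1\<^sup>2) ^ r * \<Psi> (real k) * (((real r)\<^sup>2 / n) ^ r + real k ^ (2 * r) / real N)"
            unfolding n_def using few D4 n0 \<Psi>(1)
            by (intro mult_mono mult_left_mono add_left_mono divide_right_mono power_mono)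
               (auto simp: sign_pattern_count_def)
          with r(2) show "(9 / \<epsilon>1\<^sup>2) ^ r * real (card (sign_patterns k)) * (((real r)\<^sup>2 / real (card P)) ^ r + real D ^ (2 * r) / real N) \<le> 1"
            by linarith
        qed (use \<epsilon>1 in auto)
        finally show ?thesis by (simp add: n_def)
      qed
      also have "(\<Sum>x\<in>I. \<Sum>p\<in>P. \<bar>dilate_mean (liouville_window k x) hs J (int p)\<bar>) \<le> 2 * (\<epsilon>1 * n * real N)"
      proof -
        \<comment> \<open>Off \<open>Bad\<close> the von Neumann theorem for primes applies; on
          \<open>Bad\<close>, a small proportion of \<open>I\<close>, the means are bounded by
          1.\<close>
        have "(\<Sum>x\<in>I. \<Sum>p\<in>P. \<bar>dilate_mean (liouville_window k x) hs J (int p)\<bar>) \<le> (\<Sum>x\<in>I. \<epsilon>1 * n + (if x \<in> Bad then n else 0))"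
        proof (rule sum_mono)
          fix x assume x: "x \<in> I"
          show "(\<Sum>p\<in>P. \<bar>dilate_mean (liouville_window k x) hs J (int p)\<bar>) \<le> \<epsilon>1 * n + (if x \<in> Bad then n else 0)"
          proof (cases "x \<in> Bad")
            case True
            have "(\<Sum>p\<in>P. \<bar>dilate_mean (liouville_window k x) hs J (int p)\<bar>) \<le> (\<Sum>p\<in>P. 1)"
              using k by (intro sum_mono abs_dilate_mean_le abs_liouville_window_le) (simp add: J_def)
            moreover have "0 \<le> \<epsilon>1 * n" using \<epsilon>1 n0 by simp
            ultimately show ?thesis using True by (simp add: n_def)
          next
            case False
            have eq: "length hs + 3 = q + 2" by (simp add: q_def)
            have "gowers_sq (int k) (Suc (length hs)) (liouville_window k x) \<le> \<delta> * real k ^ (length hs + 3)"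
              unfolding eq q_def[symmetric] using False x by (simp add: Bad_def not_less del: gowers_sq.simps)
            then have "(\<Sum>p\<in>P. \<bar>dilate_mean (liouville_window k x) hs J (int p)\<bar>) \<le> \<epsilon>1 * n"
              unfolding P_def J_def D_def n_def
              by (intro vn[OF k(2) abs_liouville_window_le]) (auto simp: liouville_window_def)
            then show ?thesis using False by simp
          qed
        qed
        also have "\<dots> = \<epsilon>1 * n * real N + n * real (card Bad)"
        proof -
          have "I \<inter> Bad = Bad" by (auto simp: Bad_def)
          moreover have "(\<Sum>x\<in>I. if x \<in> Bad then n else 0) = (\<Sum>x\<in>I \<inter> Bad. n)"
            by (rule sum.inter_restrict[symmetric]) (simp add: I_def)
          ultimately show ?thesis by (simp add: sum.distrib I_def mult_ac)
        qed
        also have "n * real (card Bad) \<le> n * (\<epsilon>1 * real N)" using bad n0 by (intro mult_left_mono) auto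
        finally show ?thesis by (simp add: mult_ac)
      qed
      finally have "\<bar>Q\<bar> \<le> 5 * (\<epsilon>1 * n * real N)" by simp
      also have "\<dots> \<le> \<epsilon> * n * real N"
        using \<epsilon> n0 by (simp add: \<epsilon>1_def)
      finally show "\<bar>\<Sum>p\<in>big_primes (k div (2 * M)). real p * (\<Sum>n\<in>dilated_range (scale_length (\<kappa> / 20) \<Psi> k) p. tuple_prod hs 1 n)\<bar>
         \<le> \<epsilon> * real (card (big_primes (k div (2 * M)))) * real (scale_length (\<kappa> / 20) \<Psi> k)"
        by (simp add: Q_def P_def D_def N_def n_def)
    qed
  qed
qed

text \<open>The product of the factors 1 + w i \<lambda>(n + i) is 2^M if the pattern occurs at n,
  and 0 otherwise. Multiplied out and summed, its empty term is at least card P * N / 2, as 2p \<le>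
  N, while each of the 2^M - 1 others is at most card P * N / 2^(M+1). So the total is
  positive.\<close>

lemma pattern_occurs:
  fixes w :: "nat \<Rightarrow> int"
  assumes P: "finite P" "P \<noteq> {}" "\<And>p. p \<in> P \<Longrightarrow> 0 < p \<and> 2 * p \<le> N" and w: "\<And>i. i \<in> {1..M} \<Longrightarrow> w i \<in> {- 1, 1}"
    and corr: "\<And>B. B \<subseteq> {1..M} \<Longrightarrow> B \<noteq> {} \<Longrightarrow>
      \<bar>\<Sum>p\<in>P. real p * (\<Sum>n\<in>dilated_range N p. tuple_prod (sorted_list_of_set B) 1 n)\<bar> \<le> real (card P) * real N / 2 ^ (M + 1)"
  obtains n where "n \<ge> 1" "\<And>i. i \<in> {1..M} \<Longrightarrow> liouville (n + int i) = w i"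
proof -
  define Q where "Q B = (\<Sum>p\<in>P. real p * (\<Sum>n\<in>dilated_range N p. tuple_prod (sorted_list_of_set B) 1 n))" for B
  define W where "W B = (\<Prod>i\<in>B. real_of_int (w i))" for B
  define F where "F n = (\<Prod>i\<in>{1..M}. real_of_int (w i) * real_of_int (liouville (n + int i)) + 1)" for n
  have F: "F n = (\<Sum>B\<in>Pow {1..M}. W B * tuple_prod (sorted_list_of_set B) 1 n)" for n
  proof -
    have "F n = (\<Sum>B\<in>Pow {1..M}. (\<Prod>i\<in>B. real_of_int (w i) * real_of_int (liouville (n + int i))) * (\<Prod>i\<in>{1..M} - B. 1))"
      unfolding F_def by (rule prod_add) simp
    also have "\<dots> = (\<Sum>B\<in>Pow {1..M}. W B * tuple_prod (sorted_list_of_set B) 1 n)"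
    proof (rule sum.cong[OF refl])
      fix B assume "B \<in> Pow {1..M}"
      then have fin: "finite B" using finite_subset by auto
      have "tuple_prod (sorted_list_of_set B) 1 n = (\<Prod>i\<in>B. real_of_int (liouville (n + int i)))"
        unfolding tuple_prod_def using fin by (subst prod.distinct_set_conv_list[symmetric]) auto
      then show "(\<Prod>i\<in>B. real_of_int (w i) * real_of_int (liouville (n + int i))) * (\<Prod>i\<in>{1..M} - B. 1)
          = W B * tuple_prod (sorted_list_of_set B) 1 n"
        by (simp add: W_def prod.distrib)
    qed
    finally show ?thesis .
  qed
  have total: "(\<Sum>p\<in>P. real p * (\<Sum>n\<in>dilated_range N p. F n)) = (\<Sum>B\<in>Pow {1..M}. W B * Q B)"
  proof -
    have "(\<Sum>p\<in>P. real p * (\<Sum>n\<in>dilated_range N p. F n))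
        = (\<Sum>p\<in>P. \<Sum>B\<in>Pow {1..M}. W B * (real p * (\<Sum>n\<in>dilated_range N p. tuple_prod (sorted_list_of_set B) 1 n)))"
      unfolding F by (subst sum.swap) (simp add: sum_distrib_left mult_ac)
    also have "\<dots> = (\<Sum>B\<in>Pow {1..M}. W B * Q B)"
      by (subst sum.swap) (simp add: Q_def sum_distrib_left)
    finally show ?thesis .
  qed
  define m where "m = real (card P)"
  have m: "m > 0" using P by (simp add: m_def card_gt_0_iff)
  obtain p0 where "p0 \<in> P" using P(2) by blast
  then have N0: "real N > 0" using P(3)[of p0] by auto
  have Q0: "Q {} \<ge> m * (real N / 2)"
  proof -
    have "m * (real N / 2) = (\<Sum>p\<in>P. real N / 2)" by (simp add: m_def)
    also have "\<dots> \<le> (\<Sum>p\<in>P. real p * real (card (dilated_range N p)))"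
    proof (rule sum_mono)
      fix p assume "p \<in> P"
      from P(3)[OF this] card_dilated_range_ge[of p N]
      show "real N / 2 \<le> real p * real (card (dilated_range N p))" by linarith
    qed
    also have "\<dots> = Q {}" by (simp add: Q_def tuple_prod_def)
    finally show ?thesis .
  qed
  have rest: "\<bar>\<Sum>B\<in>Pow {1..M} - {{}}. W B * Q B\<bar> \<le> real (2 ^ M - 1) * (m * real N / 2 ^ (M + 1))"
  proof -
    have "\<bar>\<Sum>B\<in>Pow {1..M} - {{}}. W B * Q B\<bar> \<le> (\<Sum>B\<in>Pow {1..M} - {{}}. m * real N / 2 ^ (M + 1))"
    proof (intro order.trans[OF sum_abs] sum_mono)
      fix B assume B: "B \<in> Pow {1..M} - {{}}"
      have "\<bar>W B\<bar> = 1" unfolding W_def abs_prod using B w by (intro prod.neutral) fastforce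
      then have "\<bar>W B * Q B\<bar> = \<bar>Q B\<bar>" by (simp add: abs_mult)
      then show "\<bar>W B * Q B\<bar> \<le> m * real N / 2 ^ (M + 1)" using corr[of B] B by (simp add: Q_def m_def)
    qed
    also have "\<dots> = real (2 ^ M - 1) * (m * real N / 2 ^ (M + 1))"
      by (simp add: card_Diff_singleton card_Pow)
    finally show ?thesis .
  qed
  have "(\<Sum>B\<in>Pow {1..M}. W B * Q B) = Q {} + (\<Sum>B\<in>Pow {1..M} - {{}}. W B * Q B)"
    by (subst sum.remove[of _ "{}"]) (auto simp: W_def)
  moreover have "real (2 ^ M - 1) * (m * real N / 2 ^ (M + 1)) < m * (real N / 2)"
  proof -
    have "real (2 ^ M - 1) < 2 ^ M" by (simp add: of_nat_diff)
    then have "real (2 ^ M - 1) * (m * real N / 2 ^ (M + 1)) < 2 ^ M * (m * real N / 2 ^ (M + 1))"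
      using m N0 by (intro mult_strict_right_mono) auto
    then show ?thesis by simp
  qed
  ultimately have pos: "(\<Sum>p\<in>P. real p * (\<Sum>n\<in>dilated_range N p. F n)) > 0"
    using Q0 rest unfolding total by linarith
  have "\<exists>p\<in>P. \<exists>n\<in>dilated_range N p. F n \<noteq> 0"
  proof (rule ccontr)
    assume "\<not> ?thesis"
    then have "(\<Sum>p\<in>P. real p * (\<Sum>n\<in>dilated_range N p. F n)) = 0" by (intro sum.neutral) auto
    with pos show False by simp
  qed
  then obtain p n where pn: "p \<in> P" "n \<in> dilated_range N p" "F n \<noteq> 0" by blast
  have "p > 0" using P(3)[OF pn(1)] by simp
  then have n1: "n \<ge> 1" using dilated_range_subset[of p N] pn(2) by auto
  have "liouville (n + int i) = w i" if i: "i \<in> {1..M}" for i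
  proof -
    have "real_of_int (w i) * real_of_int (liouville (n + int i)) + 1 \<noteq> 0"
      using pn(3) i by (auto simp: F_def)
    moreover have "liouville (n + int i) \<in> {- 1, 1}" using n1 by (intro liouville_pos) simp
    ultimately show ?thesis using w[OF i] by auto
  qed
  then show ?thesis using that n1 by blast
qed

theorem theorem5p1:
  fixes \<kappa> :: real and \<Psi> :: "real \<Rightarrow> real"
  assumes "0 < \<kappa>" and "\<kappa> < 1 / 2"
    and "strict_mono_on {1..} \<Psi>"
    and "\<forall>\<^sub>F X in at_top. X \<le> \<Psi> X \<and> \<Psi> X \<le> exp (X powr (1 / 2 - \<kappa>))"
    and "\<And>(k::nat) (\<eta>::real). \<eta> > 0 \<Longrightarrow>
      (\<lambda>X::real. integral {X..2 * X} (\<lambda>x.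
          local_gowers_norm (k + 1) x (x + increasing_inverse \<Psi> (X powr \<eta>))
            (\<lambda>n. of_int (liouville n)))) \<in> o[at_top](\<lambda>X. X)"
  shows "\<forall>\<^sub>F k :: nat in sequentially. real (sign_pattern_count k) \<ge> \<Psi> (real k)"
proof (rule ccontr)
  assume "\<not> ?thesis"
  then have bad: "\<exists>\<^sub>F k in sequentially. real (sign_pattern_count k) < \<Psi> (real k)"
    by (simp add: not_eventually not_le)
  have growth: "\<forall>\<^sub>F k in sequentially. real k \<le> \<Psi> (real k) \<and> \<Psi> (real k) \<le> exp (real k powr (1 / 2 - \<kappa>))"
    using assms(4) by (rule eventually_compose_filterlim) (rule filterlim_real_sequentially)
  have full: "sign_pattern_count M = 2 ^ M" if M: "M \<ge> 1" for M
  proof -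
    define L where "L = scale_length (\<kappa> / 20) \<Psi>"
    define D where "D k = k div (2 * M)" for k
    have "\<forall>\<^sub>F k in sequentially. \<forall>B\<in>Pow {1..M} - {{}}. real (sign_pattern_count k) < \<Psi> (real k) \<longrightarrow>
       \<bar>\<Sum>p\<in>big_primes (D k). real p * (\<Sum>n\<in>dilated_range (L k) p. tuple_prod (sorted_list_of_set B) 1 n)\<bar>
       \<le> 1 / 2 ^ (M + 1) * real (card (big_primes (D k))) * real (L k)"
    proof (rule eventually_ball_finite)
      show "\<forall>B\<in>Pow {1..M} - {{}}. \<forall>\<^sub>F k in sequentially. real (sign_pattern_count k) < \<Psi> (real k) \<longrightarrow>
       \<bar>\<Sum>p\<in>big_primes (D k). real p * (\<Sum>n\<in>dilated_range (L k) p. tuple_prod (sorted_list_of_set B) 1 n)\<bar>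
       \<le> 1 / 2 ^ (M + 1) * real (card (big_primes (D k))) * real (L k)"
      proof
        fix B assume B: "B \<in> Pow {1..M} - {{}}"
        then have "finite B" using finite_subset by auto
        then show "\<forall>\<^sub>F k in sequentially. real (sign_pattern_count k) < \<Psi> (real k) \<longrightarrow>
           \<bar>\<Sum>p\<in>big_primes (D k). real p * (\<Sum>n\<in>dilated_range (L k) p. tuple_prod (sorted_list_of_set B) 1 n)\<bar>
           \<le> 1 / 2 ^ (M + 1) * real (card (big_primes (D k))) * real (L k)"
          unfolding L_def D_def using B by (intro correlation_small[OF assms]) auto
      qed
    qed simp
    moreover have "\<forall>\<^sub>F k in sequentially. k \<ge> 16 * M + 2 \<and> D k > 0 \<and> big_primes (D k) \<noteq> {} \<and> 2 * D k \<le> L k"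
    proof -
      have "\<forall>\<^sub>F D in sequentially. big_primes D \<noteq> {}"
        using card_big_primes_lower eventually_ge_at_top[of 2]
      proof eventually_elim
        case (elim D)
        have "0 < real D / (12 * ln (real D))" using elim(2) by simp
        then have "card (big_primes D) > 0" using elim(1) by linarith
        then show ?case by auto
      qed
      moreover have "filterlim D sequentially sequentially"
        unfolding filterlim_at_top
      proof
        fix Z
        have "Z \<le> D k" if "k \<ge> Z * (2 * M)" for k
          using that M by (simp add: D_def less_eq_div_iff_mult_less_eq)
        then show "\<forall>\<^sub>F k in sequentially. Z \<le> D k" unfolding eventually_sequentially by blast
      qed
      ultimately have "\<forall>\<^sub>F k in sequentially. big_primes (D k) \<noteq> {}" by (rule eventually_compose_filterlim)
      then show ?thesis using growth eventually_ge_at_top[of "16 * M + 2"]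
      proof eventually_elim
        case (elim k)
        have D: "D k > 0" using elim(3) M by (auto simp: D_def div_greater_zero_iff)
        have "D k \<le> k div 2" unfolding D_def using M by (intro div_le_mono2) auto
        then have "2 * D k \<le> k" by linarith
        have "real k = real k powr 1" using elim(3) by simp
        also have "\<dots> \<le> real k powr (20 / \<kappa>)"
          using elim(3) assms(1,2) by (intro powr_mono) (auto simp: pos_le_divide_eq)
        also have "\<dots> \<le> \<Psi> (real k) powr (20 / \<kappa>)"
          using elim(2) assms(1) by (intro powr_mono2) auto
        finally have "k \<le> L k" unfolding L_def scale_length_def by (simp add: le_nat_floor)
        then show ?case using elim D \<open>2 * D k \<le> k\<close> by auto
      qed
    qed
    ultimately have ev: "\<forall>\<^sub>F k in sequentially. real (sign_pattern_count k) < \<Psi> (real k) \<longrightarrow>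
        PiE {1..M} (\<lambda>_. {- 1, 1}) \<subseteq> sign_patterns M"
    proof eventually_elim
      case (elim k)
      show ?case
      proof (intro impI subsetI)
        fix w assume few: "real (sign_pattern_count k) < \<Psi> (real k)" and w: "w \<in> PiE {1..M} (\<lambda>_. {- 1, 1 :: int})"
        have "\<exists>n\<ge>1. \<forall>i\<in>{1..M}. liouville (n + int i) = w i"
        proof (rule pattern_occurs[of "big_primes (D k)" "L k" M w])
          show "0 < p \<and> 2 * p \<le> L k" if "p \<in> big_primes (D k)" for p
            using that elim(2) by (auto simp: big_primes_def prime_gt_0_nat)
          show "\<bar>\<Sum>p\<in>big_primes (D k). real p * (\<Sum>n\<in>dilated_range (L k) p. tuple_prod (sorted_list_of_set B) 1 n)\<bar>
              \<le> real (card (big_primes (D k))) * real (L k) / 2 ^ (M + 1)" if "B \<subseteq> {1..M}" "B \<noteq> {}" for B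
            using elim(1) that few by auto
        qed (use elim(2) w in \<open>auto simp: PiE_iff\<close>)
        then obtain n where n: "n \<ge> 1" "\<forall>i\<in>{1..M}. liouville (n + int i) = w i" by blast
        then have "nat n \<ge> 1 \<and> (\<forall>i\<in>{1..M}. w i = liouville (int (nat n + i)))" by simp
        with w show "w \<in> sign_patterns M" unfolding sign_patterns_def by blast
      qed
    qed
    have "\<exists>\<^sub>F k in sequentially. PiE {1..M} (\<lambda>_. {- 1, 1 :: int}) \<subseteq> sign_patterns M"
      using bad by (rule frequently_rev_mp) (use ev in \<open>auto elim: eventually_mono\<close>)
    \<comment> \<open>The inclusion does not involve k, so a single suitable k is enough.\<close>
    then have "PiE {1..M} (\<lambda>_. {- 1, 1 :: int}) \<subseteq> sign_patterns M"
      using frequently_ex by blast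
    then have "sign_patterns M = PiE {1..M} (\<lambda>_. {- 1, 1 :: int})"
      by (auto simp: sign_patterns_def)
    then show ?thesis by (simp add: sign_pattern_count_def card_PiE numeral_2_eq_2)
  qed
  have "\<forall>\<^sub>F x::real in at_top. exp (x powr (1 / 2 - \<kappa>)) \<le> 2 powr x"
    using assms(1,2) by real_asymp
  then have "\<forall>\<^sub>F k in sequentially. exp (real k powr (1 / 2 - \<kappa>)) \<le> 2 powr real k"
    by (rule eventually_compose_filterlim) (rule filterlim_real_sequentially)
  then have "\<forall>\<^sub>F k in sequentially. \<not> real (sign_pattern_count k) < \<Psi> (real k)"
    using growth eventually_ge_at_top[of 1]
  proof eventually_elim
    case (elim k)
    then show ?case using full[of k] by (simp add: powr_realpow)
  qed
  with bad show False by (simp add: frequently_def)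
qed

end
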